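(* Let $i\colon\mathcal A\hookrightarrow\mathcal G$ be a pair of groupoids such that $\mathcal A$ is amenable. Let $V$ be a Banach $\mathcal G$-module with topological dual $V'$. Then for each integer $n\ge 2$ there is a canonical isometric isomorphism $$H_b^n(\mathcal G,\mathcal A;V')\longrightarrow H_b^n(\mathcal G;V'),$$ namely the map induced by the inclusion of the relative cochain complex $C_b^\ast(\mathcal G,\mathcal A;V')$ into $C_b^\ast(\mathcal G;V')$.
   Context: **Groupoids and modules.** A groupoid $\mathcal G$ is a small category in which all morphisms are invertible; $g\in\mathcal G$ means that $g$ is a morphism, with source $s(g)$ and target $t(g)$; $gh=g\circ h$ is defined if $s(g)=t(h)$. A pair of groupoids is a functor $i\colon\mathcal A\to\mathcal G$ between groupoids that is injective on objects and morphisms; we view it as an inclusion. A normed $\mathcal G$-module $V=(V_e)_{e\in\mathrm{ob}\,\mathcal G}$ is a family of normed real vector spaces with linear isometries $V_{s(g)}\to V_{t(g)}$, $v\mapsto g\cdot v$ ($g\in\mathcal G$), satisfying $g\cdot(h\cdot v)=(gh)\cdot v$ and $\mathrm{id}_e\cdot v=v$; it is a Banach $\mathcal G$-module if each $V_e$ is complete. A $\mathcal G$-map $f\colon V\to W$ is an equivariant family of bounded linear maps $f_e\colon V_e\to W_e$ with $\|f\|_\infty=\sup_e\|f_e\|<\infty$. $\mathbb R_{\mathcal G}$ is the family $(\mathbb R)_{e}$ with trivial action. $B(V,W)=(B(V_e,W_e))_e$ (bounded linear maps, operator norm) with action $(g\cdot f)(v)=g\cdot f(g^{-1}\cdot v)$;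 $V'=B(V,\mathbb R_{\mathcal G})$. The invariants are $V^{\mathcal G}=\{v\in\prod_e V_e\mid g\cdot v_{s(g)}=v_{t(g)}\ \forall g,\ \sup_e\|v_e\|<\infty\}$ with the sup-norm, and $B_{\mathcal G}(V,W)=B(V,W)^{\mathcal G}$. **Bounded cohomology.** $C_n(\mathcal G)_e$ is the real vector space with basis $P_n(\mathcal G)_e=\{(g_0,\dots,g_n)\in\mathcal G^{n+1}\mid s(g_i)=t(g_{i+1})\ (0\le i<n),\ t(g_0)=e\}$, with the $\ell^1$-norm, action $g\cdot(g_0,\dots,g_n)=(gg_0,g_1,\dots,g_n)$ and boundary $\partial_n(g_0,\dots,g_n)=\sum_{i=0}^{n-1}(-1)^i(g_0,\dots,g_ig_{i+1},\dots,g_n)+(-1)^n(g_0,\dots,g_{n-1})$. $C_b^\ast(\mathcal G;V)=B_{\mathcal G}(C_\ast(\mathcal G),V)$ and $C_b^\ast(\mathcal G,\mathcal A;V)=\{f\in C_b^\ast(\mathcal G;V)\mid f_e|_{C_\ast(\mathcal A)_e}=0\ \forall e\in\mathrm{ob}\,\mathcal A\}$. $H_b^\ast(\mathcal G;V)$ and $H_b^\ast(\mathcal G,\mathcal A;V)$ are their cohomologies, with semi-norm given by the infimum of the norms of representing cocycles; "isometric" refers to these semi-norms. **Amenability.** For a groupoid $\mathcal A$, let $\ell^\infty(\mathcal A,\mathbb R_{\mathcal A})$ be the normed $\mathcal A$-module with $\ell^\infty(\mathcal A,\mathbb R_{\mathcal A})_e=\ell^\infty(t^{-1}(e),\mathbb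 R)$ (sup-norm; $t^{-1}(e)$ is the set of morphisms of $\mathcal A$ ending in $e$) and action $(g\cdot\varphi)(h)=\varphi(g^{-1}h)$. $\mathcal A$ is amenable if there is an $\mathcal A$-map $m\colon\ell^\infty(\mathcal A,\mathbb R_{\mathcal A})\to\mathbb R_{\mathcal A}$ with $\|m\|_\infty=1$ that maps each constant function to its value. *)

theory Defs
  imports "HOL-Analysis.Analysis" "HOL-Analysis.Finite_Function_Topology"
    "HOL-Algebra.AbelCoset" "HOL-Algebra.Module"
begin

section \<open>Normed real vector spaces with explicit carriers\<close>

text \<open>The spaces below form families indexed by the objects of a groupoid, so they cannot be types.
  They are modules over the field of real numbers in the sense of HOL-Algebra together with a norm.
  The fields \<open>mult\<close> and \<open>one\<close> that a module record inherits play no role, here as in HOL-Algebra.\<close>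

definition real_ring :: "real ring" where
  "real_ring = \<lparr>carrier = UNIV, mult = (*), one = 1, zero = 0, add = (+)\<rparr>"

record 'v nspace = "(real, 'v) module" +
  vnorm :: "'v \<Rightarrow> real"

locale normed_space = Module.module real_ring V for V :: "'v nspace" +
  assumes vnorm_eq_0_iff: "x \<in> carrier V \<Longrightarrow> vnorm V x = 0 \<longleftrightarrow> x = \<zero>\<^bsub>V\<^esub>"
    and vnorm_smult: "x \<in> carrier V \<Longrightarrow> vnorm V (r \<odot>\<^bsub>V\<^esub> x) = \<bar>r\<bar> * vnorm V x"
    and vnorm_triangle:
      "\<lbrakk>x \<in> carrier V; y \<in> carrier V\<rbrakk> \<Longrightarrow> vnorm V (x \<oplus>\<^bsub>V\<^esub> y) \<le> vnorm V x + vnorm V y"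

text \<open>The distance is set to 0 off the carrier because the locale \<^locale>\<open>Metric_space\<close> wants a
  nonnegative symmetric function on the whole type.\<close>

definition vdist :: "'v nspace \<Rightarrow> 'v \<Rightarrow> 'v \<Rightarrow> real" where
  "vdist V x y = (if x \<in> carrier V \<and> y \<in> carrier V then vnorm V (x \<ominus>\<^bsub>V\<^esub> y) else 0)"

locale banach_space = normed_space +
  assumes complete: "Metric_space.mcomplete (carrier V) (vdist V)"

definition linear_map :: "'v nspace \<Rightarrow> 'w nspace \<Rightarrow> ('v \<Rightarrow> 'w) \<Rightarrow> bool" where
  "linear_map V W f \<longleftrightarrow>
     f \<in> carrier V \<rightarrow> carrier W \<and>
     (\<forall>x\<in>carrier V. \<forall>y\<in>carrier V. f (x \<oplus>\<^bsub>V\<^esub> y) = f x \<oplus>\<^bsub>W\<^esub> f y) \<and>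
     (\<forall>r. \<forall>x\<in>carrier V. f (r \<odot>\<^bsub>V\<^esub> x) = r \<odot>\<^bsub>W\<^esub> f x)"

definition isometric_on :: "'v nspace \<Rightarrow> 'w nspace \<Rightarrow> ('v \<Rightarrow> 'w) \<Rightarrow> bool" where
  "isometric_on V W f \<longleftrightarrow> (\<forall>x\<in>carrier V. vnorm W (f x) = vnorm V x)"

definition isometric_isomorphism :: "'v nspace \<Rightarrow> 'w nspace \<Rightarrow> ('v \<Rightarrow> 'w) \<Rightarrow> bool" where
  "isometric_isomorphism V W f \<longleftrightarrow>
     linear_map V W f \<and> bij_betw f (carrier V) (carrier W) \<and> isometric_on V W f"

definition bounded_map :: "'v nspace \<Rightarrow> 'w nspace \<Rightarrow> ('v \<Rightarrow> 'w) \<Rightarrow> bool" where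
  "bounded_map V W f \<longleftrightarrow>
     linear_map V W f \<and> (\<exists>K. \<forall>x\<in>carrier V. vnorm W (f x) \<le> K * vnorm V x)"

definition op_norm :: "'v nspace \<Rightarrow> 'w nspace \<Rightarrow> ('v \<Rightarrow> 'w) \<Rightarrow> real" where
  "op_norm V W f = (SUP x\<in>{x \<in> carrier V. vnorm V x \<le> 1}. vnorm W (f x))"

definition bounded_maps :: "'v nspace \<Rightarrow> 'w nspace \<Rightarrow> ('v \<Rightarrow> 'w) nspace" where
  "bounded_maps V W =
    \<lparr>carrier = {f \<in> extensional (carrier V). bounded_map V W f},
     mult = undefined, one = undefined,
     zero = (\<lambda>x\<in>carrier V. \<zero>\<^bsub>W\<^esub>),
     add = (\<lambda>f g. \<lambda>x\<in>carrier V. f x \<oplus>\<^bsub>W\<^esub> g x),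
     smult = (\<lambda>r f. \<lambda>x\<in>carrier V. r \<odot>\<^bsub>W\<^esub> f x),
     vnorm = op_norm V W\<rparr>"

definition real_space :: "real nspace" where
  "real_space = \<lparr>carrier = UNIV, mult = undefined, one = undefined,
     zero = 0, add = (+), smult = (*), vnorm = abs\<rparr>"

text \<open>The supremum of a set of nonnegative reals, with value 0 for the empty set.\<close>

definition sup0 :: "real set \<Rightarrow> real" where
  "sup0 S = Sup (insert 0 S)"


section \<open>Groupoids and pairs of groupoids\<close>

text \<open>\<open>cmp G g h\<close> is \<open>g\<close> after \<open>h\<close>; it is meaningful if \<open>src G g = tgt G h\<close>.\<close>

record ('o, 'm) gpd =
  objs :: "'o set"
  arrs :: "'m set"
  src :: "'m \<Rightarrow> 'o"
  tgt :: "'m \<Rightarrow> 'o"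
  cmp :: "'m \<Rightarrow> 'm \<Rightarrow> 'm"
  idn :: "'o \<Rightarrow> 'm"

definition is_inverse :: "('o, 'm) gpd \<Rightarrow> 'm \<Rightarrow> 'm \<Rightarrow> bool" where
  "is_inverse G g h \<longleftrightarrow>
     h \<in> arrs G \<and> src G h = tgt G g \<and> tgt G h = src G g \<and>
     cmp G h g = idn G (src G g) \<and> cmp G g h = idn G (tgt G g)"

definition ginv :: "('o, 'm) gpd \<Rightarrow> 'm \<Rightarrow> 'm" where
  "ginv G g = (THE h. is_inverse G g h)"

locale groupoid =
  fixes G :: "('o, 'm) gpd"
  assumes src_closed: "g \<in> arrs G \<Longrightarrow> src G g \<in> objs G"
    and tgt_closed: "g \<in> arrs G \<Longrightarrow> tgt G g \<in> objs G"
    and cmp_closed: "\<lbrakk>g \<in> arrs G; h \<in> arrs G; src G g = tgt G h\<rbrakk> \<Longrightarrow> cmp G g h \<in> arrs G"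
    and src_cmp: "\<lbrakk>g \<in> arrs G; h \<in> arrs G; src G g = tgt G h\<rbrakk> \<Longrightarrow> src G (cmp G g h) = src G h"
    and tgt_cmp: "\<lbrakk>g \<in> arrs G; h \<in> arrs G; src G g = tgt G h\<rbrakk> \<Longrightarrow> tgt G (cmp G g h) = tgt G g"
    and cmp_assoc: "\<lbrakk>g \<in> arrs G; h \<in> arrs G; k \<in> arrs G; src G g = tgt G h; src G h = tgt G k\<rbrakk>
      \<Longrightarrow> cmp G (cmp G g h) k = cmp G g (cmp G h k)"
    and idn_closed: "e \<in> objs G \<Longrightarrow> idn G e \<in> arrs G"
    and src_idn: "e \<in> objs G \<Longrightarrow> src G (idn G e) = e"
    and tgt_idn: "e \<in> objs G \<Longrightarrow> tgt G (idn G e) = e"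
    and cmp_idn_left: "g \<in> arrs G \<Longrightarrow> cmp G (idn G (tgt G g)) g = g"
    and cmp_idn_right: "g \<in> arrs G \<Longrightarrow> cmp G g (idn G (src G g)) = g"
    and invertible: "g \<in> arrs G \<Longrightarrow> \<exists>h. is_inverse G g h"

text \<open>A functor is given by its object part \<open>io\<close> and its morphism part \<open>ia\<close>.\<close>

locale groupoid_pair = A: groupoid A + G: groupoid G
  for A :: "('p, 'q) gpd" and G :: "('o, 'm) gpd" and io :: "'p \<Rightarrow> 'o" and ia :: "'q \<Rightarrow> 'm" +
  assumes io_closed: "e \<in> objs A \<Longrightarrow> io e \<in> objs G"
    and ia_closed: "a \<in> arrs A \<Longrightarrow> ia a \<in> arrs G"
    and src_ia: "a \<in> arrs A \<Longrightarrow> src G (ia a) = io (src A a)"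
    and tgt_ia: "a \<in> arrs A \<Longrightarrow> tgt G (ia a) = io (tgt A a)"
    and ia_cmp: "\<lbrakk>a \<in> arrs A; b \<in> arrs A; src A a = tgt A b\<rbrakk>
      \<Longrightarrow> ia (cmp A a b) = cmp G (ia a) (ia b)"
    and ia_idn: "e \<in> objs A \<Longrightarrow> ia (idn A e) = idn G (io e)"
    and inj_io: "inj_on io (objs A)"
    and inj_ia: "inj_on ia (arrs A)"


section \<open>Normed modules over a groupoid\<close>

record ('o, 'm, 'v) gmod =
  fib :: "'o \<Rightarrow> 'v nspace"
  act :: "'m \<Rightarrow> 'v \<Rightarrow> 'v"

locale normed_gmodule = groupoid G for G :: "('o, 'm) gpd" +
  fixes V :: "('o, 'm, 'v) gmod"
  assumes fib_normed: "e \<in> objs G \<Longrightarrow> normed_space (fib V e)"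
    and act_linear: "g \<in> arrs G \<Longrightarrow> linear_map (fib V (src G g)) (fib V (tgt G g)) (act V g)"
    and act_isometric: "g \<in> arrs G \<Longrightarrow> isometric_on (fib V (src G g)) (fib V (tgt G g)) (act V g)"
    and act_cmp: "\<lbrakk>g \<in> arrs G; h \<in> arrs G; src G g = tgt G h; v \<in> carrier (fib V (src G h))\<rbrakk>
      \<Longrightarrow> act V g (act V h v) = act V (cmp G g h) v"
    and act_idn: "\<lbrakk>e \<in> objs G; v \<in> carrier (fib V e)\<rbrakk> \<Longrightarrow> act V (idn G e) v = v"

locale banach_gmodule = normed_gmodule +
  assumes fib_banach: "e \<in> objs G \<Longrightarrow> banach_space (fib V e)"

definition gmap_norm ::
  "('o, 'm) gpd \<Rightarrow> ('o, 'm, 'v) gmod \<Rightarrow> ('o, 'm, 'w) gmod \<Rightarrow> ('o \<Rightarrow> 'v \<Rightarrow> 'w) \<Rightarrow> real" where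
  "gmap_norm G V W f = sup0 ((\<lambda>e. op_norm (fib V e) (fib W e) (f e)) ` objs G)"

definition is_gmap ::
  "('o, 'm) gpd \<Rightarrow> ('o, 'm, 'v) gmod \<Rightarrow> ('o, 'm, 'w) gmod \<Rightarrow> ('o \<Rightarrow> 'v \<Rightarrow> 'w) \<Rightarrow> bool" where
  "is_gmap G V W f \<longleftrightarrow>
     (\<forall>e\<in>objs G. bounded_map (fib V e) (fib W e) (f e)) \<and>
     (\<forall>g\<in>arrs G. \<forall>v\<in>carrier (fib V (src G g)). f (tgt G g) (act V g v) = act W g (f (src G g) v)) \<and>
     bdd_above ((\<lambda>e. op_norm (fib V e) (fib W e) (f e)) ` objs G)"

definition trivial_gmod :: "('o, 'm, real) gmod" where
  "trivial_gmod = \<lparr>fib = (\<lambda>e. real_space), act = (\<lambda>g x. x)\<rparr>"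

definition hom_gmod ::
  "('o, 'm) gpd \<Rightarrow> ('o, 'm, 'v) gmod \<Rightarrow> ('o, 'm, 'w) gmod \<Rightarrow> ('o, 'm, 'v \<Rightarrow> 'w) gmod" where
  "hom_gmod G V W =
    \<lparr>fib = (\<lambda>e. bounded_maps (fib V e) (fib W e)),
     act = (\<lambda>g f. \<lambda>v\<in>carrier (fib V (tgt G g)). act W g (f (act V (ginv G g) v)))\<rparr>"

definition dual_gmod :: "('o, 'm) gpd \<Rightarrow> ('o, 'm, 'v) gmod \<Rightarrow> ('o, 'm, 'v \<Rightarrow> real) gmod" where
  "dual_gmod G V = hom_gmod G V trivial_gmod"

definition invariants :: "('o, 'm) gpd \<Rightarrow> ('o, 'm, 'v) gmod \<Rightarrow> ('o \<Rightarrow> 'v) nspace" where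
  "invariants G V =
    \<lparr>carrier = {v \<in> (\<Pi>\<^sub>E e\<in>objs G. carrier (fib V e)).
        (\<forall>g\<in>arrs G. act V g (v (src G g)) = v (tgt G g)) \<and>
        bdd_above ((\<lambda>e. vnorm (fib V e) (v e)) ` objs G)},
     mult = undefined, one = undefined,
     zero = (\<lambda>e\<in>objs G. \<zero>\<^bsub>fib V e\<^esub>),
     add = (\<lambda>v w. \<lambda>e\<in>objs G. v e \<oplus>\<^bsub>fib V e\<^esub> w e),
     smult = (\<lambda>r v. \<lambda>e\<in>objs G. r \<odot>\<^bsub>fib V e\<^esub> v e),
     vnorm = (\<lambda>v. sup0 ((\<lambda>e. vnorm (fib V e) (v e)) ` objs G))\<rparr>"

definition bounded_gmaps ::
  "('o, 'm) gpd \<Rightarrow> ('o, 'm, 'v) gmod \<Rightarrow> ('o, 'm, 'w) gmod \<Rightarrow> ('o \<Rightarrow> 'v \<Rightarrow> 'w) nspace" where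
  "bounded_gmaps G V W = invariants G (hom_gmod G V W)"


section \<open>Amenability\<close>

definition linf_gmod :: "('o, 'm) gpd \<Rightarrow> ('o, 'm, 'm \<Rightarrow> real) gmod" where
  "linf_gmod A =
    \<lparr>fib = (\<lambda>e. let T = {h \<in> arrs A. tgt A h = e} in
       \<lparr>carrier = {\<phi> \<in> extensional T. bdd_above ((\<lambda>h. \<bar>\<phi> h\<bar>) ` T)},
        mult = undefined, one = undefined,
        zero = (\<lambda>h\<in>T. 0),
        add = (\<lambda>\<phi> \<psi>. \<lambda>h\<in>T. \<phi> h + \<psi> h),
        smult = (\<lambda>r \<phi>. \<lambda>h\<in>T. r * \<phi> h),
        vnorm = (\<lambda>\<phi>. SUP h\<in>T. \<bar>\<phi> h\<bar>)\<rparr>),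
     act = (\<lambda>g \<phi>. \<lambda>h\<in>{h \<in> arrs A. tgt A h = tgt A g}. \<phi> (cmp A (ginv A g) h))\<rparr>"

definition amenable :: "('o, 'm) gpd \<Rightarrow> bool" where
  "amenable A \<longleftrightarrow>
     (\<exists>m. is_gmap A (linf_gmod A) trivial_gmod m \<and>
          gmap_norm A (linf_gmod A) trivial_gmod m = 1 \<and>
          (\<forall>e\<in>objs A. \<forall>r. m e (\<lambda>h\<in>{h \<in> arrs A. tgt A h = e}. r) = r))"


section \<open>Cochain complexes and their cohomology\<close>

record 'c cochain_cpx =
  cspace :: "nat \<Rightarrow> 'c nspace"
  cdiff :: "nat \<Rightarrow> 'c \<Rightarrow> 'c"

definition cocycles :: "'c cochain_cpx \<Rightarrow> nat \<Rightarrow> 'c nspace" where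
  "cocycles C n = (cspace C n)
     \<lparr>carrier := {f \<in> carrier (cspace C n). cdiff C n f = \<zero>\<^bsub>cspace C (Suc n)\<^esub>}\<rparr>"

fun coboundaries :: "'c cochain_cpx \<Rightarrow> nat \<Rightarrow> 'c set" where
  "coboundaries C 0 = {\<zero>\<^bsub>cspace C 0\<^esub>}"
| "coboundaries C (Suc n) = cdiff C n ` carrier (cspace C n)"

text \<open>The elements are the cosets of the coboundaries in the cocycles, and the field \<open>vnorm\<close> holds
  the semi-norm, which need not be a norm.\<close>

definition cohomology :: "'c cochain_cpx \<Rightarrow> nat \<Rightarrow> 'c set nspace" where
  "cohomology C n = (let Z = cocycles C n; B = coboundaries C n in
    \<lparr>carrier = a_rcosets\<^bsub>Z\<^esub> B,
     mult = undefined, one = undefined,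
     zero = B,
     add = set_add Z,
     smult = (\<lambda>r X. \<Union>x\<in>X. B +>\<^bsub>Z\<^esub> (r \<odot>\<^bsub>Z\<^esub> x)),
     vnorm = (\<lambda>X. INF x\<in>X. vnorm Z x)\<rparr>)"

text \<open>The map sending the class of \<open>x\<close> in \<open>C\<close> to the class of \<open>\<phi> x\<close> in \<open>D\<close>.\<close>

definition induced_map ::
  "'c cochain_cpx \<Rightarrow> 'd cochain_cpx \<Rightarrow> (nat \<Rightarrow> 'c \<Rightarrow> 'd) \<Rightarrow> nat \<Rightarrow> 'c set \<Rightarrow> 'd set" where
  "induced_map C D \<phi> n =
     (\<lambda>X\<in>carrier (cohomology C n). \<Union>x\<in>X. coboundaries D n +>\<^bsub>cocycles D n\<^esub> \<phi> n x)"


section \<open>Bounded cohomology of groupoids\<close>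

definition simplices :: "('o, 'm) gpd \<Rightarrow> nat \<Rightarrow> 'o \<Rightarrow> 'm list set" where
  "simplices G n e =
    {gs. length gs = Suc n \<and> set gs \<subseteq> arrs G \<and>
         (\<forall>i<n. src G (gs ! i) = tgt G (gs ! Suc i)) \<and> tgt G (gs ! 0) = e}"

text \<open>Formal real linear combinations; the norm that the library puts on them is the sum of the
  absolute values of the coefficients.\<close>

type_synonym 'a fin_comb = "('a, real) poly_mapping"

definition lin_ext :: "('a \<Rightarrow> 'b fin_comb) \<Rightarrow> 'a fin_comb \<Rightarrow> 'b fin_comb" where
  "lin_ext F c = (\<Sum>x\<in>Poly_Mapping.keys c. Poly_Mapping.lookup c x *\<^sub>R F x)"

definition chains :: "('o, 'm) gpd \<Rightarrow> nat \<Rightarrow> ('o, 'm, 'm list fin_comb) gmod" where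
  "chains G n =
    \<lparr>fib = (\<lambda>e. \<lparr>carrier = {c. Poly_Mapping.keys c \<subseteq> simplices G n e},
        mult = undefined, one = undefined,
        zero = 0, add = (+), smult = (*\<^sub>R), vnorm = norm\<rparr>),
     act = (\<lambda>g. lin_ext (\<lambda>gs. Poly_Mapping.single (cmp G g (hd gs) # tl gs) 1))\<rparr>"

definition inner_face :: "('o, 'm) gpd \<Rightarrow> nat \<Rightarrow> 'm list \<Rightarrow> 'm list" where
  "inner_face G i gs = take i gs @ [cmp G (gs ! i) (gs ! Suc i)] @ drop (i + 2) gs"

text \<open>The last summand is the face that drops the final entry. Only used for \<open>n \<ge> 1\<close>.\<close>

definition boundary ::
  "('o, 'm) gpd \<Rightarrow> nat \<Rightarrow> 'm list fin_comb \<Rightarrow> 'm list fin_comb" where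
  "boundary G n = lin_ext (\<lambda>gs.
     (\<Sum>i<n. Poly_Mapping.single (inner_face G i gs) ((-1) ^ i)) +
     Poly_Mapping.single (butlast gs) ((-1) ^ n))"

definition bounded_cochains ::
  "('o, 'm) gpd \<Rightarrow> ('o, 'm, 'v) gmod \<Rightarrow> ('o \<Rightarrow> 'm list fin_comb \<Rightarrow> 'v) cochain_cpx" where
  "bounded_cochains G V =
    \<lparr>cspace = (\<lambda>n. bounded_gmaps G (chains G n) V),
     cdiff = (\<lambda>n f. \<lambda>e\<in>objs G. \<lambda>c\<in>carrier (fib (chains G (Suc n)) e). f e (boundary G (Suc n) c))\<rparr>"

text \<open>The map \<open>lin_ext (\<lambda>as. Poly_Mapping.single (map ia as) 1)\<close> is the inclusion of the chains of
  \<open>A\<close> at \<open>e\<close> into the chains of \<open>G\<close> at \<open>io e\<close>.\<close>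

definition relative_bounded_cochains ::
  "('p, 'q) gpd \<Rightarrow> ('o, 'm) gpd \<Rightarrow> ('p \<Rightarrow> 'o) \<Rightarrow> ('q \<Rightarrow> 'm) \<Rightarrow> ('o, 'm, 'v) gmod
    \<Rightarrow> ('o \<Rightarrow> 'm list fin_comb \<Rightarrow> 'v) cochain_cpx" where
  "relative_bounded_cochains A G io ia V =
    \<lparr>cspace = (\<lambda>n. (cspace (bounded_cochains G V) n)
       \<lparr>carrier := {f \<in> carrier (cspace (bounded_cochains G V) n).
          \<forall>e\<in>objs A. \<forall>c\<in>carrier (fib (chains A n) e).
            f (io e) (lin_ext (\<lambda>as. Poly_Mapping.single (map ia as) 1) c) = \<zero>\<^bsub>fib V (io e)\<^esub>}\<rparr>),
     cdiff = cdiff (bounded_cochains G V)\<rparr>"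

end

theory Submission
  imports Defs
begin

text \<open>In homogeneous coordinates an \<open>n\<close>-cochain with values in a dual module is a family of bounded
  functions of \<open>n + 1\<close> arrows \<open>x\<^sub>0, \<dots>, x\<^sub>n\<close> with a common target. Averaging each \<open>x\<^sub>i\<close> over
  \<open>x\<^sub>i a\<close> with \<open>a\<close> in the amenable subgroupoid and antisymmetrizing is a cochain map that does not
  increase norms. The averaged function only depends on the cosets of the \<open>x\<^sub>i\<close>, so antisymmetry makes it
  vanish on simplices of the subgroupoid in positive degrees. Like every natural augmented cochain
  map it is homotopic to the identity, by coning at \<open>x\<^sub>0\<close>, and the homotopy preserves the relative
  cochains since the means at points of the subgroupoid do not leave it. Surjectivity,
  injectivity and the comparison of norms follow formally.\<close>

section \<open>Alternating averages\<close>

text \<open>A mean integrates bounded real functions only. This is where dual coefficients enter: a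
  cochain evaluated at a fixed vector is such a function of the vertices, and linearity in the
  vector survives integration. The obstacle is that iterated means need not commute, so there is no
  Fubini theorem. Alternating the function and then integrating in a fixed order would in general
  not give zero when all means coincide. In \<open>avg\<close> the order of integration is tied to
  the argument positions instead, and the signed sum distributes the means over these positions.
  Equal means then give equal terms that cancel, and the sum still commutes with the coboundary. A
  vertex whose source lies outside the subgroupoid keeps its Dirac mean. The bound n >= 2 comes from
  injectivity: besides a cocycle of degree n, a primitive of degree n - 1 has to be averaged into a
  relative cochain, and in degree 0 the average on the subgroupoid is a mean value, which need not
  vanish.\<close>

definition del :: "nat \<Rightarrow> 'a list \<Rightarrow> 'a list" where
  "del i xs = take i xs @ drop (Suc i) xs"

lemma length_del [simp]: "i < length xs \<Longrightarrow> length (del i xs) = length xs - 1"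
  by (simp add: del_def)

lemma nth_del: "i < length xs \<Longrightarrow> j < length xs - 1 \<Longrightarrow> del i xs ! j = xs ! (if j < i then j else Suc j)"
  by (auto simp: del_def nth_append min_def)

lemma del_Cons_0 [simp]: "del 0 (x # xs) = xs"
  by (simp add: del_def)

lemma del_Cons_Suc [simp]: "del (Suc i) (x # xs) = x # del i xs"
  by (simp add: del_def)

lemma set_del_subset: "set (del i xs) \<subseteq> set xs"
  by (auto simp: del_def dest: in_set_takeD in_set_dropD)

lemma map_del: "map f (del i xs) = del i (map f xs)"
  by (simp add: del_def take_map drop_map)

lemma del_del:
  assumes "i < length xs" "j < length xs - 1"
  shows "del j (del i xs) = (if j < i then del (i - 1) (del j xs) else del i (del (Suc j) xs))"
  using assms by (intro nth_equalityI) (auto simp: nth_del)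

lemma del_replicate [simp]: "i < n \<Longrightarrow> del i (replicate n x) = replicate (n - 1) x"
  by (simp add: del_def flip: replicate_add)

text \<open>Deleting the \<open>i\<close>-th entry and then the \<open>j\<close>-th of the rest amounts to deleting two entries in
  the opposite order, at positions whose sum has the other parity.\<close>

lemma alternating_sum_swap:
  fixes A B :: "nat \<Rightarrow> nat \<Rightarrow> real"
  assumes less: "\<And>i j. i \<le> k \<Longrightarrow> j < i \<Longrightarrow> A i j = B j (i - 1)"
    and ge: "\<And>i j. j < k \<Longrightarrow> i \<le> j \<Longrightarrow> A i j = B (Suc j) i"
  shows "(\<Sum>i<Suc k. \<Sum>j<k. (-1) ^ (i + j) * A i j) = - (\<Sum>i<Suc k. \<Sum>j<k. (-1) ^ (i + j) * B i j)"
proof -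
  let ?P = "{..<Suc k} \<times> {..<k}"
  \<comment> \<open>\<open>?s\<close> is an involution of the index pairs that changes the parity of
    \<open>i + j\<close>, so it serves as its own inverse in the reindexing.\<close>
  let ?s = "\<lambda>(i, j). if j < i then (j, i - 1) else (Suc j, i)"
  have "(\<Sum>(i, j)\<in>?P. (-1) ^ (i + j) * A i j) = (\<Sum>(i, j)\<in>?P. - ((-1) ^ (i + j) * B i j))"
  proof (rule sum.reindex_bij_witness[where i = ?s and j = ?s], goal_cases)
    case (5 p)
    obtain i j where p: "p = (i, j)" by force
    show ?case
    proof (cases "j < i")
      case True
      then obtain l where "i = Suc l" by (cases i) auto
      with True 5 p less[of i j] show ?thesis by (auto simp: algebra_simps)
    next
      case False
      with 5 p ge[of j i] show ?thesis by (auto simp: algebra_simps)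
    qed
  qed (auto split: if_splits)
  then show ?thesis
    by (simp only: sum.cartesian_product sum_negf split_def)
qed

section \<open>The simplicial coboundary of functions on tuples\<close>

definition cob :: "('a list \<Rightarrow> real) \<Rightarrow> 'a list \<Rightarrow> real" where
  "cob f xs = (\<Sum>i<length xs. (-1) ^ i * f (del i xs))"

lemma cob_Nil [simp]: "cob f [] = 0"
  by (simp add: cob_def)

text \<open>Dual to the boundary d(y * c) = c - y * d(c) of a cone with apex \<open>y\<close>. Both
  the computation of \<open>avg (cob f)\<close> and the homotopy formula rest on this rule.\<close>

lemma cob_Cons: "cob f (y # ys) = f ys - cob (\<lambda>zs. f (y # zs)) ys"
  by (simp add: cob_def sum.lessThan_Suc_shift sum_negf del: sum.lessThan_Suc)

text \<open>\<open>alternating_sum_swap\<close> with the same family on both sides shows that the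
  double sum equals its own negative. Tuples with at most one entry have no pairs to delete.\<close>

lemma cob_cob: "cob (cob f) xs = 0"
proof (cases "length xs \<le> 1")
  case True
  then show ?thesis by (cases xs) (auto simp: cob_def)
next
  case False
  then obtain k where k: "length xs = Suc k" by (cases xs) auto
  have eq: "cob (cob f) xs = (\<Sum>i<Suc k. \<Sum>j<k. (-1) ^ (i + j) * f (del j (del i xs)))"
    by (simp add: cob_def k sum_distrib_left power_add mult.assoc del: sum.lessThan_Suc)
  have "(\<Sum>i<Suc k. \<Sum>j<k. (-1) ^ (i + j) * f (del j (del i xs)))
      = - (\<Sum>i<Suc k. \<Sum>j<k. (-1) ^ (i + j) * f (del j (del i xs)))"
  proof (rule alternating_sum_swap)
    show "f (del j (del i xs)) = f (del (i - 1) (del j xs))" if "i \<le> k" "j < i" for i j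
      using that k by (subst del_del) auto
    show "f (del j (del i xs)) = f (del i (del (Suc j) xs))" if "j < k" "i \<le> j" for i j
      using that k by (subst del_del) auto
  qed
  with eq show ?thesis by linarith
qed

lemma cob_add: "cob (\<lambda>ys. f ys + g ys) xs = cob f xs + cob g xs"
  by (simp add: cob_def distrib_left sum.distrib)

lemma cob_diff: "cob (\<lambda>ys. f ys - g ys) xs = cob f xs - cob g xs"
  by (simp add: cob_def right_diff_distrib sum_subtractf)

lemma cob_mult: "cob (\<lambda>ys. r * f ys) xs = r * cob f xs"
  by (simp add: cob_def sum_distrib_left mult.left_commute)

section \<open>Bounded functions on tuples, means and alternating averages\<close>

definition tuples :: "'a set \<Rightarrow> nat \<Rightarrow> 'a list set" where
  "tuples X k = {xs. length xs = k \<and> set xs \<subseteq> X}"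

lemma del_tuples: "xs \<in> tuples X (Suc k) \<Longrightarrow> i \<le> k \<Longrightarrow> del i xs \<in> tuples X k"
  using set_del_subset[of i xs] by (auto simp: tuples_def)

lemma cob_cong:
  assumes "xs \<in> tuples X (Suc k)" "\<And>ys. ys \<in> tuples X k \<Longrightarrow> f ys = g ys"
  shows "cob f xs = cob g xs"
  unfolding cob_def
  by (rule sum.cong[OF refl]) (use assms del_tuples[OF assms(1)] in \<open>auto simp: tuples_def\<close>)

lemma cob_map: "cob f (map p xs) = cob (\<lambda>ys. f (map p ys)) xs"
  by (simp add: cob_def map_del)

text \<open>Means are linear on bounded functions only, so bounds accompany every linearity
  statement. The constant is explicit because norms of cochains are read off from it, and because
  the bound 0 later expresses vanishing on all tuples in \<open>X\<close>.\<close>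

definition bounded_by :: "'a set \<Rightarrow> nat \<Rightarrow> real \<Rightarrow> ('a list \<Rightarrow> real) \<Rightarrow> bool" where
  "bounded_by X k K f \<longleftrightarrow> (\<forall>xs\<in>tuples X k. \<bar>f xs\<bar> \<le> K)"

lemma cob_bounded_by:
  assumes "bounded_by X k K f"
  shows "bounded_by X (Suc k) (real (Suc k) * K) (cob f)"
  unfolding bounded_by_def
proof
  fix xs assume xs: "xs \<in> tuples X (Suc k)"
  have "\<bar>cob f xs\<bar> \<le> (\<Sum>i<Suc k. \<bar>(-1) ^ i * f (del i xs)\<bar>)"
    using xs unfolding cob_def tuples_def by (simp del: sum.lessThan_Suc)
  also have "\<dots> \<le> (\<Sum>i<Suc k. K)"
    by (rule sum_mono)
      (use assms del_tuples[OF xs] in \<open>auto simp: bounded_by_def abs_mult power_abs\<close>)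
  finally show "\<bar>cob f xs\<bar> \<le> real (Suc k) * K"
    by (simp only: sum_constant card_lessThan)
qed

lemma bounded_by_Cons:
  assumes "bounded_by X (Suc k) K f" "y \<in> X"
  shows "bounded_by X k K (\<lambda>ys. f (y # ys))"
  unfolding bounded_by_def
proof
  fix ys assume "ys \<in> tuples X k"
  then have "y # ys \<in> tuples X (Suc k)" using assms(2) by (simp add: tuples_def)
  then show "\<bar>f (y # ys)\<bar> \<le> K" using assms(1) unfolding bounded_by_def by blast
qed

lemma bounded_by_add:
  assumes "bounded_by X k K f" "bounded_by X k L g"
  shows "bounded_by X k (K + L) (\<lambda>ys. f ys + g ys)"
  unfolding bounded_by_def
proof
  fix ys assume "ys \<in> tuples X k"
  then have "\<bar>f ys\<bar> \<le> K" "\<bar>g ys\<bar> \<le> L" using assms unfolding bounded_by_def by blast+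
  then show "\<bar>f ys + g ys\<bar> \<le> K + L" by linarith
qed

lemma bounded_by_mult:
  assumes "bounded_by X k K f"
  shows "bounded_by X k (\<bar>r\<bar> * K) (\<lambda>ys. r * f ys)"
  using assms unfolding bounded_by_def abs_mult by (intro ballI mult_left_mono) auto

text \<open>\<open>M\<close> accepts total functions, but \<open>cong\<close> says that only their
  values on \<open>X\<close> count, and linearity is demanded only for functions bounded there. In
  this form means can be nested and pushed forward without restricting functions at every
  stage.\<close>

locale is_mean =
  fixes X :: "'a set" and M :: "('a \<Rightarrow> real) \<Rightarrow> real"
  assumes add: "\<lbrakk>\<And>x. x \<in> X \<Longrightarrow> \<bar>\<phi> x\<bar> \<le> K; \<And>x. x \<in> X \<Longrightarrow> \<bar>\<psi> x\<bar> \<le> L\<rbrakk>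
      \<Longrightarrow> M (\<lambda>x. \<phi> x + \<psi> x) = M \<phi> + M \<psi>"
    and mult: "(\<And>x. x \<in> X \<Longrightarrow> \<bar>\<phi> x\<bar> \<le> K) \<Longrightarrow> M (\<lambda>x. r * \<phi> x) = r * M \<phi>"
    and bound: "(\<And>x. x \<in> X \<Longrightarrow> \<bar>\<phi> x\<bar> \<le> K) \<Longrightarrow> \<bar>M \<phi>\<bar> \<le> K"
    and cong: "(\<And>x. x \<in> X \<Longrightarrow> \<phi> x = \<psi> x) \<Longrightarrow> M \<phi> = M \<psi>"
    and const: "M (\<lambda>x. r) = r"

lemma mean_sum:
  assumes M: "is_mean X M" and "finite I" and "\<And>i x. i \<in> I \<Longrightarrow> x \<in> X \<Longrightarrow> \<bar>\<phi> i x\<bar> \<le> K"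
  shows "M (\<lambda>x. \<Sum>i\<in>I. \<phi> i x) = (\<Sum>i\<in>I. M (\<phi> i))"
  using assms(2,3)
proof (induction I)
  case empty
  then show ?case using is_mean.const[OF M] by simp
next
  case (insert j I)
  have "\<bar>\<Sum>i\<in>I. \<phi> i x\<bar> \<le> (\<Sum>i\<in>I. K)" if "x \<in> X" for x
    by (rule order_trans[OF sum_abs sum_mono]) (use insert that in auto)
  then have "M (\<lambda>x. \<phi> j x + (\<Sum>i\<in>I. \<phi> i x)) = M (\<phi> j) + M (\<lambda>x. \<Sum>i\<in>I. \<phi> i x)"
    using insert by (intro is_mean.add[OF M, of _ K]) auto
  with insert show ?case by simp
qed

text \<open>Replaces the vertices of a simplex by independent random points distributed according to the
  means \<open>Ms\<close> and antisymmetrizes: a random vertex comes first, and the recursion treats the others.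
  The antisymmetrization makes the result vanish if all means coincide.\<close>

primrec avg :: "nat \<Rightarrow> (('a \<Rightarrow> real) \<Rightarrow> real) list \<Rightarrow> ('a list \<Rightarrow> real) \<Rightarrow> real" where
  "avg 0 Ms f = f []"
| "avg (Suc k) Ms f =
     (\<Sum>i<Suc k. (-1) ^ i * (Ms ! i) (\<lambda>y. avg k (del i Ms) (\<lambda>ys. f (y # ys)))) / Suc k"

declare avg.simps(2) [simp del]

abbreviation means :: "'a set \<Rightarrow> nat \<Rightarrow> (('a \<Rightarrow> real) \<Rightarrow> real) list set" where
  "means X \<equiv> tuples {M. is_mean X M}"

lemma means_nth: "Ms \<in> means X (Suc k) \<Longrightarrow> i \<le> k \<Longrightarrow> is_mean X (Ms ! i)"
  unfolding tuples_def by (metis (mono_tags, lifting) le_imp_less_Suc mem_Collect_eq nth_mem subsetD)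

text \<open>Dividing by the number of summands makes each stage an average of signed terms of size
  at most \<open>K\<close>. That no constant is lost here is the source of the isometry.\<close>

lemma avg_bound: "Ms \<in> means X k \<Longrightarrow> bounded_by X k K f \<Longrightarrow> \<bar>avg k Ms f\<bar> \<le> K"
proof (induction k arbitrary: Ms f)
  case 0
  then show ?case by (auto simp: bounded_by_def tuples_def)
next
  case (Suc k)
  have "\<bar>\<Sum>i<Suc k. (-1) ^ i * (Ms ! i) (\<lambda>y. avg k (del i Ms) (\<lambda>ys. f (y # ys)))\<bar> \<le> (\<Sum>i<Suc k. K)"
  proof (rule order_trans[OF sum_abs sum_mono])
    fix i assume "i \<in> {..<Suc k}"
    then have "\<bar>(Ms ! i) (\<lambda>y. avg k (del i Ms) (\<lambda>ys. f (y # ys)))\<bar> \<le> K"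
      using Suc by (intro is_mean.bound[OF means_nth]) (auto intro!: Suc.IH bounded_by_Cons del_tuples)
    then show "\<bar>(-1) ^ i * (Ms ! i) (\<lambda>y. avg k (del i Ms) (\<lambda>ys. f (y # ys)))\<bar> \<le> K"
      by (simp add: abs_mult power_abs)
  qed
  then show ?case
    by (simp add: avg.simps(2) abs_mult pos_divide_le_eq mult.commute del: sum.lessThan_Suc of_nat_Suc)
qed

lemma avg_cong:
  "Ms \<in> means X k \<Longrightarrow> (\<And>xs. xs \<in> tuples X k \<Longrightarrow> f xs = g xs) \<Longrightarrow> avg k Ms f = avg k Ms g"
proof (induction k arbitrary: Ms f g)
  case 0
  then show ?case by (simp add: tuples_def)
next
  case (Suc k)
  have "(Ms ! i) (\<lambda>y. avg k (del i Ms) (\<lambda>ys. f (y # ys)))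
      = (Ms ! i) (\<lambda>y. avg k (del i Ms) (\<lambda>ys. g (y # ys)))" if "i < Suc k" for i
    by (rule is_mean.cong[OF means_nth[OF Suc.prems(1)]])
      (use that Suc.prems(2) in \<open>auto intro!: Suc.IH del_tuples[OF Suc.prems(1)] simp: tuples_def\<close>)
  then show ?case by (simp add: avg.simps(2) del: sum.lessThan_Suc of_nat_Suc)
qed

lemma avg_add:
  "Ms \<in> means X k \<Longrightarrow> bounded_by X k K f \<Longrightarrow> bounded_by X k L g
    \<Longrightarrow> avg k Ms (\<lambda>xs. f xs + g xs) = avg k Ms f + avg k Ms g"
proof (induction k arbitrary: Ms f g)
  case 0
  then show ?case by simp
next
  case (Suc k)
  have "(Ms ! i) (\<lambda>y. avg k (del i Ms) (\<lambda>ys. f (y # ys) + g (y # ys)))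
      = (Ms ! i) (\<lambda>y. avg k (del i Ms) (\<lambda>ys. f (y # ys))) + (Ms ! i) (\<lambda>y. avg k (del i Ms) (\<lambda>ys. g (y # ys)))"
    if "i < Suc k" for i
  proof -
    note M = means_nth[OF Suc.prems(1), of i] and D = del_tuples[OF Suc.prems(1), of i]
    \<comment> \<open>The inductive hypothesis is available only for \<open>y\<close> in
      \<open>X\<close>, where the functions obtained by fixing the first vertex are bounded;
      \<open>cong\<close> asks for no more.\<close>
    have "(Ms ! i) (\<lambda>y. avg k (del i Ms) (\<lambda>ys. f (y # ys) + g (y # ys)))
      = (Ms ! i) (\<lambda>y. avg k (del i Ms) (\<lambda>ys. f (y # ys)) + avg k (del i Ms) (\<lambda>ys. g (y # ys)))"
      using that Suc.prems by (intro is_mean.cong[OF M] Suc.IH[OF D]) (auto intro: bounded_by_Cons)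
    also have "\<dots> = (Ms ! i) (\<lambda>y. avg k (del i Ms) (\<lambda>ys. f (y # ys)))
        + (Ms ! i) (\<lambda>y. avg k (del i Ms) (\<lambda>ys. g (y # ys)))"
      using that Suc.prems by (intro is_mean.add[OF M, of _ K _ L] avg_bound[OF D]) (auto intro: bounded_by_Cons)
    finally show ?thesis .
  qed
  then show ?case
    by (simp add: avg.simps(2) algebra_simps sum.distrib add_divide_distrib del: sum.lessThan_Suc of_nat_Suc)
qed

lemma avg_mult:
  "Ms \<in> means X k \<Longrightarrow> bounded_by X k K f \<Longrightarrow> avg k Ms (\<lambda>xs. r * f xs) = r * avg k Ms f"
proof (induction k arbitrary: Ms f)
  case 0
  then show ?case by simp
next
  case (Suc k)
  have "(Ms ! i) (\<lambda>y. avg k (del i Ms) (\<lambda>ys. r * f (y # ys)))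
      = r * (Ms ! i) (\<lambda>y. avg k (del i Ms) (\<lambda>ys. f (y # ys)))"
    if "i < Suc k" for i
  proof -
    note M = means_nth[OF Suc.prems(1), of i] and D = del_tuples[OF Suc.prems(1), of i]
    have "(Ms ! i) (\<lambda>y. avg k (del i Ms) (\<lambda>ys. r * f (y # ys)))
      = (Ms ! i) (\<lambda>y. r * avg k (del i Ms) (\<lambda>ys. f (y # ys)))"
      using that Suc.prems by (intro is_mean.cong[OF M] Suc.IH[OF D]) (auto intro: bounded_by_Cons)
    also have "\<dots> = r * (Ms ! i) (\<lambda>y. avg k (del i Ms) (\<lambda>ys. f (y # ys)))"
      using that Suc.prems by (intro is_mean.mult[OF M, of _ K] avg_bound[OF D]) (auto intro: bounded_by_Cons)
    finally show ?thesis .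
  qed
  then show ?case
    by (simp add: avg.simps(2) sum_distrib_left mult.left_commute del: sum.lessThan_Suc of_nat_Suc)
qed

lemma avg_diff:
  assumes "Ms \<in> means X k" "bounded_by X k K f" "bounded_by X k L g"
  shows "avg k Ms (\<lambda>xs. f xs - g xs) = avg k Ms f - avg k Ms g"
  using avg_add[OF assms(1,2) bounded_by_mult[OF assms(3), of "-1"]] avg_mult[OF assms(1,3), of "-1"]
  by simp

text \<open>Drawing points and then applying \<open>p\<close> is the same as pulling
  \<open>f\<close> back along \<open>p\<close>; the recursion treats the means as black boxes. With
  \<open>p\<close> a left multiplication this becomes equivariance of the average.\<close>

lemma avg_map:
  "length Ms = k \<Longrightarrow> avg k (map (\<lambda>M \<phi>. M (\<lambda>x. \<phi> (p x))) Ms) f = avg k Ms (\<lambda>xs. f (map p xs))"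
proof (induction k arbitrary: Ms f)
  case 0
  then show ?case by simp
next
  case (Suc k)
  then show ?case by (simp add: avg.simps(2) flip: map_del del: sum.lessThan_Suc of_nat_Suc)
qed

text \<open>Expanding the first vertex turns \<open>avg (cob f)\<close> into one copy of the right-hand side and, by
  induction and the sign rule for deleting two vertices, \<open>k\<close> further ones.\<close>

lemma avg_cob:
  "Ms \<in> means X (Suc k) \<Longrightarrow> bounded_by X k K f
    \<Longrightarrow> avg (Suc k) Ms (cob f) = (\<Sum>i<Suc k. (-1) ^ i * avg k (del i Ms) f)"
proof (induction k arbitrary: Ms f)
  case 0
  then have "is_mean X (Ms ! 0)" by (simp add: means_nth)
  from is_mean.const[OF this] show ?case by (simp add: avg.simps(2) cob_Cons)
next
  case (Suc k)
  \<comment> \<open>In \<open>a i j\<close> the mean at \<open>i\<close> integrates the first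
    argument and the \<open>j\<close>-th of the remaining means is discarded; in
    \<open>b i j\<close> these roles are exchanged. Either way the same two means leave the list, so
    the swap of indices turns \<open>a\<close> into \<open>b\<close>.\<close>
  define a where "a i j = ((Ms ! i) (\<lambda>y. avg k (del j (del i Ms)) (\<lambda>ys. f (y # ys))))" for i j
  define b where "b i j = ((del i Ms ! j) (\<lambda>y. avg k (del j (del i Ms)) (\<lambda>ys. f (y # ys))))" for i j
  have step: "(Ms ! i) (\<lambda>y. avg (Suc k) (del i Ms) (\<lambda>ys. cob f (y # ys)))
      = avg (Suc k) (del i Ms) f - (\<Sum>j<Suc k. (-1) ^ j * a i j)" if i: "i < Suc (Suc k)" for i
  proof -
    note M = means_nth[OF Suc.prems(1), of i] and D = del_tuples[OF Suc.prems(1), of i]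
    note DD = del_tuples[OF D]
    have "avg (Suc k) (del i Ms) (\<lambda>ys. cob f (y # ys))
       = avg (Suc k) (del i Ms) f + (\<Sum>j<Suc k. - ((-1) ^ j) * avg k (del j (del i Ms)) (\<lambda>ys. f (y # ys)))"
      if y: "y \<in> X" for y
    proof -
      have B: "bounded_by X k K (\<lambda>ys. f (y # ys))"
        using Suc.prems(2) y by (rule bounded_by_Cons)
      have "avg (Suc k) (del i Ms) (\<lambda>ys. cob f (y # ys))
          = avg (Suc k) (del i Ms) f - avg (Suc k) (del i Ms) (cob (\<lambda>ys. f (y # ys)))"
        unfolding cob_Cons using i by (intro avg_diff[OF D Suc.prems(2) cob_bounded_by[OF B]]) auto
      also have "avg (Suc k) (del i Ms) (cob (\<lambda>ys. f (y # ys)))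
          = (\<Sum>j<Suc k. (-1) ^ j * avg k (del j (del i Ms)) (\<lambda>ys. f (y # ys)))"
        using i by (intro Suc.IH[OF D B]) auto
      finally show ?thesis by (simp add: sum_negf)
    qed
    then have "(Ms ! i) (\<lambda>y. avg (Suc k) (del i Ms) (\<lambda>ys. cob f (y # ys)))
      = (Ms ! i) (\<lambda>y. avg (Suc k) (del i Ms) f
          + (\<Sum>j<Suc k. - ((-1) ^ j) * avg k (del j (del i Ms)) (\<lambda>ys. f (y # ys))))"
      using i by (intro is_mean.cong[OF M]) auto
    also have "\<dots> = (Ms ! i) (\<lambda>y. avg (Suc k) (del i Ms) f)
        + (Ms ! i) (\<lambda>y. \<Sum>j<Suc k. - ((-1) ^ j) * avg k (del j (del i Ms)) (\<lambda>ys. f (y # ys)))"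
    proof (rule is_mean.add[OF M])
      fix y assume "y \<in> X"
      then have B: "bounded_by X k K (\<lambda>ys. f (y # ys))"
        using Suc.prems(2) by (intro bounded_by_Cons)
      show "\<bar>\<Sum>j<Suc k. - ((-1) ^ j) * avg k (del j (del i Ms)) (\<lambda>ys. f (y # ys))\<bar> \<le> (\<Sum>j<Suc k. K)"
        by (rule order_trans[OF sum_abs sum_mono])
          (use i in \<open>auto simp: abs_mult power_abs intro!: avg_bound[OF DD B]\<close>)
    qed (use i in auto)
    also have "(Ms ! i) (\<lambda>y. \<Sum>j<Suc k. - ((-1) ^ j) * avg k (del j (del i Ms)) (\<lambda>ys. f (y # ys)))
        = (\<Sum>j<Suc k. (Ms ! i) (\<lambda>y. - ((-1) ^ j) * avg k (del j (del i Ms)) (\<lambda>ys. f (y # ys))))"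
      by (rule mean_sum[OF M, of _ _ K])
        (use i Suc.prems(2) in \<open>auto simp: abs_mult power_abs intro!: avg_bound[OF DD] bounded_by_Cons\<close>)
    also have "\<dots> = (\<Sum>j<Suc k. - ((-1) ^ j) * a i j)"
      unfolding a_def
      by (intro sum.cong[OF refl] is_mean.mult[OF M, of _ K])
        (use i Suc.prems(2) in \<open>auto intro!: avg_bound[OF DD] bounded_by_Cons\<close>)
    finally show ?thesis
      using i by (simp add: is_mean.const[OF M] sum_negf del: sum.lessThan_Suc)
  qed
  have swap: "(\<Sum>i<Suc (Suc k). \<Sum>j<Suc k. (-1) ^ (i + j) * a i j)
      = - (\<Sum>i<Suc (Suc k). \<Sum>j<Suc k. (-1) ^ (i + j) * b i j)"
  proof (rule alternating_sum_swap)
    show "a i j = b j (i - 1)" if "i \<le> Suc k" "j < i" for i j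
      using that Suc.prems(1) del_del[of i Ms j] by (auto simp: a_def b_def nth_del tuples_def)
    show "a i j = b (Suc j) i" if "j < Suc k" "i \<le> j" for i j
      using that Suc.prems(1) del_del[of i Ms j] by (auto simp: a_def b_def nth_del tuples_def)
  qed
  have b: "(\<Sum>j<Suc k. (-1) ^ j * b i j) = Suc k * avg (Suc k) (del i Ms) f" for i
    by (simp add: b_def avg.simps(2) del: sum.lessThan_Suc of_nat_Suc)
  \<comment> \<open>Multiplication clears the denominator of \<open>avg\<close>. The constant terms
    of \<open>step\<close> give one copy of the claimed sum; the terms in \<open>a\<close>,
    rewritten through \<open>swap\<close> and \<open>b\<close>, give \<open>Suc k\<close>
    more.\<close>
  have "Suc (Suc k) * avg (Suc (Suc k)) Ms (cob f)
      = (\<Sum>i<Suc (Suc k). (-1) ^ i * (avg (Suc k) (del i Ms) f - (\<Sum>j<Suc k. (-1) ^ j * a i j)))"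
    unfolding avg.simps(2)[of "Suc k"] using step by (simp del: sum.lessThan_Suc of_nat_Suc)
  also have "\<dots> = (\<Sum>i<Suc (Suc k). (-1) ^ i * avg (Suc k) (del i Ms) f)
      - (\<Sum>i<Suc (Suc k). \<Sum>j<Suc k. (-1) ^ (i + j) * a i j)"
    by (simp add: right_diff_distrib sum_subtractf sum_distrib_left power_add mult.assoc
        del: sum.lessThan_Suc)
  also have "\<dots> = (\<Sum>i<Suc (Suc k). (-1) ^ i * avg (Suc k) (del i Ms) f)
      + (\<Sum>i<Suc (Suc k). (-1) ^ i * (\<Sum>j<Suc k. (-1) ^ j * b i j))"
    unfolding swap by (simp add: sum_distrib_left power_add mult.assoc del: sum.lessThan_Suc)
  also have "\<dots> = Suc (Suc k) * (\<Sum>i<Suc (Suc k). (-1) ^ i * avg (Suc k) (del i Ms) f)"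
    unfolding b by (simp add: sum_distrib_left algebra_simps sum.distrib del: sum.lessThan_Suc)
  finally show ?case by (rule mult_left_cancel[OF of_nat_neq_0, THEN iffD1])
qed

lemma alternating_sum_real: "(\<Sum>i<k. (-1) ^ i :: real) = (if even k then 0 else 1)"
  by (induction k) auto

text \<open>All summands agree up to sign, since deleting any entry of a constant list gives the
  same list. An even number of alternating signs cancels, whatever functional \<open>M\<close>
  is.\<close>

lemma avg_replicate_even:
  assumes "even k" "k > 0"
  shows "avg k (replicate k M) f = 0"
proof -
  obtain l where l: "k = Suc l" using assms(2) by (cases k) auto
  have "avg k (replicate k M) f
      = (\<Sum>i<k. (-1) ^ i) * M (\<lambda>y. avg l (replicate l M) (\<lambda>ys. f (y # ys))) / k"
    unfolding l avg.simps(2) sum_distrib_right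
    by (intro arg_cong2[where f = "(/)"] sum.cong refl) (auto simp del: replicate_Suc)
  with assms(1) show ?thesis by (simp add: alternating_sum_real)
qed

text \<open>For odd \<open>k\<close> the signs do not cancel, but after the first vertex is drawn an
  even, positive number of equal means remains, so the inner average is zero and \<open>M\<close> is
  applied to the zero function. For \<open>k = 1\<close> nothing cancels: the average is the mean of
  \<open>f\<close>.\<close>

lemma avg_replicate:
  assumes "is_mean X M" "k \<ge> 2"
  shows "avg k (replicate k M) f = 0"
proof (cases "even k")
  case False
  then obtain l where l: "k = Suc l" "even l" "l > 0" using assms(2) by (cases k) auto
  have "avg k (replicate k M) f
      = (\<Sum>i<k. (-1) ^ i * M (\<lambda>y. avg l (replicate l M) (\<lambda>ys. f (y # ys)))) / k"
    unfolding l avg.simps(2)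
    by (intro arg_cong2[where f = "(/)"] sum.cong refl) (auto simp del: replicate_Suc)
  also have "\<dots> = 0"
    unfolding avg_replicate_even[OF l(2,3)] is_mean.const[OF assms(1)] by simp
  finally show ?thesis .
next
  case True
  then show ?thesis using assms(2) by (intro avg_replicate_even) auto
qed

text \<open>The chain homotopy between two natural augmented chain maps, here the identity and the
  average, that comes from coning at the first vertex.\<close>

primrec hmt :: "('a \<Rightarrow> ('a \<Rightarrow> real) \<Rightarrow> real) \<Rightarrow> nat \<Rightarrow> ('a list \<Rightarrow> real) \<Rightarrow> 'a list \<Rightarrow> real" where
  "hmt \<mu> 0 f xs = 0"
| "hmt \<mu> (Suc k) f xs = avg (Suc k) (map \<mu> xs) (\<lambda>ys. f (hd xs # ys)) - f (hd xs # xs)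
     - cob (hmt \<mu> k (\<lambda>ys. f (hd xs # ys))) xs"

text \<open>Read off from the recursion of \<open>hmt\<close>: the average and the function
  contribute 1 each, and the coboundary sums \<open>Suc k\<close> faces of the previous stage. The
  size is immaterial. Its use is that \<open>hmt\<close> preserves boundedness and, for a function
  bounded by 0, gives 0.\<close>

primrec hmt_bound :: "nat \<Rightarrow> real" where
  "hmt_bound 0 = 0"
| "hmt_bound (Suc k) = 2 + Suc k * hmt_bound k"

lemma hmt_bound_nonneg: "hmt_bound k \<ge> 0"
  by (induction k) auto

text \<open>\<open>X\<close> has to be closed under the means at its points. Two instances matter:
  all arrows with a given target, where the homotopy lives, and the arrows of the subgroupoid with a
  given target, which show that the homotopy preserves relative cochains.\<close>

locale mean_system =
  fixes X :: "'a set" and \<mu> :: "'a \<Rightarrow> ('a \<Rightarrow> real) \<Rightarrow> real"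
  assumes mean: "x \<in> X \<Longrightarrow> is_mean X (\<mu> x)"
begin

lemma map_means: "xs \<in> tuples X k \<Longrightarrow> map \<mu> xs \<in> means X k"
  using mean by (auto simp: tuples_def)

lemma hd_tuples: "xs \<in> tuples X (Suc k) \<Longrightarrow> hd xs \<in> X"
  by (cases xs) (auto simp: tuples_def)

lemma Cons_tuples: "x \<in> X \<Longrightarrow> xs \<in> tuples X k \<Longrightarrow> x # xs \<in> tuples X (Suc k)"
  by (auto simp: tuples_def)

lemma hmt_cong:
  "xs \<in> tuples X k \<Longrightarrow> (\<And>ys. ys \<in> tuples X (Suc k) \<Longrightarrow> f ys = g ys) \<Longrightarrow> hmt \<mu> k f xs = hmt \<mu> k g xs"
proof (induction k arbitrary: f g xs)
  case (Suc k)
  note hd = hd_tuples[OF Suc.prems(1)]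
  have "avg (Suc k) (map \<mu> xs) (\<lambda>ys. f (hd xs # ys)) = avg (Suc k) (map \<mu> xs) (\<lambda>ys. g (hd xs # ys))"
    using Suc.prems(2) hd by (intro avg_cong[OF map_means[OF Suc.prems(1)]]) (auto intro: Cons_tuples)
  moreover have "cob (hmt \<mu> k (\<lambda>ys. f (hd xs # ys))) xs = cob (hmt \<mu> k (\<lambda>ys. g (hd xs # ys))) xs"
    using Suc.prems hd by (intro cob_cong[OF Suc.prems(1)] Suc.IH) (auto intro: Cons_tuples)
  ultimately show ?case using Suc.prems hd by (simp add: Cons_tuples)
qed simp

lemma hmt_bounded_by: "bounded_by X (Suc k) K f \<Longrightarrow> bounded_by X k (hmt_bound k * K) (hmt \<mu> k f)"
proof (induction k arbitrary: f)
  case (Suc k)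
  show ?case unfolding bounded_by_def
  proof
    fix xs assume xs: "xs \<in> tuples X (Suc k)"
    note hd = hd_tuples[OF xs]
    note B = bounded_by_Cons[OF Suc.prems hd]
    have "\<bar>avg (Suc k) (map \<mu> xs) (\<lambda>ys. f (hd xs # ys))\<bar> \<le> K"
      by (rule avg_bound[OF map_means[OF xs] B])
    moreover have "\<bar>f (hd xs # xs)\<bar> \<le> K"
      using B xs by (simp add: bounded_by_def)
    moreover have "\<bar>cob (hmt \<mu> k (\<lambda>ys. f (hd xs # ys))) xs\<bar> \<le> Suc k * (hmt_bound k * K)"
      using cob_bounded_by[OF Suc.IH[OF B]] xs by (simp add: bounded_by_def)
    ultimately show "\<bar>hmt \<mu> (Suc k) f xs\<bar> \<le> hmt_bound (Suc k) * K"
      by (simp add: distrib_right mult.assoc)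
  qed
qed (simp add: bounded_by_def)

lemma hmt_add:
  "xs \<in> tuples X k \<Longrightarrow> bounded_by X (Suc k) K f \<Longrightarrow> bounded_by X (Suc k) L g
    \<Longrightarrow> hmt \<mu> k (\<lambda>ys. f ys + g ys) xs = hmt \<mu> k f xs + hmt \<mu> k g xs"
proof (induction k arbitrary: f g xs)
  case (Suc k)
  note hd = hd_tuples[OF Suc.prems(1)]
  note B = bounded_by_Cons[OF Suc.prems(2) hd] bounded_by_Cons[OF Suc.prems(3) hd]
  have "cob (hmt \<mu> k (\<lambda>ys. f (hd xs # ys) + g (hd xs # ys))) xs
      = cob (\<lambda>zs. hmt \<mu> k (\<lambda>ys. f (hd xs # ys)) zs + hmt \<mu> k (\<lambda>ys. g (hd xs # ys)) zs) xs"
    by (rule cob_cong[OF Suc.prems(1)]) (rule Suc.IH[OF _ B])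
  then show ?case
    by (simp add: avg_add[OF map_means[OF Suc.prems(1)] B] cob_add)
qed simp

lemma hmt_mult:
  "xs \<in> tuples X k \<Longrightarrow> bounded_by X (Suc k) K f \<Longrightarrow> hmt \<mu> k (\<lambda>ys. r * f ys) xs = r * hmt \<mu> k f xs"
proof (induction k arbitrary: f xs)
  case (Suc k)
  note hd = hd_tuples[OF Suc.prems(1)]
  note B = bounded_by_Cons[OF Suc.prems(2) hd]
  have "cob (hmt \<mu> k (\<lambda>ys. r * f (hd xs # ys))) xs
      = cob (\<lambda>zs. r * hmt \<mu> k (\<lambda>ys. f (hd xs # ys)) zs) xs"
    by (rule cob_cong[OF Suc.prems(1)]) (rule Suc.IH[OF _ B])
  then show ?case
    by (simp add: avg_mult[OF map_means[OF Suc.prems(1)] B] cob_mult right_diff_distrib)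
qed simp

lemma hmt_diff:
  assumes "xs \<in> tuples X k" "bounded_by X (Suc k) K f" "bounded_by X (Suc k) L g"
  shows "hmt \<mu> k (\<lambda>ys. f ys - g ys) xs = hmt \<mu> k f xs - hmt \<mu> k g xs"
  using hmt_add[OF assms(1,2) bounded_by_mult[OF assms(3), of "-1"]] hmt_mult[OF assms(1,3), of "-1"]
  by simp

lemma avg_cob_map:
  assumes xs: "xs \<in> tuples X (Suc k)" and f: "bounded_by X k K f"
  shows "avg (Suc k) (map \<mu> xs) (cob f) = cob (\<lambda>ys. avg k (map \<mu> ys) f) xs"
  using avg_cob[OF map_means[OF xs] f] xs by (simp add: cob_def tuples_def map_del)

text \<open>The cone rule \<open>cob_Cons\<close> turns the coboundary inside \<open>hmt\<close>
  into the same formula for the function \<open>?c\<close> of one argument less, with apex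
  \<open>hd xs\<close> fixed. At \<open>k = 0\<close> the truncated index \<open>k - 1\<close> is
  harmless, because every coboundary vanishes at the empty tuple.\<close>

lemma hmt_homotopy:
  "xs \<in> tuples X k \<Longrightarrow> bounded_by X k K f
    \<Longrightarrow> cob (hmt \<mu> (k - 1) f) xs + hmt \<mu> k (cob f) xs = avg k (map \<mu> xs) f - f xs"
proof (induction k arbitrary: f xs)
  case 0
  then show ?case by (simp add: tuples_def)
next
  case (Suc k)
  note xs = Suc.prems(1) and hd = hd_tuples[OF Suc.prems(1)]
  let ?c = "\<lambda>ys. f (hd xs # ys)"
  note B = bounded_by_Cons[OF Suc.prems(2) hd]
  note cB = cob_bounded_by[OF B]
  have "cob (hmt \<mu> k (\<lambda>ys. cob f (hd xs # ys))) xs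
      = cob (\<lambda>ys. hmt \<mu> k f ys - hmt \<mu> k (cob ?c) ys) xs"
    by (rule cob_cong[OF xs]) (simp add: cob_Cons hmt_diff[OF _ Suc.prems(2) cB])
  also have "\<dots> = cob (hmt \<mu> k f) xs - cob (hmt \<mu> k (cob ?c)) xs"
    by (rule cob_diff)
  \<comment> \<open>The inductive hypothesis is applied to \<open>?c\<close> on every face of
    \<open>xs\<close>. Its own homotopy term appears under a second coboundary and disappears by
    \<open>cob_cob\<close>.\<close>
  also have "cob (hmt \<mu> k (cob ?c)) xs
      = cob (\<lambda>ys. (avg k (map \<mu> ys) ?c - ?c ys) - cob (hmt \<mu> (k - 1) ?c) ys) xs"
    by (rule cob_cong[OF xs]) (use Suc.IH[OF _ B] in \<open>simp add: algebra_simps\<close>)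
  also have "\<dots> = avg (Suc k) (map \<mu> xs) (cob ?c) - cob ?c xs"
    by (simp add: cob_diff cob_cob avg_cob_map[OF xs B])
  finally have "cob (hmt \<mu> k (\<lambda>ys. cob f (hd xs # ys))) xs
      = cob (hmt \<mu> k f) xs - (avg (Suc k) (map \<mu> xs) (cob ?c) - cob ?c xs)" .
  moreover have "avg (Suc k) (map \<mu> xs) (\<lambda>ys. cob f (hd xs # ys))
      = avg (Suc k) (map \<mu> xs) f - avg (Suc k) (map \<mu> xs) (cob ?c)"
    unfolding cob_Cons by (rule avg_diff[OF map_means[OF xs] Suc.prems(2) cB])
  ultimately show ?case by (simp add: cob_Cons)
qed

end

lemma avg_natural:
  assumes "length xs = k" "\<And>x. x \<in> set xs \<Longrightarrow> \<mu> (p x) = (\<lambda>\<phi>. \<nu> x (\<lambda>y. \<phi> (p y)))"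
  shows "avg k (map \<mu> (map p xs)) f = avg k (map \<nu> xs) (\<lambda>ys. f (map p ys))"
proof -
  have "map \<mu> (map p xs) = map (\<lambda>M \<phi>. M (\<lambda>x. \<phi> (p x))) (map \<nu> xs)"
    using assms(2) by auto
  with assms(1) show ?thesis by (simp only: avg_map length_map)
qed

text \<open>The apex of the cone is the first vertex, and \<open>p\<close> sends first vertices to
  first vertices; no choice enters that \<open>p\<close> could fail to respect.\<close>

lemma hmt_natural:
  assumes "length xs = k" "\<And>x. x \<in> set xs \<Longrightarrow> \<mu> (p x) = (\<lambda>\<phi>. \<nu> x (\<lambda>y. \<phi> (p y)))"
  shows "hmt \<mu> k f (map p xs) = hmt \<nu> k (\<lambda>ys. f (map p ys)) xs"
  using assms
proof (induction k arbitrary: f xs)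
  case (Suc k)
  then have hd: "hd (map p xs) = p (hd xs)" by (cases xs) auto
  have "cob (hmt \<mu> k (\<lambda>ys. f (p (hd xs) # ys))) (map p xs)
      = cob (hmt \<nu> k (\<lambda>ys. f (p (hd xs) # map p ys))) xs"
    unfolding cob_map
    \<comment> \<open>The compatibility of the means is known only at entries of \<open>xs\<close>,
      and every face has its entries among them.\<close>
    by (rule cob_cong[of xs "set xs"]) (use Suc in \<open>auto simp: tuples_def\<close>)
  then show ?case unfolding hmt.simps hd using avg_natural[of xs "Suc k" \<mu> p \<nu>, OF Suc.prems] by simp
qed simp

section \<open>Cohomology of a subcomplex onto which a complex retracts\<close>

lemma real_ring_simps [simp]:
  "carrier real_ring = UNIV" "x \<otimes>\<^bsub>real_ring\<^esub> y = x * y" "\<one>\<^bsub>real_ring\<^esub> = 1"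
  "\<zero>\<^bsub>real_ring\<^esub> = 0" "x \<oplus>\<^bsub>real_ring\<^esub> y = x + y"
  by (simp_all add: real_ring_def)

lemma cring_real_ring: "cring real_ring"
proof (rule cringI)
  show "abelian_group real_ring"
    by (rule abelian_groupI) (auto simp: intro: exI[of _ "- x" for x])
  show "comm_monoid real_ring"
    by (rule comm_monoidI) auto
qed (auto simp: algebra_simps)

lemma real_ring_uminus [simp]: "\<ominus>\<^bsub>real_ring\<^esub> r = - r"
proof -
  interpret cring real_ring by (rule cring_real_ring)
  show ?thesis by (rule minus_equality) auto
qed

abbreviation real_module :: "'v nspace \<Rightarrow> bool" where
  "real_module \<equiv> Module.module real_ring"

text \<open>The law for multiplication by 0 stands in for additive inverses: together with
  distributivity it makes -1 times \<open>x\<close> an inverse of \<open>x\<close>.\<close>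

lemma real_moduleI:
  assumes "\<And>x y. x \<in> carrier V \<Longrightarrow> y \<in> carrier V \<Longrightarrow> x \<oplus>\<^bsub>V\<^esub> y \<in> carrier V"
    and "\<zero>\<^bsub>V\<^esub> \<in> carrier V"
    and "\<And>r x. x \<in> carrier V \<Longrightarrow> r \<odot>\<^bsub>V\<^esub> x \<in> carrier V"
    and "\<And>x y z. x \<in> carrier V \<Longrightarrow> y \<in> carrier V \<Longrightarrow> z \<in> carrier V
      \<Longrightarrow> (x \<oplus>\<^bsub>V\<^esub> y) \<oplus>\<^bsub>V\<^esub> z = x \<oplus>\<^bsub>V\<^esub> (y \<oplus>\<^bsub>V\<^esub> z)"
    and "\<And>x y. x \<in> carrier V \<Longrightarrow> y \<in> carrier V \<Longrightarrow> x \<oplus>\<^bsub>V\<^esub> y = y \<oplus>\<^bsub>V\<^esub> x"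
    and "\<And>x. x \<in> carrier V \<Longrightarrow> \<zero>\<^bsub>V\<^esub> \<oplus>\<^bsub>V\<^esub> x = x"
    and "\<And>x. x \<in> carrier V \<Longrightarrow> 0 \<odot>\<^bsub>V\<^esub> x = \<zero>\<^bsub>V\<^esub>"
    and "\<And>r s x. x \<in> carrier V \<Longrightarrow> (r + s) \<odot>\<^bsub>V\<^esub> x = r \<odot>\<^bsub>V\<^esub> x \<oplus>\<^bsub>V\<^esub> s \<odot>\<^bsub>V\<^esub> x"
    and "\<And>r x y. x \<in> carrier V \<Longrightarrow> y \<in> carrier V
      \<Longrightarrow> r \<odot>\<^bsub>V\<^esub> (x \<oplus>\<^bsub>V\<^esub> y) = r \<odot>\<^bsub>V\<^esub> x \<oplus>\<^bsub>V\<^esub> r \<odot>\<^bsub>V\<^esub> y"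
    and "\<And>r s x. x \<in> carrier V \<Longrightarrow> (r * s) \<odot>\<^bsub>V\<^esub> x = r \<odot>\<^bsub>V\<^esub> (s \<odot>\<^bsub>V\<^esub> x)"
    and "\<And>x. x \<in> carrier V \<Longrightarrow> 1 \<odot>\<^bsub>V\<^esub> x = x"
  shows "real_module V"
proof (rule moduleI)
  show "cring real_ring" by (rule cring_real_ring)
  show "abelian_group V"
  proof (rule abelian_groupI)
    fix x assume x: "x \<in> carrier V"
    have "-1 \<odot>\<^bsub>V\<^esub> x \<oplus>\<^bsub>V\<^esub> x = (-1 + 1) \<odot>\<^bsub>V\<^esub> x" using x by (simp only: assms)
    also have "\<dots> = \<zero>\<^bsub>V\<^esub>" using x assms(7) by simp
    finally show "\<exists>y\<in>carrier V. y \<oplus>\<^bsub>V\<^esub> x = \<zero>\<^bsub>V\<^esub>" using x assms(3) by blast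
  qed (use assms in auto)
qed (use assms in simp_all)

text \<open>Cosets use the addition only. Hence cosets formed in the record of cocycles are cosets
  in the whole space of cochains.\<close>

lemma a_r_coset_carrier_update [simp]: "B +>\<^bsub>W\<lparr>carrier := Y\<rparr>\<^esub> x = B +>\<^bsub>W\<^esub> x"
  by (simp add: a_r_coset_def')

lemma set_add_carrier_update [simp]: "X <+>\<^bsub>W\<lparr>carrier := Y\<rparr>\<^esub> X' = X <+>\<^bsub>W\<^esub> X'"
  by (simp add: set_add_def')

lemma linear_map_zero:
  assumes "real_module V" "real_module W" "linear_map V W f"
  shows "f \<zero>\<^bsub>V\<^esub> = \<zero>\<^bsub>W\<^esub>"
proof -
  interpret V: Module.module real_ring V by fact
  interpret W: Module.module real_ring W by fact
  have "f \<zero>\<^bsub>V\<^esub> = f (0 \<odot>\<^bsub>V\<^esub> \<zero>\<^bsub>V\<^esub>)" by (simp add: V.smult_r_null)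
  also have "\<dots> = 0 \<odot>\<^bsub>W\<^esub> f \<zero>\<^bsub>V\<^esub>" using assms(3) unfolding linear_map_def by blast
  also have "\<dots> = \<zero>\<^bsub>W\<^esub>" using assms(3) W.smult_l_null by (auto simp: linear_map_def)
  finally show ?thesis .
qed

lemma linear_map_closed: "linear_map V W f \<Longrightarrow> x \<in> carrier V \<Longrightarrow> f x \<in> carrier W"
  by (auto simp: linear_map_def)

lemma linear_map_add:
  "linear_map V W f \<Longrightarrow> x \<in> carrier V \<Longrightarrow> y \<in> carrier V \<Longrightarrow> f (x \<oplus>\<^bsub>V\<^esub> y) = f x \<oplus>\<^bsub>W\<^esub> f y"
  by (auto simp: linear_map_def)

lemma linear_map_smult: "linear_map V W f \<Longrightarrow> x \<in> carrier V \<Longrightarrow> f (r \<odot>\<^bsub>V\<^esub> x) = r \<odot>\<^bsub>W\<^esub> f x"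
  by (auto simp: linear_map_def)

lemma smult_minus_one:
  assumes "real_module V" "x \<in> carrier V"
  shows "-1 \<odot>\<^bsub>V\<^esub> x = \<ominus>\<^bsub>V\<^esub> x"
proof -
  interpret V: Module.module real_ring V by fact
  show ?thesis using V.smult_l_minus[of 1 x] V.smult_one[of x] assms(2) by simp
qed

lemma linear_map_minus:
  assumes "real_module V" "real_module W" "linear_map V W f" "x \<in> carrier V" "y \<in> carrier V"
  shows "f (x \<ominus>\<^bsub>V\<^esub> y) = f x \<ominus>\<^bsub>W\<^esub> f y"
proof -
  interpret V: Module.module real_ring V by fact
  have "f (x \<oplus>\<^bsub>V\<^esub> (-1 \<odot>\<^bsub>V\<^esub> y)) = f x \<oplus>\<^bsub>W\<^esub> (-1 \<odot>\<^bsub>W\<^esub> f y)"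
    using assms(3-5) V.smult_closed[of "-1" y] by (simp add: linear_map_add linear_map_smult)
  then show ?thesis
    using assms linear_map_closed[OF assms(3)] by (simp add: a_minus_def smult_minus_one)
qed

section \<open>Subspaces and their cosets\<close>

locale real_subspace = Module.module real_ring W for W :: "'w nspace" (structure) +
  fixes B :: "'w set"
  assumes subset: "B \<subseteq> carrier W"
    and zero_mem: "\<zero>\<^bsub>W\<^esub> \<in> B"
    and add_mem: "x \<in> B \<Longrightarrow> y \<in> B \<Longrightarrow> x \<oplus>\<^bsub>W\<^esub> y \<in> B"
    and smult_mem: "x \<in> B \<Longrightarrow> r \<odot>\<^bsub>W\<^esub> x \<in> B"
begin

lemma mem_carrier: "x \<in> B \<Longrightarrow> x \<in> carrier W"
  using subset by blast

lemma minus_mem: "x \<in> B \<Longrightarrow> y \<in> B \<Longrightarrow> x \<ominus>\<^bsub>W\<^esub> y \<in> B"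
  using add_mem[of x "-1 \<odot>\<^bsub>W\<^esub> y"] smult_mem[of y "-1"] smult_minus_one[of W y] mem_carrier
  by (simp add: a_minus_def module_axioms)

abbreviation cls where "cls x \<equiv> B +>\<^bsub>W\<^esub> x"

lemma cls_def: "cls x = (\<lambda>b. b \<oplus>\<^bsub>W\<^esub> x) ` B"
  by (auto simp: a_r_coset_def')

lemma mem_cls_iff:
  assumes "x \<in> carrier W"
  shows "y \<in> cls x \<longleftrightarrow> y \<in> carrier W \<and> y \<ominus>\<^bsub>W\<^esub> x \<in> B"
proof
  assume "y \<in> cls x"
  then obtain b where b: "b \<in> B" "y = b \<oplus>\<^bsub>W\<^esub> x" by (auto simp: cls_def)
  with assms mem_carrier[OF b(1)] show "y \<in> carrier W \<and> y \<ominus>\<^bsub>W\<^esub> x \<in> B"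
    by (simp add: a_minus_def M.a_assoc M.r_neg)
next
  assume y: "y \<in> carrier W \<and> y \<ominus>\<^bsub>W\<^esub> x \<in> B"
  then have "y = (y \<ominus>\<^bsub>W\<^esub> x) \<oplus>\<^bsub>W\<^esub> x" using assms by (simp add: a_minus_def M.a_assoc M.l_neg)
  with y show "y \<in> cls x" by (auto simp: cls_def)
qed

lemma self_mem_cls: "x \<in> carrier W \<Longrightarrow> x \<in> cls x"
  by (simp add: mem_cls_iff a_minus_def M.r_neg zero_mem)

lemma cls_eq_iff:
  assumes "x \<in> carrier W" "y \<in> carrier W"
  shows "cls x = cls y \<longleftrightarrow> x \<ominus>\<^bsub>W\<^esub> y \<in> B"
proof
  assume "cls x = cls y"
  with self_mem_cls[OF assms(1)] show "x \<ominus>\<^bsub>W\<^esub> y \<in> B" using mem_cls_iff[OF assms(2)] by blast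
next
  have trans: "w \<ominus>\<^bsub>W\<^esub> y \<in> B"
    if "x \<in> carrier W" "y \<in> carrier W" "w \<in> carrier W" "w \<ominus>\<^bsub>W\<^esub> x \<in> B" "x \<ominus>\<^bsub>W\<^esub> y \<in> B" for w x y
    using add_mem[OF that(4,5)] that(1-3) by (simp add: a_minus_def M.a_assoc M.r_neg1)
  assume xy: "x \<ominus>\<^bsub>W\<^esub> y \<in> B"
  then have "-1 \<odot>\<^bsub>W\<^esub> (x \<ominus>\<^bsub>W\<^esub> y) \<in> B" by (rule smult_mem)
  then have yx: "y \<ominus>\<^bsub>W\<^esub> x \<in> B"
    using assms smult_minus_one[of W "x \<ominus>\<^bsub>W\<^esub> y"]
    by (simp add: a_minus_def M.minus_add M.a_comm module_axioms)
  show "cls x = cls y"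
  proof (rule Set.set_eqI)
    fix w
    show "w \<in> cls x \<longleftrightarrow> w \<in> cls y"
      unfolding mem_cls_iff[OF assms(1)] mem_cls_iff[OF assms(2)]
      using trans[OF assms _ _ xy] trans[OF assms(2,1) _ _ yx] by blast
  qed
qed

lemma cls_eqI: "x \<in> carrier W \<Longrightarrow> y \<in> cls x \<Longrightarrow> cls y = cls x"
  using mem_cls_iff cls_eq_iff by blast

lemma cls_add:
  assumes "x \<in> carrier W" "y \<in> carrier W"
  shows "cls x <+>\<^bsub>W\<^esub> cls y = cls (x \<oplus>\<^bsub>W\<^esub> y)"
proof (intro equalityI subsetI)
  fix w assume "w \<in> cls x <+>\<^bsub>W\<^esub> cls y"
  then obtain a b where ab: "a \<in> B" "b \<in> B" "w = (a \<oplus>\<^bsub>W\<^esub> x) \<oplus>\<^bsub>W\<^esub> (b \<oplus>\<^bsub>W\<^esub> y)"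
    by (auto simp: cls_def set_add_def')
  then have "w = (a \<oplus>\<^bsub>W\<^esub> b) \<oplus>\<^bsub>W\<^esub> (x \<oplus>\<^bsub>W\<^esub> y)"
    using assms mem_carrier by (simp add: M.a_ac)
  then show "w \<in> cls (x \<oplus>\<^bsub>W\<^esub> y)" using add_mem[OF ab(1,2)] by (simp add: cls_def)
next
  fix w assume "w \<in> cls (x \<oplus>\<^bsub>W\<^esub> y)"
  then obtain b where b: "b \<in> B" "w = b \<oplus>\<^bsub>W\<^esub> (x \<oplus>\<^bsub>W\<^esub> y)" by (auto simp: cls_def)
  then have "w = (b \<oplus>\<^bsub>W\<^esub> x) \<oplus>\<^bsub>W\<^esub> y" using assms mem_carrier by (simp add: M.a_assoc)
  moreover have "b \<oplus>\<^bsub>W\<^esub> x \<in> cls x" using b by (simp add: cls_def)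
  ultimately show "w \<in> cls x <+>\<^bsub>W\<^esub> cls y"
    using self_mem_cls[OF assms(2)] by (auto simp: set_add_def')
qed

text \<open>A scalar multiple of a class is encoded as a union over its representatives. All cosets
  in the union coincide, because two representatives differ by an element of \<open>B\<close>, and
  \<open>B\<close> is closed under scalars.\<close>

lemma cls_smult:
  assumes "x \<in> carrier W"
  shows "(\<Union>y\<in>cls x. cls (r \<odot>\<^bsub>W\<^esub> y)) = cls (r \<odot>\<^bsub>W\<^esub> x)"
proof -
  have "cls (r \<odot>\<^bsub>W\<^esub> y) = cls (r \<odot>\<^bsub>W\<^esub> x)" if y: "y \<in> cls x" for y
  proof -
    obtain b where b: "b \<in> B" "y = b \<oplus>\<^bsub>W\<^esub> x" using y by (auto simp: cls_def)
    then have "r \<odot>\<^bsub>W\<^esub> y = (r \<odot>\<^bsub>W\<^esub> b) \<oplus>\<^bsub>W\<^esub> (r \<odot>\<^bsub>W\<^esub> x)"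
      using assms mem_carrier by (simp add: smult_r_distr)
    then have "r \<odot>\<^bsub>W\<^esub> y \<in> cls (r \<odot>\<^bsub>W\<^esub> x)" using smult_mem[OF b(1)] by (simp add: cls_def)
    then show ?thesis using assms by (intro cls_eqI) simp_all
  qed
  then show ?thesis using self_mem_cls[OF assms] by blast
qed

end

section \<open>Subcomplexes and retractions up to homotopy\<close>

definition subcomplex :: "'c cochain_cpx \<Rightarrow> (nat \<Rightarrow> 'c set) \<Rightarrow> 'c cochain_cpx" where
  "subcomplex C S = \<lparr>cspace = (\<lambda>k. (cspace C k)\<lparr>carrier := S k\<rparr>), cdiff = cdiff C\<rparr>"

lemma real_subspace_carrier: "real_module V \<Longrightarrow> real_subspace V (carrier V)"
proof -
  assume "real_module V"
  then interpret Module.module real_ring V .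
  show ?thesis by unfold_locales auto
qed

lemma real_subspace_image:
  assumes "real_module V" "real_module W" "linear_map V W f" "real_subspace V S"
  shows "real_subspace W (f ` S)"
proof -
  interpret V: Module.module real_ring V by fact
  interpret W: Module.module real_ring W by fact
  interpret S: real_subspace V S by fact
  show ?thesis
  proof (unfold_locales)
    show "f ` S \<subseteq> carrier W" using linear_map_closed[OF assms(3)] S.mem_carrier by blast
    show "\<zero>\<^bsub>W\<^esub> \<in> f ` S" using linear_map_zero[OF assms(1-3)] S.zero_mem by (metis image_eqI)
    show "x \<oplus>\<^bsub>W\<^esub> y \<in> f ` S" if xy: "x \<in> f ` S" "y \<in> f ` S" for x y
    proof -
      obtain a b where "a \<in> S" "x = f a" "b \<in> S" "y = f b" using xy by blast
      then show ?thesis using linear_map_add[OF assms(3), of a b] S.add_mem[of a b] S.mem_carrier by (intro image_eqI[of _ f "a \<oplus>\<^bsub>V\<^esub> b"]) auto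
    qed
    show "r \<odot>\<^bsub>W\<^esub> x \<in> f ` S" if x: "x \<in> f ` S" for x r
    proof -
      obtain a where "a \<in> S" "x = f a" using x by blast
      then show ?thesis using linear_map_smult[OF assms(3), of a r] S.smult_mem[of a r] S.mem_carrier by (intro image_eqI[of _ f "r \<odot>\<^bsub>V\<^esub> a"]) auto
    qed
  qed
qed

text \<open>\<open>T\<close> is the identity on \<open>S\<close> only up to the homotopy
  \<open>h\<close>, which \<open>h_mem\<close> keeps inside the subcomplex. The cohomology compared
  is that of degree \<open>Suc m\<close>; degree \<open>m\<close> enters through primitives, and
  this is why \<open>T\<close> has to land in \<open>S\<close> in both degrees. The norm condition
  concerns degree \<open>Suc m\<close>, where the semi-norms are compared.\<close>

locale cochain_retraction =
  fixes C :: "'c cochain_cpx" and S :: "nat \<Rightarrow> 'c set" and m :: nat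
    and T :: "nat \<Rightarrow> 'c \<Rightarrow> 'c" and h :: "'c \<Rightarrow> 'c"
  assumes cmodule: "real_module (cspace C k)"
    and cdiff_linear: "linear_map (cspace C k) (cspace C (Suc k)) (cdiff C k)"
    and cdiff_cdiff: "x \<in> carrier (cspace C k) \<Longrightarrow> cdiff C (Suc k) (cdiff C k x) = \<zero>\<^bsub>cspace C (Suc (Suc k))\<^esub>"
    and cnorm_nonneg: "x \<in> carrier (cspace C k) \<Longrightarrow> 0 \<le> vnorm (cspace C k) x"
    and S_subspace: "real_subspace (cspace C k) (S k)"
    and T_mem: "k = m \<or> k = Suc m \<Longrightarrow> x \<in> carrier (cspace C k) \<Longrightarrow> T k x \<in> S k"
    and T_cdiff: "x \<in> carrier (cspace C m) \<Longrightarrow> T (Suc m) (cdiff C m x) = cdiff C m (T m x)"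
    and T_norm: "x \<in> carrier (cspace C (Suc m)) \<Longrightarrow> vnorm (cspace C (Suc m)) (T (Suc m) x) \<le> vnorm (cspace C (Suc m)) x"
    and h_closed: "x \<in> carrier (cspace C (Suc m)) \<Longrightarrow> h x \<in> carrier (cspace C m)"
    and h_mem: "x \<in> S (Suc m) \<Longrightarrow> h x \<in> S m"
    and homotopy: "x \<in> carrier (cspace C (Suc m)) \<Longrightarrow> cdiff C (Suc m) x = \<zero>\<^bsub>cspace C (Suc (Suc m))\<^esub>
      \<Longrightarrow> T (Suc m) x = x \<oplus>\<^bsub>cspace C (Suc m)\<^esub> cdiff C m (h x)"
begin

abbreviation "W \<equiv> cspace C (Suc m)"
abbreviation "Z \<equiv> {x \<in> carrier W. cdiff C (Suc m) x = \<zero>\<^bsub>cspace C (Suc (Suc m))\<^esub>}"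
abbreviation "B \<equiv> cdiff C m ` carrier (cspace C m)"
abbreviation "BS \<equiv> cdiff C m ` S m"
abbreviation "R \<equiv> subcomplex C S"

interpretation W: Module.module real_ring W by (rule cmodule)
interpretation c: real_subspace W B
  by (rule real_subspace_image[OF cmodule cmodule cdiff_linear real_subspace_carrier[OF cmodule]])
interpretation r: real_subspace W BS
  by (rule real_subspace_image[OF cmodule cmodule cdiff_linear S_subspace])
interpretation S: real_subspace W "S (Suc m)" by (rule S_subspace)

lemma BS_subset: "BS \<subseteq> B"
  using real_subspace.subset[OF S_subspace] by blast

lemma Z_subspace: "real_subspace W Z"
proof -
  interpret Y: Module.module real_ring "cspace C (Suc (Suc m))" by (rule cmodule)
  show ?thesis
    by unfold_locales
      (auto simp: linear_map_zero[OF cmodule cmodule cdiff_linear] linear_map_add[OF cdiff_linear]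
        linear_map_smult[OF cdiff_linear] Y.smult_r_null)
qed

interpretation Z: real_subspace W Z by (rule Z_subspace)

lemma B_subset_Z: "B \<subseteq> Z"
  using cdiff_cdiff linear_map_closed[OF cdiff_linear] by blast

lemma T_cocycle:
  assumes "x \<in> Z"
  shows "T (Suc m) x \<in> Z" "T (Suc m) x \<ominus>\<^bsub>W\<^esub> x \<in> B"
proof -
  have x: "x \<in> carrier W" and b: "cdiff C m (h x) \<in> B" using assms h_closed by auto
  have eq: "T (Suc m) x = x \<oplus>\<^bsub>W\<^esub> cdiff C m (h x)" using homotopy assms by auto
  show "T (Suc m) x \<in> Z" unfolding eq using assms b B_subset_Z by (intro Z.add_mem) auto
  show "T (Suc m) x \<ominus>\<^bsub>W\<^esub> x \<in> B"
    using b x c.mem_carrier[OF b] unfolding eq by (simp add: a_minus_def W.M.a_comm W.M.r_neg1)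
qed

text \<open>If w = d(b), then d(T b) = T(d b) = T w = w + d(h w), so w = d(T b - h w). Both T b and
  h w lie in the subcomplex.\<close>

lemma relative_coboundary:
  assumes "w \<in> B" "w \<in> S (Suc m)"
  shows "w \<in> BS"
proof -
  obtain b where b: "b \<in> carrier (cspace C m)" "w = cdiff C m b" using assms(1) by blast
  have hw: "h w \<in> S m" using assms(2) by (rule h_mem)
  have w: "w \<in> carrier W" and hw': "h w \<in> carrier (cspace C m)"
    using assms c.mem_carrier h_closed by auto
  have "cdiff C (Suc m) w = \<zero>\<^bsub>cspace C (Suc (Suc m))\<^esub>" using b cdiff_cdiff by simp
  then have eq: "T (Suc m) w = w \<oplus>\<^bsub>W\<^esub> cdiff C m (h w)" using w homotopy by blast
  have Tb: "T m b \<in> S m" "T m b \<in> carrier (cspace C m)"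
    using T_mem b real_subspace.mem_carrier[OF S_subspace] by auto
  have dh: "cdiff C m (h w) \<in> carrier W" using hw' by (rule linear_map_closed[OF cdiff_linear])
  have "cdiff C m (T m b \<ominus>\<^bsub>cspace C m\<^esub> h w) = cdiff C m (T m b) \<ominus>\<^bsub>W\<^esub> cdiff C m (h w)"
    by (rule linear_map_minus[OF cmodule cmodule cdiff_linear Tb(2) hw'])
  also have "\<dots> = w"
    unfolding T_cdiff[OF b(1), symmetric] b(2)[symmetric] eq
    using w dh by (simp add: a_minus_def W.M.a_assoc W.M.r_neg)
  finally show ?thesis
    using real_subspace.minus_mem[OF S_subspace Tb(1) hw] by (metis image_eqI)
qed

text \<open>Passing to cocycles changes only the carrier, so classes are cosets of \<open>B\<close>
  in \<open>W\<close>. The same holds for the subcomplex with \<open>BS\<close>, and the two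
  cohomologies can be compared inside one space.\<close>

lemma cohomology_C:
  "carrier (cohomology C (Suc m)) = c.cls ` Z"
  "x \<in> carrier W \<Longrightarrow> y \<in> carrier W \<Longrightarrow> c.cls x \<oplus>\<^bsub>cohomology C (Suc m)\<^esub> c.cls y = c.cls (x \<oplus>\<^bsub>W\<^esub> y)"
  "x \<in> carrier W \<Longrightarrow> r \<odot>\<^bsub>cohomology C (Suc m)\<^esub> c.cls x = c.cls (r \<odot>\<^bsub>W\<^esub> x)"
  "vnorm (cohomology C (Suc m)) X = (INF x\<in>X. vnorm W x)"
  using c.cls_add c.cls_smult
  by (auto simp add: cohomology_def cocycles_def Let_def A_RCOSETS_def' simp del: UN_simps)

lemma cohomology_R:
  "carrier (cohomology R (Suc m)) = r.cls ` (Z \<inter> S (Suc m))"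
  "x \<in> carrier W \<Longrightarrow> y \<in> carrier W \<Longrightarrow> r.cls x \<oplus>\<^bsub>cohomology R (Suc m)\<^esub> r.cls y = r.cls (x \<oplus>\<^bsub>W\<^esub> y)"
  "x \<in> carrier W \<Longrightarrow> r \<odot>\<^bsub>cohomology R (Suc m)\<^esub> r.cls x = r.cls (r \<odot>\<^bsub>W\<^esub> x)"
  "vnorm (cohomology R (Suc m)) X = (INF x\<in>X. vnorm W x)"
  using r.cls_add r.cls_smult S.subset
  by (auto simp add: cohomology_def cocycles_def subcomplex_def Let_def A_RCOSETS_def' simp del: UN_simps)

abbreviation "I \<equiv> induced_map R C (\<lambda>k f. f) (Suc m)"

text \<open>\<open>induced_map\<close> takes a union over representatives. Since \<open>BS\<close>
  is contained in \<open>B\<close>, all of them have the same absolute class.\<close>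

lemma induced_map_cls:
  assumes "x \<in> Z \<inter> S (Suc m)"
  shows "I (r.cls x) = c.cls x"
proof -
  have x: "x \<in> carrier W" using assms by blast
  have "I (r.cls x) = (\<Union>y\<in>r.cls x. c.cls y)"
    using assms by (auto simp add: induced_map_def cohomology_R(1) cocycles_def simp del: UN_simps)
  also have "\<dots> = (\<Union>y\<in>r.cls x. c.cls x)"
  proof (rule SUP_cong[OF refl])
    fix y assume "y \<in> r.cls x"
    then have "y \<in> c.cls x"
      unfolding r.mem_cls_iff[OF x] c.mem_cls_iff[OF x] using BS_subset by blast
    then show "c.cls y = c.cls x" by (rule c.cls_eqI[OF x])
  qed
  also have "\<dots> = c.cls x" using r.self_mem_cls[OF x] by (intro cSUP_const) auto
  finally show ?thesis .
qed

lemma ZS_subspace: "real_subspace W (Z \<inter> S (Suc m))"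
  by unfold_locales
    (use Z.zero_mem Z.add_mem Z.smult_mem S.zero_mem S.add_mem S.smult_mem in blast)+

text \<open>The difference of relative cocycles lies in \<open>S\<close>, so if it is a coboundary
  at all it has a relative primitive by \<open>relative_coboundary\<close>. This is
  injectivity.\<close>

lemma cls_eq_relative:
  assumes "x \<in> Z \<inter> S (Suc m)" "y \<in> Z \<inter> S (Suc m)" "c.cls x = c.cls y"
  shows "r.cls x = r.cls y"
proof -
  have "x \<ominus>\<^bsub>W\<^esub> y \<in> B" using assms c.cls_eq_iff[of x y] by blast
  moreover have "x \<ominus>\<^bsub>W\<^esub> y \<in> S (Suc m)" using assms S.minus_mem by blast
  ultimately show ?thesis using assms r.cls_eq_iff[of x y] relative_coboundary by blast
qed

text \<open>Surjectivity: on cocycles \<open>T\<close> moves within the absolute class, by the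
  homotopy, and ends in the subcomplex.\<close>

lemma T_relative:
  assumes "x \<in> Z"
  shows "T (Suc m) x \<in> Z \<inter> S (Suc m)" "c.cls (T (Suc m) x) = c.cls x"
proof -
  show 1: "T (Suc m) x \<in> Z \<inter> S (Suc m)" using T_cocycle(1)[OF assms] T_mem assms by blast
  show "c.cls (T (Suc m) x) = c.cls x"
    using T_cocycle(2)[OF assms] 1 assms by (subst c.cls_eq_iff) auto
qed

text \<open>The relative class is contained in the absolute one, which gives one inequality. For the
  other, \<open>T\<close> carries each representative of the absolute class to a relative
  representative whose norm is not larger.\<close>

lemma norm_cls:
  assumes x: "x \<in> Z \<inter> S (Suc m)"
  shows "(INF y\<in>c.cls x. vnorm W y) = (INF y\<in>r.cls x. vnorm W y)"
proof (rule antisym)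
  have xW: "x \<in> carrier W" using x by blast
  have bdd: "bdd_below (vnorm W ` c.cls x)" "bdd_below (vnorm W ` r.cls x)"
    using cnorm_nonneg c.mem_cls_iff[OF xW] r.mem_cls_iff[OF xW] by (auto intro!: bdd_belowI[of _ 0])
  have sub: "r.cls x \<subseteq> c.cls x"
    using BS_subset c.mem_cls_iff[OF xW] r.mem_cls_iff[OF xW] by blast
  show "(INF y\<in>c.cls x. vnorm W y) \<le> (INF y\<in>r.cls x. vnorm W y)"
    using r.self_mem_cls[OF xW] by (intro cINF_superset_mono bdd sub) auto
  show "(INF y\<in>r.cls x. vnorm W y) \<le> (INF y\<in>c.cls x. vnorm W y)"
  proof (rule cINF_mono)
    fix y assume y: "y \<in> c.cls x"
    have "y \<in> Z"
    proof -
      obtain b where "b \<in> B" "y = b \<oplus>\<^bsub>W\<^esub> x" using y by (auto simp: c.cls_def)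
      then show ?thesis using x B_subset_Z Z.add_mem by blast
    qed
    note Ty = T_relative[OF this]
    have "c.cls (T (Suc m) y) = c.cls x" using Ty(2) c.cls_eqI[OF xW y] by simp
    from cls_eq_relative[OF Ty(1) x this] have "T (Suc m) y \<in> r.cls x"
      using r.self_mem_cls Ty(1) by blast
    then show "\<exists>z\<in>r.cls x. vnorm W z \<le> vnorm W y" using T_norm \<open>y \<in> Z\<close> by blast
  qed (use c.self_mem_cls[OF xW] bdd in auto)
qed

theorem isometric_isomorphism_induced_map:
  "isometric_isomorphism (cohomology R (Suc m)) (cohomology C (Suc m)) I"
proof -
  interpret ZS: real_subspace W "Z \<inter> S (Suc m)" by (rule ZS_subspace)
  have "linear_map (cohomology R (Suc m)) (cohomology C (Suc m)) I"
    unfolding linear_map_def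
  proof (intro conjI ballI allI funcsetI)
    fix X assume "X \<in> carrier (cohomology R (Suc m))"
    then obtain x where x: "x \<in> Z \<inter> S (Suc m)" and X: "X = r.cls x" by (auto simp: cohomology_R(1))
    show "I X \<in> carrier (cohomology C (Suc m))"
      using x by (auto simp: X induced_map_cls cohomology_C(1))
    show "I (r \<odot>\<^bsub>cohomology R (Suc m)\<^esub> X) = r \<odot>\<^bsub>cohomology C (Suc m)\<^esub> I X" for r
      unfolding X induced_map_cls[OF x] cohomology_R(3)[OF ZS.mem_carrier[OF x]]
        cohomology_C(3)[OF ZS.mem_carrier[OF x]]
      by (rule induced_map_cls[OF ZS.smult_mem[OF x]])
    fix Y assume "Y \<in> carrier (cohomology R (Suc m))"
    then obtain y where y: "y \<in> Z \<inter> S (Suc m)" and Y: "Y = r.cls y" by (auto simp: cohomology_R(1))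
    show "I (X \<oplus>\<^bsub>cohomology R (Suc m)\<^esub> Y) = I X \<oplus>\<^bsub>cohomology C (Suc m)\<^esub> I Y"
      unfolding X Y induced_map_cls[OF x] induced_map_cls[OF y]
        cohomology_R(2)[OF ZS.mem_carrier[OF x] ZS.mem_carrier[OF y]]
        cohomology_C(2)[OF ZS.mem_carrier[OF x] ZS.mem_carrier[OF y]]
      by (rule induced_map_cls[OF ZS.add_mem[OF x y]])
  qed
  moreover have "bij_betw I (carrier (cohomology R (Suc m))) (carrier (cohomology C (Suc m)))"
    unfolding bij_betw_def
  proof
    show "inj_on I (carrier (cohomology R (Suc m)))"
    proof (rule inj_onI)
      fix X Y assume "X \<in> carrier (cohomology R (Suc m))" "Y \<in> carrier (cohomology R (Suc m))" and eq: "I X = I Y"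
      then obtain x y where x: "x \<in> Z \<inter> S (Suc m)" "X = r.cls x" and y: "y \<in> Z \<inter> S (Suc m)" "Y = r.cls y"
        by (auto simp: cohomology_R(1))
      show "X = Y" using eq cls_eq_relative[OF x(1) y(1)] by (simp add: x(2) y(2) induced_map_cls[OF x(1)] induced_map_cls[OF y(1)])
    qed
    show "I ` carrier (cohomology R (Suc m)) = carrier (cohomology C (Suc m))"
    proof (intro equalityI subsetI)
      fix Y assume "Y \<in> carrier (cohomology C (Suc m))"
      then obtain y where y: "y \<in> Z" "Y = c.cls y" by (auto simp: cohomology_C(1))
      note Ty = T_relative[OF y(1)]
      show "Y \<in> I ` carrier (cohomology R (Suc m))"
        unfolding cohomology_R(1) y(2) Ty(2)[symmetric] induced_map_cls[OF Ty(1), symmetric] using Ty(1) by blast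
    qed (auto simp: cohomology_R(1) cohomology_C(1) induced_map_cls)
  qed
  moreover have "isometric_on (cohomology R (Suc m)) (cohomology C (Suc m)) I"
    unfolding isometric_on_def
    by (auto simp: cohomology_R(1,4) cohomology_C(4) induced_map_cls norm_cls)
  ultimately show ?thesis unfolding isometric_isomorphism_def by blast
qed

end

section \<open>Normed modules over groupoids\<close>

lemma sup0_nonneg: "bdd_above S \<Longrightarrow> 0 \<le> sup0 S"
  unfolding sup0_def by (rule cSup_upper) auto

lemma le_sup0: "bdd_above S \<Longrightarrow> x \<in> S \<Longrightarrow> x \<le> sup0 S"
  unfolding sup0_def by (rule cSup_upper) auto

lemma sup0_le: "0 \<le> K \<Longrightarrow> (\<And>x. x \<in> S \<Longrightarrow> x \<le> K) \<Longrightarrow> sup0 S \<le> K"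
  unfolding sup0_def by (rule cSup_least) auto

context normed_space begin

lemma is_real_module: "real_module V"
  by (rule module_axioms)

lemma vnorm_zero [simp]: "vnorm V \<zero>\<^bsub>V\<^esub> = 0"
  by (simp add: vnorm_eq_0_iff)

text \<open>The triangle inequality for \<open>x\<close> and -1 times \<open>x\<close>, which have
  equal norms and sum to zero.\<close>

lemma vnorm_nonneg [simp]:
  assumes x: "x \<in> carrier V"
  shows "0 \<le> vnorm V x"
proof -
  have mx: "-1 \<odot>\<^bsub>V\<^esub> x \<in> carrier V" using x by (intro smult_closed) auto
  have "0 = vnorm V (x \<oplus>\<^bsub>V\<^esub> -1 \<odot>\<^bsub>V\<^esub> x)"
    using x by (simp add: smult_minus_one is_real_module M.r_neg)
  also have "\<dots> \<le> vnorm V x + vnorm V (-1 \<odot>\<^bsub>V\<^esub> x)" by (rule vnorm_triangle[OF x mx])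
  also have "\<dots> = 2 * vnorm V x" using vnorm_smult[OF x, of "-1"] by simp
  finally show ?thesis by simp
qed

end

lemma normed_spaceI:
  assumes "real_module V"
    and "\<And>x. x \<in> carrier V \<Longrightarrow> vnorm V x = 0 \<Longrightarrow> x = \<zero>\<^bsub>V\<^esub>" "vnorm V \<zero>\<^bsub>V\<^esub> = 0"
    and "\<And>x r. x \<in> carrier V \<Longrightarrow> vnorm V (r \<odot>\<^bsub>V\<^esub> x) = \<bar>r\<bar> * vnorm V x"
    and "\<And>x y. x \<in> carrier V \<Longrightarrow> y \<in> carrier V \<Longrightarrow> vnorm V (x \<oplus>\<^bsub>V\<^esub> y) \<le> vnorm V x + vnorm V y"
  shows "normed_space V"
  using assms by (auto intro!: normed_space.intro normed_space_axioms.intro)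

section \<open>Bounded linear maps and the operator norm\<close>

locale normed_space_pair = V: normed_space V + W: normed_space W
  for V :: "'v nspace" and W :: "'w nspace"
begin

lemma op_norm_bdd:
  assumes "bounded_map V W f"
  shows "bdd_above ((\<lambda>x. vnorm W (f x)) ` {x \<in> carrier V. vnorm V x \<le> 1})"
proof -
  obtain K where K: "\<forall>x\<in>carrier V. vnorm W (f x) \<le> K * vnorm V x"
    using assms unfolding bounded_map_def by blast
  show ?thesis
  proof (rule bdd_aboveI2)
    fix x assume x: "x \<in> {x \<in> carrier V. vnorm V x \<le> 1}"
    then have "vnorm W (f x) \<le> K * vnorm V x" using K by blast
    \<comment> \<open>The constant witnessing boundedness carries no sign condition, hence the
      absolute value.\<close>
    also have "\<dots> \<le> \<bar>K\<bar> * 1" using x V.vnorm_nonneg[of x] by (intro mult_mono) auto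
    finally show "vnorm W (f x) \<le> \<bar>K\<bar>" by simp
  qed
qed

lemma op_norm_nonneg:
  assumes "bounded_map V W f"
  shows "0 \<le> op_norm V W f"
proof -
  have f: "f \<zero>\<^bsub>V\<^esub> = \<zero>\<^bsub>W\<^esub>"
    using assms linear_map_zero V.is_real_module W.is_real_module unfolding bounded_map_def by blast
  have "vnorm W (f \<zero>\<^bsub>V\<^esub>) \<le> op_norm V W f"
    unfolding op_norm_def by (rule cSUP_upper[OF _ op_norm_bdd[OF assms]]) simp
  then show ?thesis by (simp add: f)
qed

lemma op_norm_upper:
  assumes f: "bounded_map V W f" and x: "x \<in> carrier V"
  shows "vnorm W (f x) \<le> op_norm V W f * vnorm V x"
proof (cases "vnorm V x = 0")
  case True
  then have "x = \<zero>\<^bsub>V\<^esub>" using x V.vnorm_eq_0_iff by blast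
  then have "f x = \<zero>\<^bsub>W\<^esub>"
    using f linear_map_zero V.is_real_module W.is_real_module unfolding bounded_map_def by blast
  then show ?thesis using True by simp
next
  case False
  define r where "r = inverse (vnorm V x)"
  have nx: "vnorm V x > 0" using False V.vnorm_nonneg[OF x] by linarith
  have lin: "linear_map V W f" using f by (simp add: bounded_map_def)
  have y: "r \<odot>\<^bsub>V\<^esub> x \<in> carrier V" using x by (intro V.smult_closed) auto
  have "vnorm V (r \<odot>\<^bsub>V\<^esub> x) = 1" using V.vnorm_smult[OF x, of r] nx by (simp add: r_def)
  then have "vnorm W (f (r \<odot>\<^bsub>V\<^esub> x)) \<le> op_norm V W f"
    unfolding op_norm_def using y by (intro cSUP_upper[OF _ op_norm_bdd[OF f]]) auto
  moreover have "vnorm W (f (r \<odot>\<^bsub>V\<^esub> x)) = r * vnorm W (f x)"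
    unfolding linear_map_smult[OF lin x] W.vnorm_smult[OF linear_map_closed[OF lin x]]
    using nx by (simp add: r_def)
  ultimately have "vnorm W (f x) / vnorm V x \<le> op_norm V W f"
    by (simp add: r_def divide_inverse mult.commute)
  then show ?thesis using nx by (simp only: pos_divide_le_eq)
qed

lemma op_norm_least:
  assumes "0 \<le> K" "\<And>x. x \<in> carrier V \<Longrightarrow> vnorm W (f x) \<le> K * vnorm V x"
  shows "op_norm V W f \<le> K"
  unfolding op_norm_def
proof (rule cSUP_least)
  show "{x \<in> carrier V. vnorm V x \<le> 1} \<noteq> {}" using V.zero_closed V.vnorm_zero by force
  fix x assume x: "x \<in> {x \<in> carrier V. vnorm V x \<le> 1}"
  then have "vnorm W (f x) \<le> K * vnorm V x" using assms(2) by blast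
  also have "\<dots> \<le> K * 1" using x assms(1) by (intro mult_left_mono) auto
  finally show "vnorm W (f x) \<le> K" by simp
qed

lemma bounded_mapI:
  assumes "linear_map V W f" "\<And>x. x \<in> carrier V \<Longrightarrow> vnorm W (f x) \<le> K * vnorm V x"
  shows "bounded_map V W f"
  using assms unfolding bounded_map_def by blast

lemma bounded_maps_simps [simp]:
  "\<zero>\<^bsub>bounded_maps V W\<^esub> = (\<lambda>x\<in>carrier V. \<zero>\<^bsub>W\<^esub>)"
  "f \<oplus>\<^bsub>bounded_maps V W\<^esub> g = (\<lambda>x\<in>carrier V. f x \<oplus>\<^bsub>W\<^esub> g x)"
  "r \<odot>\<^bsub>bounded_maps V W\<^esub> f = (\<lambda>x\<in>carrier V. r \<odot>\<^bsub>W\<^esub> f x)"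
  "vnorm (bounded_maps V W) f = op_norm V W f"
  by (simp_all add: bounded_maps_def)

lemma bounded_maps_mem: "f \<in> carrier (bounded_maps V W) \<longleftrightarrow> f \<in> extensional (carrier V) \<and> bounded_map V W f"
  by (simp add: bounded_maps_def)

lemma bounded_maps_closed:
  "f \<in> carrier (bounded_maps V W) \<Longrightarrow> x \<in> carrier V \<Longrightarrow> f x \<in> carrier W"
  by (auto simp: bounded_maps_mem bounded_map_def linear_map_closed)

lemma bounded_maps_bound:
  "f \<in> carrier (bounded_maps V W) \<Longrightarrow> x \<in> carrier V \<Longrightarrow> vnorm W (f x) \<le> op_norm V W f * vnorm V x"
  by (auto simp: bounded_maps_mem op_norm_upper)

lemma bounded_maps_eqI:
  "f \<in> carrier (bounded_maps V W) \<Longrightarrow> g \<in> carrier (bounded_maps V W)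
    \<Longrightarrow> (\<And>x. x \<in> carrier V \<Longrightarrow> f x = g x) \<Longrightarrow> f = g"
  unfolding bounded_maps_mem by (blast intro: extensionalityI)

lemma bounded_maps_memI:
  assumes "f \<in> extensional (carrier V)"
    and "\<And>x. x \<in> carrier V \<Longrightarrow> f x \<in> carrier W"
    and "\<And>x y. x \<in> carrier V \<Longrightarrow> y \<in> carrier V \<Longrightarrow> f (x \<oplus>\<^bsub>V\<^esub> y) = f x \<oplus>\<^bsub>W\<^esub> f y"
    and "\<And>x r. x \<in> carrier V \<Longrightarrow> f (r \<odot>\<^bsub>V\<^esub> x) = r \<odot>\<^bsub>W\<^esub> f x"
    and "\<And>x. x \<in> carrier V \<Longrightarrow> vnorm W (f x) \<le> K * vnorm V x"
  shows "f \<in> carrier (bounded_maps V W)"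
  unfolding bounded_maps_mem
  by (intro conjI assms(1) bounded_mapI[of _ K] assms(5)) (simp_all add: linear_map_def assms)

lemma bounded_maps_add_closed:
  assumes f: "f \<in> carrier (bounded_maps V W)" and g: "g \<in> carrier (bounded_maps V W)"
  shows "f \<oplus>\<^bsub>bounded_maps V W\<^esub> g \<in> carrier (bounded_maps V W)"
    and "op_norm V W (f \<oplus>\<^bsub>bounded_maps V W\<^esub> g) \<le> op_norm V W f + op_norm V W g"
proof -
  have lin: "linear_map V W f" "linear_map V W g" and bd: "bounded_map V W f" "bounded_map V W g"
    using f g by (simp_all add: bounded_maps_mem bounded_map_def)
  have bound: "vnorm W (f x \<oplus>\<^bsub>W\<^esub> g x) \<le> (op_norm V W f + op_norm V W g) * vnorm V x"
    if "x \<in> carrier V" for x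
    using W.vnorm_triangle[OF bounded_maps_closed[OF f that] bounded_maps_closed[OF g that]]
      bounded_maps_bound[OF f that] bounded_maps_bound[OF g that] by (simp add: distrib_right)
  have smult: "r \<odot>\<^bsub>V\<^esub> x \<in> carrier V" if "x \<in> carrier V" for r x
    using that by (intro V.smult_closed) auto
  show "f \<oplus>\<^bsub>bounded_maps V W\<^esub> g \<in> carrier (bounded_maps V W)"
    by (rule bounded_maps_memI)
      (use bound smult in \<open>auto simp: bounded_maps_closed[OF f] bounded_maps_closed[OF g] linear_map_add[OF lin(1)]
        linear_map_add[OF lin(2)] linear_map_smult[OF lin(1)] linear_map_smult[OF lin(2)] W.M.a_ac W.smult_r_distr\<close>)
  show "op_norm V W (f \<oplus>\<^bsub>bounded_maps V W\<^esub> g) \<le> op_norm V W f + op_norm V W g"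
    by (rule op_norm_least) (use bound op_norm_nonneg bd in auto)
qed

lemma bounded_maps_smult_closed:
  assumes f: "f \<in> carrier (bounded_maps V W)"
  shows "r \<odot>\<^bsub>bounded_maps V W\<^esub> f \<in> carrier (bounded_maps V W)"
    and "op_norm V W (r \<odot>\<^bsub>bounded_maps V W\<^esub> f) \<le> \<bar>r\<bar> * op_norm V W f"
proof -
  have lin: "linear_map V W f" and bd: "bounded_map V W f"
    using f by (simp_all add: bounded_maps_mem bounded_map_def)
  have bound: "vnorm W (r \<odot>\<^bsub>W\<^esub> f x) \<le> (\<bar>r\<bar> * op_norm V W f) * vnorm V x" if "x \<in> carrier V" for x
    using W.vnorm_smult[OF bounded_maps_closed[OF f that], of r] bounded_maps_bound[OF f that]
    by (simp add: mult_left_mono mult.assoc)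
  have smult: "r \<odot>\<^bsub>V\<^esub> x \<in> carrier V" if "x \<in> carrier V" for r x
    using that by (intro V.smult_closed) auto
  have comm: "r \<odot>\<^bsub>W\<^esub> (s \<odot>\<^bsub>W\<^esub> y) = s \<odot>\<^bsub>W\<^esub> (r \<odot>\<^bsub>W\<^esub> y)" if "y \<in> carrier W" for s y
    using W.smult_assoc1[of r s y] W.smult_assoc1[of s r y] that by (simp add: mult.commute)
  show "r \<odot>\<^bsub>bounded_maps V W\<^esub> f \<in> carrier (bounded_maps V W)"
    by (rule bounded_maps_memI)
      (use bound smult comm in \<open>auto simp: bounded_maps_closed[OF f] linear_map_add[OF lin(1)]
        linear_map_smult[OF lin(1)] W.smult_r_distr\<close>)
  show "op_norm V W (r \<odot>\<^bsub>bounded_maps V W\<^esub> f) \<le> \<bar>r\<bar> * op_norm V W f"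
    by (rule op_norm_least) (use bound op_norm_nonneg bd in auto)
qed

lemma bounded_maps_zero_closed: "\<zero>\<^bsub>bounded_maps V W\<^esub> \<in> carrier (bounded_maps V W)"
  by (rule bounded_maps_memI[of _ 0]) (auto intro!: V.smult_closed simp: W.smult_r_null)

lemma op_norm_zero: "op_norm V W \<zero>\<^bsub>bounded_maps V W\<^esub> = 0"
proof (rule antisym)
  show "op_norm V W \<zero>\<^bsub>bounded_maps V W\<^esub> \<le> 0" by (rule op_norm_least) auto
  show "0 \<le> op_norm V W \<zero>\<^bsub>bounded_maps V W\<^esub>"
    using bounded_maps_zero_closed by (intro op_norm_nonneg) (simp add: bounded_maps_mem)
qed

lemma real_module_bounded_maps: "real_module (bounded_maps V W)"
proof (rule real_moduleI)
  fix f g k assume "f \<in> carrier (bounded_maps V W)" "g \<in> carrier (bounded_maps V W)" "k \<in> carrier (bounded_maps V W)"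
  then show "f \<oplus>\<^bsub>bounded_maps V W\<^esub> g \<oplus>\<^bsub>bounded_maps V W\<^esub> k
      = f \<oplus>\<^bsub>bounded_maps V W\<^esub> (g \<oplus>\<^bsub>bounded_maps V W\<^esub> k)"
    by (auto simp: bounded_maps_closed W.M.a_assoc)
next
  fix f assume f: "f \<in> carrier (bounded_maps V W)"
  show "\<zero>\<^bsub>bounded_maps V W\<^esub> \<oplus>\<^bsub>bounded_maps V W\<^esub> f = f"
    by (rule bounded_maps_eqI[OF bounded_maps_add_closed(1)[OF bounded_maps_zero_closed f] f])
      (simp add: bounded_maps_closed[OF f])
  show "0 \<odot>\<^bsub>bounded_maps V W\<^esub> f = \<zero>\<^bsub>bounded_maps V W\<^esub>"
    using W.smult_l_null by (auto simp: bounded_maps_closed[OF f])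
  show "1 \<odot>\<^bsub>bounded_maps V W\<^esub> f = f"
    by (rule bounded_maps_eqI[OF bounded_maps_smult_closed(1)[OF f] f])
      (use W.smult_one in \<open>simp add: bounded_maps_closed[OF f]\<close>)
  show "(r + s) \<odot>\<^bsub>bounded_maps V W\<^esub> f
      = r \<odot>\<^bsub>bounded_maps V W\<^esub> f \<oplus>\<^bsub>bounded_maps V W\<^esub> s \<odot>\<^bsub>bounded_maps V W\<^esub> f" for r s
    using W.smult_l_distr[of r s] by (auto simp: bounded_maps_closed[OF f])
  show "(r * s) \<odot>\<^bsub>bounded_maps V W\<^esub> f = r \<odot>\<^bsub>bounded_maps V W\<^esub> (s \<odot>\<^bsub>bounded_maps V W\<^esub> f)" for r s
    using W.smult_assoc1[of r s] by (auto simp: bounded_maps_closed[OF f])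
  fix g assume g: "g \<in> carrier (bounded_maps V W)"
  show "f \<oplus>\<^bsub>bounded_maps V W\<^esub> g = g \<oplus>\<^bsub>bounded_maps V W\<^esub> f"
    by (auto simp: bounded_maps_closed[OF f] bounded_maps_closed[OF g] W.M.a_comm)
  show "r \<odot>\<^bsub>bounded_maps V W\<^esub> (f \<oplus>\<^bsub>bounded_maps V W\<^esub> g)
      = r \<odot>\<^bsub>bounded_maps V W\<^esub> f \<oplus>\<^bsub>bounded_maps V W\<^esub> r \<odot>\<^bsub>bounded_maps V W\<^esub> g" for r
    by (auto simp: bounded_maps_closed[OF f] bounded_maps_closed[OF g] W.smult_r_distr)
qed (use bounded_maps_add_closed(1) bounded_maps_smult_closed(1) bounded_maps_zero_closed in blast)+

lemma normed_space_bounded_maps: "normed_space (bounded_maps V W)"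
proof (rule normed_spaceI[OF real_module_bounded_maps])
  fix f assume f: "f \<in> carrier (bounded_maps V W)"
  show "f = \<zero>\<^bsub>bounded_maps V W\<^esub>" if "vnorm (bounded_maps V W) f = 0"
  proof (rule bounded_maps_eqI[OF f bounded_maps_zero_closed])
    fix x assume x: "x \<in> carrier V"
    have "vnorm W (f x) \<le> 0" using bounded_maps_bound[OF f x] that by simp
    then have "vnorm W (f x) = 0"
      using W.vnorm_nonneg[OF bounded_maps_closed[OF f x]] by linarith
    then show "f x = \<zero>\<^bsub>bounded_maps V W\<^esub> x"
      using W.vnorm_eq_0_iff bounded_maps_closed[OF f x] x by simp
  qed
  show "vnorm (bounded_maps V W) (r \<odot>\<^bsub>bounded_maps V W\<^esub> f) = \<bar>r\<bar> * vnorm (bounded_maps V W) f" for r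
  proof (cases "r = 0")
    case True
    then have "r \<odot>\<^bsub>bounded_maps V W\<^esub> f = \<zero>\<^bsub>bounded_maps V W\<^esub>"
      using W.smult_l_null by (auto simp: bounded_maps_closed[OF f])
    with True show ?thesis by (metis op_norm_zero bounded_maps_simps(4) abs_zero mult_zero_left)
  next
    case False
    \<comment> \<open>\<open>bounded_maps_smult_closed\<close> gives only one inequality. Applying
      it to \<open>inverse r\<close> and the multiple of \<open>f\<close> by \<open>r\<close> yields
      the converse.\<close>
    have "f = inverse r \<odot>\<^bsub>bounded_maps V W\<^esub> (r \<odot>\<^bsub>bounded_maps V W\<^esub> f)"
      by (rule bounded_maps_eqI[OF f bounded_maps_smult_closed(1)[OF bounded_maps_smult_closed(1)[OF f]]])
        (use W.smult_assoc1[of "inverse r" r] W.smult_one False in \<open>simp add: bounded_maps_closed[OF f]\<close>)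
    then have "op_norm V W f = op_norm V W (inverse r \<odot>\<^bsub>bounded_maps V W\<^esub> (r \<odot>\<^bsub>bounded_maps V W\<^esub> f))"
      by (rule arg_cong)
    also have "\<dots> \<le> \<bar>inverse r\<bar> * op_norm V W (r \<odot>\<^bsub>bounded_maps V W\<^esub> f)"
      by (rule bounded_maps_smult_closed(2)[OF bounded_maps_smult_closed(1)[OF f]])
    finally have "op_norm V W f \<le> \<bar>inverse r\<bar> * op_norm V W (r \<odot>\<^bsub>bounded_maps V W\<^esub> f)" .
    then have "\<bar>r\<bar> * op_norm V W f \<le> op_norm V W (r \<odot>\<^bsub>bounded_maps V W\<^esub> f)"
      using False by (simp add: abs_inverse field_simps del: bounded_maps_simps)
    then show ?thesis
      using bounded_maps_smult_closed(2)[OF f, of r] unfolding bounded_maps_simps(4) by linarith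
  qed
  fix g assume g: "g \<in> carrier (bounded_maps V W)"
  show "vnorm (bounded_maps V W) (f \<oplus>\<^bsub>bounded_maps V W\<^esub> g) \<le> vnorm (bounded_maps V W) f + vnorm (bounded_maps V W) g"
    unfolding bounded_maps_simps(4) by (rule bounded_maps_add_closed(2)[OF f g])
qed (simp only: bounded_maps_simps(4) op_norm_zero)

end

lemma real_space_simps [simp]:
  "carrier real_space = UNIV" "\<zero>\<^bsub>real_space\<^esub> = 0" "x \<oplus>\<^bsub>real_space\<^esub> y = x + y"
  "r \<odot>\<^bsub>real_space\<^esub> x = r * x" "vnorm real_space x = \<bar>x\<bar>"
  by (simp_all add: real_space_def)

lemma normed_space_real_space: "normed_space real_space"
  by (rule normed_spaceI, rule real_moduleI) (auto simp: algebra_simps abs_mult abs_triangle_ineq)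

section \<open>Inverses in a groupoid\<close>

context groupoid begin

lemma is_inverse_unique:
  assumes "g \<in> arrs G" "is_inverse G g h" "is_inverse G g k"
  shows "h = k"
proof -
  have h: "h \<in> arrs G" "src G h = tgt G g" "tgt G h = src G g" "cmp G h g = idn G (src G g)"
    and k: "k \<in> arrs G" "src G k = tgt G g" "tgt G k = src G g" "cmp G g k = idn G (tgt G g)"
    using assms(2,3) by (simp_all add: is_inverse_def)
  have "h = cmp G h (cmp G g k)" using cmp_idn_right[OF h(1)] h k by simp
  also have "\<dots> = cmp G (cmp G h g) k" using cmp_assoc[of h g k] h k assms(1) by simp
  also have "\<dots> = k" using cmp_idn_left[OF k(1)] h k by simp
  finally show ?thesis .
qed

lemma ginv_eqI: "g \<in> arrs G \<Longrightarrow> is_inverse G g h \<Longrightarrow> ginv G g = h"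
  unfolding ginv_def by (rule the_equality) (auto intro: is_inverse_unique)

lemma is_inverse_ginv: "g \<in> arrs G \<Longrightarrow> is_inverse G g (ginv G g)"
  using invertible ginv_eqI by metis

lemma ginv_closed [simp]: "g \<in> arrs G \<Longrightarrow> ginv G g \<in> arrs G"
  and src_ginv [simp]: "g \<in> arrs G \<Longrightarrow> src G (ginv G g) = tgt G g"
  and tgt_ginv [simp]: "g \<in> arrs G \<Longrightarrow> tgt G (ginv G g) = src G g"
  and cmp_ginv_left: "g \<in> arrs G \<Longrightarrow> cmp G (ginv G g) g = idn G (src G g)"
  and cmp_ginv_right: "g \<in> arrs G \<Longrightarrow> cmp G g (ginv G g) = idn G (tgt G g)"
  by (drule is_inverse_ginv, simp add: is_inverse_def)+

lemmas arr_simps [simp] = src_closed tgt_closed cmp_closed src_cmp tgt_cmp idn_closed src_idn tgt_idn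

lemma cmp_idn_left' [simp]: "g \<in> arrs G \<Longrightarrow> tgt G g = e \<Longrightarrow> cmp G (idn G e) g = g"
  using cmp_idn_left by blast

lemma cmp_idn_right' [simp]: "g \<in> arrs G \<Longrightarrow> src G g = e \<Longrightarrow> cmp G g (idn G e) = g"
  using cmp_idn_right by blast

lemma ginv_cmp_cancel [simp]:
  assumes "g \<in> arrs G" "h \<in> arrs G"
  shows "src G g = tgt G h \<Longrightarrow> cmp G (ginv G g) (cmp G g h) = h"
    and "tgt G g = tgt G h \<Longrightarrow> cmp G g (cmp G (ginv G g) h) = h"
  using assms by (simp_all add: cmp_ginv_left cmp_ginv_right flip: cmp_assoc)

lemma ginv_cmp:
  assumes "g \<in> arrs G" "h \<in> arrs G" "src G g = tgt G h"
  shows "ginv G (cmp G g h) = cmp G (ginv G h) (ginv G g)"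
  by (rule ginv_eqI) (use assms in \<open>simp_all add: is_inverse_def cmp_assoc cmp_ginv_left cmp_ginv_right\<close>)

lemma ginv_idn: "e \<in> objs G \<Longrightarrow> ginv G (idn G e) = idn G e"
  by (rule ginv_eqI) (simp_all add: is_inverse_def)

end

section \<open>Normed modules and modules of bounded maps\<close>

context normed_gmodule begin

lemma fib_real_module: "e \<in> objs G \<Longrightarrow> real_module (fib V e)"
  using fib_normed normed_space.is_real_module by blast

lemma act_closed: "g \<in> arrs G \<Longrightarrow> src G g = e \<Longrightarrow> v \<in> carrier (fib V e) \<Longrightarrow> act V g v \<in> carrier (fib V (tgt G g))"
  by (rule linear_map_closed[OF act_linear]) auto

lemma act_norm: "g \<in> arrs G \<Longrightarrow> v \<in> carrier (fib V (src G g)) \<Longrightarrow> vnorm (fib V (tgt G g)) (act V g v) = vnorm (fib V (src G g)) v"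
  using act_isometric unfolding isometric_on_def by blast

lemma act_ginv_act: "g \<in> arrs G \<Longrightarrow> v \<in> carrier (fib V (src G g)) \<Longrightarrow> act V (ginv G g) (act V g v) = v"
  by (simp add: act_cmp cmp_ginv_left act_idn)

lemma act_ginv_closed: "g \<in> arrs G \<Longrightarrow> v \<in> carrier (fib V (tgt G g)) \<Longrightarrow> act V (ginv G g) v \<in> carrier (fib V (src G g))"
  using act_closed[of "ginv G g" _ v] by simp

lemma act_ginv_norm: "g \<in> arrs G \<Longrightarrow> v \<in> carrier (fib V (tgt G g)) \<Longrightarrow> vnorm (fib V (src G g)) (act V (ginv G g) v) = vnorm (fib V (tgt G g)) v"
  using act_norm[of "ginv G g" v] by simp

end

text \<open>Since inverses act as well, an action that does not increase norms preserves them.\<close>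

lemma (in groupoid) normed_gmoduleI:
  assumes "\<And>e. e \<in> objs G \<Longrightarrow> normed_space (fib V e)"
    and lin: "\<And>g. g \<in> arrs G \<Longrightarrow> linear_map (fib V (src G g)) (fib V (tgt G g)) (act V g)"
    and le: "\<And>g v. g \<in> arrs G \<Longrightarrow> v \<in> carrier (fib V (src G g))
      \<Longrightarrow> vnorm (fib V (tgt G g)) (act V g v) \<le> vnorm (fib V (src G g)) v"
    and cmp: "\<And>g h v. g \<in> arrs G \<Longrightarrow> h \<in> arrs G \<Longrightarrow> src G g = tgt G h \<Longrightarrow> v \<in> carrier (fib V (src G h))
      \<Longrightarrow> act V g (act V h v) = act V (cmp G g h) v"
    and idn: "\<And>e v. e \<in> objs G \<Longrightarrow> v \<in> carrier (fib V e) \<Longrightarrow> act V (idn G e) v = v"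
  shows "normed_gmodule G V"
proof (intro normed_gmodule.intro normed_gmodule_axioms.intro groupoid_axioms)
  fix g assume g: "g \<in> arrs G"
  show "isometric_on (fib V (src G g)) (fib V (tgt G g)) (act V g)"
    unfolding isometric_on_def
  proof (intro ballI antisym)
    fix v assume v: "v \<in> carrier (fib V (src G g))"
    have "act V (ginv G g) (act V g v) = v" using g v by (simp add: cmp cmp_ginv_left idn)
    then show "vnorm (fib V (src G g)) v \<le> vnorm (fib V (tgt G g)) (act V g v)"
      using le[of "ginv G g" "act V g v"] g linear_map_closed[OF lin[OF g] v] by simp
  qed (use le g in blast)
qed (use assms in auto)

lemma hom_gmod_simps [simp]:
  "fib (hom_gmod G V W) e = bounded_maps (fib V e) (fib W e)"
  "act (hom_gmod G V W) g f = (\<lambda>v\<in>carrier (fib V (tgt G g)). act W g (f (act V (ginv G g) v)))"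
  by (simp_all add: hom_gmod_def)

text \<open>Conjugating by isometries cannot increase an operator norm; the converse estimate is
  supplied by \<open>normed_gmoduleI\<close>. Associativity of the action comes from the order
  reversal in \<open>ginv_cmp\<close>.\<close>

lemma normed_gmodule_hom_gmod:
  assumes "normed_gmodule G V" "normed_gmodule G W"
  shows "normed_gmodule G (hom_gmod G V W)"
proof -
  interpret V: normed_gmodule G V by fact
  interpret W: normed_gmodule G W by fact
  have pair: "normed_space_pair (fib V e) (fib W e)" if "e \<in> objs G" for e
    using V.fib_normed[OF that] W.fib_normed[OF that] by (rule normed_space_pair.intro)
  have closed: "act (hom_gmod G V W) g f \<in> carrier (fib (hom_gmod G V W) (tgt G g))"
    and bound: "vnorm (fib (hom_gmod G V W) (tgt G g)) (act (hom_gmod G V W) g f) \<le> vnorm (fib (hom_gmod G V W) (src G g)) f"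
    if g: "g \<in> arrs G" and f: "f \<in> carrier (fib (hom_gmod G V W) (src G g))" for g f
  proof -
    interpret s: normed_space_pair "fib V (src G g)" "fib W (src G g)" using g by (intro pair) simp
    interpret t: normed_space_pair "fib V (tgt G g)" "fib W (tgt G g)" using g by (intro pair) simp
    let ?f = "act (hom_gmod G V W) g f"
    have f': "f \<in> carrier (bounded_maps (fib V (src G g)) (fib W (src G g)))" using f by simp
    then have lin: "linear_map (fib V (src G g)) (fib W (src G g)) f"
      by (simp add: s.bounded_maps_mem bounded_map_def)
    have Vlin: "linear_map (fib V (tgt G g)) (fib V (src G g)) (act V (ginv G g))"
      using V.act_linear[of "ginv G g"] g by simp
    note Wlin = W.act_linear[OF g]
    note cl = V.act_ginv_closed[OF g] s.bounded_maps_closed[OF f']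
    have smult: "r \<odot>\<^bsub>fib V (tgt G g)\<^esub> x \<in> carrier (fib V (tgt G g))" if "x \<in> carrier (fib V (tgt G g))" for r x
      using that by (intro t.V.smult_closed) auto
    have b: "vnorm (fib W (tgt G g)) (?f v) \<le> op_norm (fib V (src G g)) (fib W (src G g)) f * vnorm (fib V (tgt G g)) v"
      if "v \<in> carrier (fib V (tgt G g))" for v
      using s.bounded_maps_bound[OF f' cl(1)[OF that]] that
      by (simp add: W.act_norm[OF g] cl V.act_ginv_norm[OF g])
    show "?f \<in> carrier (fib (hom_gmod G V W) (tgt G g))"
      unfolding hom_gmod_simps(1)
    proof (rule t.bounded_maps_memI[OF _ _ _ _ b])
      show "?f \<in> extensional (carrier (fib V (tgt G g)))"
        unfolding hom_gmod_simps(2) by (rule restrict_extensional)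
    qed (simp_all add: cl W.act_closed[OF g refl] smult linear_map_add[OF Vlin] linear_map_add[OF lin]
          linear_map_add[OF Wlin] linear_map_smult[OF Vlin] linear_map_smult[OF lin] linear_map_smult[OF Wlin])
    show "vnorm (fib (hom_gmod G V W) (tgt G g)) ?f \<le> vnorm (fib (hom_gmod G V W) (src G g)) f"
      unfolding hom_gmod_simps(1) s.bounded_maps_simps t.bounded_maps_simps
      using f' by (intro t.op_norm_least b s.op_norm_nonneg) (auto simp: s.bounded_maps_mem)
  qed
  show ?thesis
  proof (rule V.normed_gmoduleI)
    show "normed_space (fib (hom_gmod G V W) e)" if "e \<in> objs G" for e
      using normed_space_pair.normed_space_bounded_maps[OF pair[OF that]] by simp
    fix g assume g: "g \<in> arrs G"
    interpret s: normed_space_pair "fib V (src G g)" "fib W (src G g)" using g by (intro pair) simp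
    interpret t: normed_space_pair "fib V (tgt G g)" "fib W (tgt G g)" using g by (intro pair) simp
    note Wlin = W.act_linear[OF g]
    show "linear_map (fib (hom_gmod G V W) (src G g)) (fib (hom_gmod G V W) (tgt G g)) (act (hom_gmod G V W) g)"
      unfolding linear_map_def
    proof (intro conjI funcsetI ballI allI)
      fix f assume f: "f \<in> carrier (fib (hom_gmod G V W) (src G g))"
      then have f': "f \<in> carrier (bounded_maps (fib V (src G g)) (fib W (src G g)))" by simp
      show "act (hom_gmod G V W) g f \<in> carrier (fib (hom_gmod G V W) (tgt G g))" by (rule closed[OF g f])
      show "act (hom_gmod G V W) g (r \<odot>\<^bsub>fib (hom_gmod G V W) (src G g)\<^esub> f)
          = r \<odot>\<^bsub>fib (hom_gmod G V W) (tgt G g)\<^esub> act (hom_gmod G V W) g f" for r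
        by (auto simp: V.act_ginv_closed[OF g] linear_map_smult[OF Wlin] s.bounded_maps_closed[OF f'])
      fix k assume "k \<in> carrier (fib (hom_gmod G V W) (src G g))"
      then have k': "k \<in> carrier (bounded_maps (fib V (src G g)) (fib W (src G g)))" by simp
      show "act (hom_gmod G V W) g (f \<oplus>\<^bsub>fib (hom_gmod G V W) (src G g)\<^esub> k)
          = act (hom_gmod G V W) g f \<oplus>\<^bsub>fib (hom_gmod G V W) (tgt G g)\<^esub> act (hom_gmod G V W) g k"
        by (auto simp: V.act_ginv_closed[OF g] linear_map_add[OF Wlin] s.bounded_maps_closed[OF f']
            s.bounded_maps_closed[OF k'])
    qed
  next
    fix g h f assume gh: "g \<in> arrs G" "h \<in> arrs G" "src G g = tgt G h"
      and f: "f \<in> carrier (fib (hom_gmod G V W) (src G h))"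
    interpret s: normed_space_pair "fib V (src G h)" "fib W (src G h)" using gh by (intro pair) simp
    have f': "f \<in> carrier (bounded_maps (fib V (src G h)) (fib W (src G h)))" using f by simp
    have "act W g (act W h (f (act V (ginv G h) (act V (ginv G g) v))))
        = act W (cmp G g h) (f (act V (ginv G (cmp G g h)) v))" if v: "v \<in> carrier (fib V (tgt G g))" for v
    proof -
      have "act V (ginv G h) (act V (ginv G g) v) = act V (ginv G (cmp G g h)) v"
        using gh v by (simp add: V.act_cmp V.ginv_cmp)
      moreover have "act V (ginv G (cmp G g h)) v \<in> carrier (fib V (src G h))"
        using V.act_ginv_closed[of "cmp G g h" v] gh v by simp
      ultimately show ?thesis using gh by (simp add: W.act_cmp s.bounded_maps_closed[OF f'])
    qed
    then show "act (hom_gmod G V W) g (act (hom_gmod G V W) h f) = act (hom_gmod G V W) (cmp G g h) f"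
      using gh V.act_ginv_closed[OF gh(1)] by (auto simp: restrict_def)
  next
    fix e f assume e: "e \<in> objs G" and f: "f \<in> carrier (fib (hom_gmod G V W) e)"
    interpret s: normed_space_pair "fib V e" "fib W e" using e by (rule pair)
    have f': "f \<in> carrier (bounded_maps (fib V e) (fib W e))" using f by simp
    have f'': "act (hom_gmod G V W) (idn G e) f \<in> carrier (bounded_maps (fib V e) (fib W e))"
      using closed[of "idn G e" f] e f by (simp del: hom_gmod_simps(2))
    show "act (hom_gmod G V W) (idn G e) f = f"
      by (rule s.bounded_maps_eqI[OF f'' f'])
        (use e in \<open>simp add: V.ginv_idn V.act_idn W.act_idn s.bounded_maps_closed[OF f']\<close>)
  qed (use bound in blast)
qed

lemma trivial_gmod_simps [simp]: "fib trivial_gmod e = real_space" "act trivial_gmod g x = x"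
  by (simp_all add: trivial_gmod_def)

lemma (in groupoid) normed_gmodule_trivial_gmod: "normed_gmodule G trivial_gmod"
  by (rule normed_gmoduleI) (auto simp: normed_space_real_space linear_map_def)

lemma normed_gmodule_dual_gmod: "normed_gmodule G V \<Longrightarrow> normed_gmodule G (dual_gmod G V)"
  unfolding dual_gmod_def
  by (intro normed_gmodule_hom_gmod groupoid.normed_gmodule_trivial_gmod normed_gmodule.axioms(1))

section \<open>The space of invariants\<close>

context normed_gmodule begin

lemma invariants_simps:
  "\<zero>\<^bsub>invariants G V\<^esub> = (\<lambda>e\<in>objs G. \<zero>\<^bsub>fib V e\<^esub>)"
  "v \<oplus>\<^bsub>invariants G V\<^esub> w = (\<lambda>e\<in>objs G. v e \<oplus>\<^bsub>fib V e\<^esub> w e)"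
  "r \<odot>\<^bsub>invariants G V\<^esub> v = (\<lambda>e\<in>objs G. r \<odot>\<^bsub>fib V e\<^esub> v e)"
  "vnorm (invariants G V) v = sup0 ((\<lambda>e. vnorm (fib V e) (v e)) ` objs G)"
  by (simp_all add: invariants_def)

lemma invariants_mem:
  "v \<in> carrier (invariants G V) \<longleftrightarrow> v \<in> extensional (objs G) \<and>
     (\<forall>e\<in>objs G. v e \<in> carrier (fib V e)) \<and>
     (\<forall>g\<in>arrs G. act V g (v (src G g)) = v (tgt G g)) \<and>
     bdd_above ((\<lambda>e. vnorm (fib V e) (v e)) ` objs G)"
  by (auto simp: invariants_def PiE_def Pi_def)

lemma invariants_memI:
  assumes "v \<in> extensional (objs G)" "\<And>e. e \<in> objs G \<Longrightarrow> v e \<in> carrier (fib V e)"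
    and "\<And>g. g \<in> arrs G \<Longrightarrow> act V g (v (src G g)) = v (tgt G g)"
    and "\<And>e. e \<in> objs G \<Longrightarrow> vnorm (fib V e) (v e) \<le> K"
  shows "v \<in> carrier (invariants G V)"
  using assms by (auto simp: invariants_mem intro!: bdd_aboveI2[of _ _ K])

lemma invariants_closed: "v \<in> carrier (invariants G V) \<Longrightarrow> e \<in> objs G \<Longrightarrow> v e \<in> carrier (fib V e)"
  by (simp add: invariants_mem)

lemma invariants_act: "v \<in> carrier (invariants G V) \<Longrightarrow> g \<in> arrs G \<Longrightarrow> act V g (v (src G g)) = v (tgt G g)"
  by (simp add: invariants_mem)

lemma invariants_norm_upper:
  "v \<in> carrier (invariants G V) \<Longrightarrow> e \<in> objs G \<Longrightarrow> vnorm (fib V e) (v e) \<le> vnorm (invariants G V) v"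
  unfolding invariants_simps by (rule le_sup0) (auto simp: invariants_mem)

lemma invariants_norm_nonneg: "v \<in> carrier (invariants G V) \<Longrightarrow> 0 \<le> vnorm (invariants G V) v"
  unfolding invariants_simps by (rule sup0_nonneg) (simp add: invariants_mem)

lemma invariants_norm_least:
  "0 \<le> K \<Longrightarrow> (\<And>e. e \<in> objs G \<Longrightarrow> vnorm (fib V e) (v e) \<le> K) \<Longrightarrow> vnorm (invariants G V) v \<le> K"
  unfolding invariants_simps by (rule sup0_le) auto

lemma invariants_eqI:
  "v \<in> carrier (invariants G V) \<Longrightarrow> w \<in> carrier (invariants G V)
    \<Longrightarrow> (\<And>e. e \<in> objs G \<Longrightarrow> v e = w e) \<Longrightarrow> v = w"
  unfolding invariants_mem by (blast intro: extensionalityI)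

lemma real_module_invariants: "real_module (invariants G V)"
proof -
  have sm: "r \<odot>\<^bsub>fib V e\<^esub> x \<in> carrier (fib V e)" if "e \<in> objs G" "x \<in> carrier (fib V e)" for e r x
    using Module.module.smult_closed[OF fib_real_module[OF that(1)]] that(2) by simp
  have ad: "x \<oplus>\<^bsub>fib V e\<^esub> y \<in> carrier (fib V e)"
    if "e \<in> objs G" "x \<in> carrier (fib V e)" "y \<in> carrier (fib V e)" for e x y
    using that fib_real_module[OF that(1)] by (meson abelian_groupE(1) Module.module_def)
  have ze: "\<zero>\<^bsub>fib V e\<^esub> \<in> carrier (fib V e)" if "e \<in> objs G" for e
    using fib_real_module[OF that] by (meson abelian_groupE(2) Module.module_def)
  have add: "v \<oplus>\<^bsub>invariants G V\<^esub> w \<in> carrier (invariants G V)"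
    if v: "v \<in> carrier (invariants G V)" and w: "w \<in> carrier (invariants G V)" for v w
  proof (rule invariants_memI[where K = "vnorm (invariants G V) v + vnorm (invariants G V) w"])
    show "act V g ((v \<oplus>\<^bsub>invariants G V\<^esub> w) (src G g)) = (v \<oplus>\<^bsub>invariants G V\<^esub> w) (tgt G g)" if "g \<in> arrs G" for g
      using that v w by (simp add: invariants_simps linear_map_add[OF act_linear] invariants_closed invariants_act)
    show "vnorm (fib V e) ((v \<oplus>\<^bsub>invariants G V\<^esub> w) e) \<le> vnorm (invariants G V) v + vnorm (invariants G V) w"
      if e: "e \<in> objs G" for e
      using normed_space.vnorm_triangle[OF fib_normed[OF e] invariants_closed[OF v e] invariants_closed[OF w e]]
        invariants_norm_upper[OF v e] invariants_norm_upper[OF w e] e by (simp add: invariants_simps(2))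
  qed (use v w ad in \<open>auto simp: invariants_simps(2) invariants_closed\<close>)
  have smult: "r \<odot>\<^bsub>invariants G V\<^esub> v \<in> carrier (invariants G V)" if v: "v \<in> carrier (invariants G V)" for r v
  proof (rule invariants_memI[where K = "\<bar>r\<bar> * vnorm (invariants G V) v"])
    show "act V g ((r \<odot>\<^bsub>invariants G V\<^esub> v) (src G g)) = (r \<odot>\<^bsub>invariants G V\<^esub> v) (tgt G g)" if "g \<in> arrs G" for g
      using that v by (simp add: invariants_simps linear_map_smult[OF act_linear] invariants_closed invariants_act)
    show "vnorm (fib V e) ((r \<odot>\<^bsub>invariants G V\<^esub> v) e) \<le> \<bar>r\<bar> * vnorm (invariants G V) v" if e: "e \<in> objs G" for e
      using normed_space.vnorm_smult[OF fib_normed[OF e] invariants_closed[OF v e], of r]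
        invariants_norm_upper[OF v e] e by (simp add: invariants_simps(3) mult_left_mono)
  qed (use v sm in \<open>auto simp: invariants_simps(3) invariants_closed\<close>)
  have zero: "\<zero>\<^bsub>invariants G V\<^esub> \<in> carrier (invariants G V)"
  proof (rule invariants_memI[where K = 0])
    show "act V g (\<zero>\<^bsub>invariants G V\<^esub> (src G g)) = \<zero>\<^bsub>invariants G V\<^esub> (tgt G g)" if "g \<in> arrs G" for g
      using that linear_map_zero[OF fib_real_module fib_real_module act_linear] by (simp add: invariants_simps)
  qed (use ze normed_space.vnorm_zero[OF fib_normed] in \<open>auto simp: invariants_simps\<close>)
  show ?thesis
  proof (rule real_moduleI)
    fix u v w assume u: "u \<in> carrier (invariants G V)" and v: "v \<in> carrier (invariants G V)"
      and w: "w \<in> carrier (invariants G V)"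
    show "u \<oplus>\<^bsub>invariants G V\<^esub> v \<oplus>\<^bsub>invariants G V\<^esub> w = u \<oplus>\<^bsub>invariants G V\<^esub> (v \<oplus>\<^bsub>invariants G V\<^esub> w)"
    proof (rule invariants_eqI[OF add[OF add[OF u v] w] add[OF u add[OF v w]]])
      fix e assume e: "e \<in> objs G"
      interpret Module.module real_ring "fib V e" by (rule fib_real_module[OF e])
      show "(u \<oplus>\<^bsub>invariants G V\<^esub> v \<oplus>\<^bsub>invariants G V\<^esub> w) e = (u \<oplus>\<^bsub>invariants G V\<^esub> (v \<oplus>\<^bsub>invariants G V\<^esub> w)) e"
        using u v w e by (simp add: invariants_simps invariants_closed M.a_assoc)
    qed
    show "u \<oplus>\<^bsub>invariants G V\<^esub> v = v \<oplus>\<^bsub>invariants G V\<^esub> u"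
    proof (rule invariants_eqI[OF add[OF u v] add[OF v u]])
      fix e assume e: "e \<in> objs G"
      interpret Module.module real_ring "fib V e" by (rule fib_real_module[OF e])
      show "(u \<oplus>\<^bsub>invariants G V\<^esub> v) e = (v \<oplus>\<^bsub>invariants G V\<^esub> u) e"
        using u v e by (simp add: invariants_simps invariants_closed M.a_comm)
    qed
    show "r \<odot>\<^bsub>invariants G V\<^esub> (u \<oplus>\<^bsub>invariants G V\<^esub> v)
        = r \<odot>\<^bsub>invariants G V\<^esub> u \<oplus>\<^bsub>invariants G V\<^esub> r \<odot>\<^bsub>invariants G V\<^esub> v" for r
    proof (rule invariants_eqI[OF smult[OF add[OF u v]] add[OF smult[OF u] smult[OF v]]])
      fix e assume e: "e \<in> objs G"
      interpret Module.module real_ring "fib V e" by (rule fib_real_module[OF e])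
      show "(r \<odot>\<^bsub>invariants G V\<^esub> (u \<oplus>\<^bsub>invariants G V\<^esub> v)) e
          = (r \<odot>\<^bsub>invariants G V\<^esub> u \<oplus>\<^bsub>invariants G V\<^esub> r \<odot>\<^bsub>invariants G V\<^esub> v) e"
        using u v e by (simp add: invariants_simps invariants_closed smult_r_distr)
    qed
  next
    fix v assume v: "v \<in> carrier (invariants G V)"
    show "\<zero>\<^bsub>invariants G V\<^esub> \<oplus>\<^bsub>invariants G V\<^esub> v = v"
    proof (rule invariants_eqI[OF add[OF zero v] v])
      fix e assume e: "e \<in> objs G"
      interpret Module.module real_ring "fib V e" by (rule fib_real_module[OF e])
      show "(\<zero>\<^bsub>invariants G V\<^esub> \<oplus>\<^bsub>invariants G V\<^esub> v) e = v e"
        using v e by (simp add: invariants_simps invariants_closed)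
    qed
    show "0 \<odot>\<^bsub>invariants G V\<^esub> v = \<zero>\<^bsub>invariants G V\<^esub>"
    proof (rule invariants_eqI[OF smult[OF v] zero])
      fix e assume e: "e \<in> objs G"
      interpret Module.module real_ring "fib V e" by (rule fib_real_module[OF e])
      show "(0 \<odot>\<^bsub>invariants G V\<^esub> v) e = \<zero>\<^bsub>invariants G V\<^esub> e"
        using v e smult_l_null by (simp add: invariants_simps invariants_closed)
    qed
    show "1 \<odot>\<^bsub>invariants G V\<^esub> v = v"
    proof (rule invariants_eqI[OF smult[OF v] v])
      fix e assume e: "e \<in> objs G"
      interpret Module.module real_ring "fib V e" by (rule fib_real_module[OF e])
      show "(1 \<odot>\<^bsub>invariants G V\<^esub> v) e = v e"
        using v e smult_one by (simp add: invariants_simps invariants_closed)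
    qed
    fix r s
    show "(r + s) \<odot>\<^bsub>invariants G V\<^esub> v = r \<odot>\<^bsub>invariants G V\<^esub> v \<oplus>\<^bsub>invariants G V\<^esub> s \<odot>\<^bsub>invariants G V\<^esub> v"
    proof (rule invariants_eqI[OF smult[OF v] add[OF smult[OF v] smult[OF v]]])
      fix e assume e: "e \<in> objs G"
      interpret Module.module real_ring "fib V e" by (rule fib_real_module[OF e])
      show "((r + s) \<odot>\<^bsub>invariants G V\<^esub> v) e
          = (r \<odot>\<^bsub>invariants G V\<^esub> v \<oplus>\<^bsub>invariants G V\<^esub> s \<odot>\<^bsub>invariants G V\<^esub> v) e"
        using v e smult_l_distr[of r s] by (simp add: invariants_simps invariants_closed)
    qed
    show "(r * s) \<odot>\<^bsub>invariants G V\<^esub> v = r \<odot>\<^bsub>invariants G V\<^esub> (s \<odot>\<^bsub>invariants G V\<^esub> v)"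
    proof (rule invariants_eqI[OF smult[OF v] smult[OF smult[OF v]]])
      fix e assume e: "e \<in> objs G"
      interpret Module.module real_ring "fib V e" by (rule fib_real_module[OF e])
      show "((r * s) \<odot>\<^bsub>invariants G V\<^esub> v) e = (r \<odot>\<^bsub>invariants G V\<^esub> (s \<odot>\<^bsub>invariants G V\<^esub> v)) e"
        using v e smult_assoc1[of r s] by (simp add: invariants_simps invariants_closed)
    qed
  qed (use add smult zero in blast)+
qed

end

section \<open>Cochains in homogeneous coordinates\<close>

lemma lookup_scaleR [simp]: "Poly_Mapping.lookup (r *\<^sub>R c) x = r * Poly_Mapping.lookup c x"
  for c :: "'a fin_comb"
proof -
  have "finite {x. r * Poly_Mapping.lookup c x \<noteq> 0}"
    by (rule finite_subset[of _ "Poly_Mapping.keys c"]) (auto simp: in_keys_iff)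
  then show ?thesis by (simp add: scaleR_poly_mapping_def)
qed

lemma norm_fin_comb: "norm c = (\<Sum>x\<in>Poly_Mapping.keys c. \<bar>Poly_Mapping.lookup c x\<bar>)"
  for c :: "'a fin_comb"
  by (simp add: norm_poly_mapping_def dist_poly_mapping_def)

text \<open>This is \<open>lin_ext\<close> with an arbitrary real vector space as target, so that
  maps between chains and real-valued cochains obey the same lemmas.\<close>

definition lin_sum :: "('a \<Rightarrow> 'b) \<Rightarrow> 'a fin_comb \<Rightarrow> 'b :: real_vector" where
  "lin_sum F c = (\<Sum>x\<in>Poly_Mapping.keys c. Poly_Mapping.lookup c x *\<^sub>R F x)"

lemma lin_ext_eq_lin_sum: "lin_ext = lin_sum"
  by (intro ext) (simp add: lin_ext_def lin_sum_def)

text \<open>Coefficients may cancel in a sum of chains, so additivity is computed over a finite set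
  that contains the keys of all chains involved.\<close>

lemma lin_sum_superset:
  "finite A \<Longrightarrow> Poly_Mapping.keys c \<subseteq> A \<Longrightarrow> lin_sum F c = (\<Sum>x\<in>A. Poly_Mapping.lookup c x *\<^sub>R F x)"
  unfolding lin_sum_def by (rule sum.mono_neutral_left) (auto simp: in_keys_iff)

lemma lin_sum_add: "lin_sum F (c + d) = lin_sum F c + lin_sum F d"
proof -
  let ?A = "Poly_Mapping.keys c \<union> Poly_Mapping.keys d"
  have "Poly_Mapping.keys (c + d) \<subseteq> ?A" by (rule keys_add)
  then show ?thesis
    by (simp add: lin_sum_superset[of ?A] lookup_add scaleR_left_distrib sum.distrib)
qed

lemma lin_sum_scaleR: "lin_sum F (r *\<^sub>R c) = r *\<^sub>R lin_sum F c"
proof -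
  have "Poly_Mapping.keys (r *\<^sub>R c) \<subseteq> Poly_Mapping.keys c" by (auto simp: in_keys_iff)
  then show ?thesis
    by (simp add: lin_sum_superset[of "Poly_Mapping.keys c"] scaleR_sum_right)
qed

lemma lin_sum_single [simp]: "lin_sum F (Poly_Mapping.single x r) = r *\<^sub>R F x"
  by (simp add: lin_sum_superset[of "{x}"])

lemma lin_sum_zero [simp]: "lin_sum F 0 = 0"
  by (simp add: lin_sum_def)

lemma lin_sum_sum: "lin_sum F (\<Sum>i\<in>I. c i) = (\<Sum>i\<in>I. lin_sum F (c i))"
  by (induction I rule: infinite_finite_induct) (auto simp: lin_sum_add)

lemma lin_sum_lin_sum: "lin_sum F (lin_sum E c) = lin_sum (\<lambda>x. lin_sum F (E x)) c"
  unfolding lin_sum_def[of E] lin_sum_def[of "\<lambda>x. lin_sum F (E x)"]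
  by (simp only: lin_sum_sum lin_sum_scaleR)

lemma lin_sum_cong: "(\<And>x. x \<in> Poly_Mapping.keys c \<Longrightarrow> F x = E x) \<Longrightarrow> lin_sum F c = lin_sum E c"
  by (simp add: lin_sum_def)

lemma lin_sum_fun_add: "lin_sum (\<lambda>x. F x + E x) c = lin_sum F c + lin_sum E c"
  by (simp add: lin_sum_def scaleR_right_distrib sum.distrib)

lemma lin_sum_fun_mult: "lin_sum (\<lambda>x. r * F x) c = r * lin_sum F c" for r :: real
  by (simp add: lin_sum_def sum_distrib_left mult.left_commute)

lemma lin_sum_unit: "lin_sum (\<lambda>x. Poly_Mapping.single x 1) c = c"
  by (rule poly_mapping_eqI)
    (simp add: lin_sum_def lookup_sum lookup_single when_def if_distrib sum.delta in_keys_iff cong: if_cong)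

text \<open>The universal property of the l^1-norm: a bound on the basis is a bound for the linear
  extension, with the same constant. Norms of cochains can therefore be tested on simplices.\<close>

lemma norm_lin_sum:
  fixes F :: "'a \<Rightarrow> 'b :: real_normed_vector"
  assumes "\<And>x. x \<in> Poly_Mapping.keys c \<Longrightarrow> norm (F x) \<le> K"
  shows "norm (lin_sum F c) \<le> K * norm c"
proof -
  have "norm (lin_sum F c) \<le> (\<Sum>x\<in>Poly_Mapping.keys c. norm (Poly_Mapping.lookup c x *\<^sub>R F x))"
    unfolding lin_sum_def by (rule norm_sum)
  also have "\<dots> \<le> (\<Sum>x\<in>Poly_Mapping.keys c. \<bar>Poly_Mapping.lookup c x\<bar> * K)"
    by (rule sum_mono) (simp add: assms mult_left_mono)
  finally show ?thesis by (simp add: norm_fin_comb sum_distrib_left mult.commute)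
qed

lemma norm_single [simp]: "norm (Poly_Mapping.single x r) = \<bar>r\<bar>" for r :: real
  by (cases "r = 0") (simp_all add: norm_fin_comb)

lemma keys_sum_subset: "Poly_Mapping.keys (\<Sum>i\<in>I. c i) \<subseteq> (\<Union>i\<in>I. Poly_Mapping.keys (c i))"
  for c :: "'i \<Rightarrow> 'a fin_comb"
proof (induction I rule: infinite_finite_induct)
  case (insert i I)
  then show ?case using keys_add[of "c i" "sum c I"] by auto
qed auto

lemma keys_lin_sum: "Poly_Mapping.keys (lin_sum F c) \<subseteq> (\<Union>x\<in>Poly_Mapping.keys c. Poly_Mapping.keys (F x))"
  for F :: "'a \<Rightarrow> 'b fin_comb"
proof -
  have "Poly_Mapping.keys (r *\<^sub>R d) \<subseteq> Poly_Mapping.keys d" for r and d :: "'b fin_comb"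
    by (auto simp: in_keys_iff)
  then show ?thesis unfolding lin_sum_def by (intro order_trans[OF keys_sum_subset] UN_mono) auto
qed

section \<open>Homogeneous coordinates of simplices\<close>

definition star :: "('o, 'm) gpd \<Rightarrow> 'o \<Rightarrow> 'm set" where
  "star G e = {x \<in> arrs G. tgt G x = e}"

text \<open>Simplices in homogeneous coordinates: the simplex with vertices \<open>x\<^sub>0, \<dots>, x\<^sub>n\<close> (arrows with
  the same target) is \<open>(x\<^sub>0, x\<^sub>0\<inverse> x\<^sub>1, \<dots>)\<close>.\<close>

definition inhomog :: "('o, 'm) gpd \<Rightarrow> 'm list \<Rightarrow> 'm list" where
  "inhomog G xs = map (\<lambda>i. if i = 0 then xs ! 0 else cmp G (ginv G (xs ! (i - 1))) (xs ! i)) [0..<length xs]"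

text \<open>The products g_0 ... g_i, which recover the vertices of a simplex from its edges and all
  end at the target of g_0.\<close>

primrec partial_cmp :: "('o, 'm) gpd \<Rightarrow> 'm list \<Rightarrow> nat \<Rightarrow> 'm" where
  "partial_cmp G gs 0 = gs ! 0"
| "partial_cmp G gs (Suc i) = cmp G (partial_cmp G gs i) (gs ! Suc i)"

definition homog :: "('o, 'm) gpd \<Rightarrow> 'm list \<Rightarrow> 'm list" where
  "homog G gs = map (partial_cmp G gs) [0..<length gs]"

lemma length_inhomog [simp]: "length (inhomog G xs) = length xs"
  by (simp add: inhomog_def)

lemma nth_inhomog: "i < length xs \<Longrightarrow> inhomog G xs ! i = (if i = 0 then xs ! 0 else cmp G (ginv G (xs ! (i - 1))) (xs ! i))"
  by (simp add: inhomog_def)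

lemma length_homog [simp]: "length (homog G gs) = length gs"
  by (simp add: homog_def)

lemma nth_homog: "i < length gs \<Longrightarrow> homog G gs ! i = partial_cmp G gs i"
  by (simp add: homog_def)

lemma tuples_nth: "xs \<in> tuples X k \<Longrightarrow> i < k \<Longrightarrow> xs ! i \<in> X"
  by (auto simp: tuples_def)

lemma tuples_length: "xs \<in> tuples X k \<Longrightarrow> length xs = k"
  by (simp add: tuples_def)

lemma tuples_map: "xs \<in> tuples X k \<Longrightarrow> (\<And>x. x \<in> X \<Longrightarrow> p x \<in> Y) \<Longrightarrow> map p xs \<in> tuples Y k"
  by (auto simp: tuples_def)

lemma tuplesI: "length xs = k \<Longrightarrow> (\<And>i. i < k \<Longrightarrow> xs ! i \<in> X) \<Longrightarrow> xs \<in> tuples X k"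
  by (auto simp: tuples_def in_set_conv_nth)

definition translate :: "('o, 'm) gpd \<Rightarrow> 'm \<Rightarrow> 'm list \<Rightarrow> 'm list" where
  "translate G g gs = cmp G g (hd gs) # tl gs"

lemma chains_simps [simp]:
  "carrier (fib (chains G n) e) = {c. Poly_Mapping.keys c \<subseteq> simplices G n e}"
  "\<zero>\<^bsub>fib (chains G n) e\<^esub> = 0" "c \<oplus>\<^bsub>fib (chains G n) e\<^esub> d = c + d"
  "r \<odot>\<^bsub>fib (chains G n) e\<^esub> c = r *\<^sub>R c" "vnorm (fib (chains G n) e) c = norm c"
  "act (chains G n) g = lin_sum (\<lambda>gs. Poly_Mapping.single (translate G g gs) 1)"
  by (simp_all add: chains_def lin_ext_eq_lin_sum translate_def)

context groupoid begin

lemma starD: "x \<in> star G e \<Longrightarrow> x \<in> arrs G" "x \<in> star G e \<Longrightarrow> tgt G x = e"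
  by (simp_all add: star_def)

lemma simplicesD:
  assumes "gs \<in> simplices G n e"
  shows "length gs = Suc n" "i \<le> n \<Longrightarrow> gs ! i \<in> arrs G"
    "i < n \<Longrightarrow> src G (gs ! i) = tgt G (gs ! Suc i)" "tgt G (gs ! 0) = e"
  using assms by (auto simp: simplices_def)

lemma simplicesI:
  assumes "length gs = Suc n" "\<And>i. i \<le> n \<Longrightarrow> gs ! i \<in> arrs G"
    "\<And>i. i < n \<Longrightarrow> src G (gs ! i) = tgt G (gs ! Suc i)" "tgt G (gs ! 0) = e"
  shows "gs \<in> simplices G n e"
  using assms by (auto simp: simplices_def in_set_conv_nth less_Suc_eq_le)

lemma partial_cmp:
  assumes "gs \<in> simplices G n e"
  shows "i \<le> n \<Longrightarrow> partial_cmp G gs i \<in> arrs G \<and> tgt G (partial_cmp G gs i) = e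
    \<and> src G (partial_cmp G gs i) = src G (gs ! i)"
  by (induction i) (simp_all add: simplicesD[OF assms])

lemma homog_tuples:
  assumes "gs \<in> simplices G n e"
  shows "homog G gs \<in> tuples (star G e) (Suc n)"
  by (rule tuplesI) (use simplicesD(1)[OF assms] partial_cmp[OF assms] in \<open>auto simp: nth_homog star_def\<close>)

text \<open>The quotient of x_(i-1) and x_i starts at the source of x_i, and the next quotient ends
  there.\<close>

lemma inhomog_simplices:
  assumes "xs \<in> tuples (star G e) (Suc n)"
  shows "inhomog G xs \<in> simplices G n e"
proof (rule simplicesI)
  have x: "xs ! i \<in> arrs G" "tgt G (xs ! i) = e" if "i \<le> n" for i
    using tuples_nth[OF assms, of i] that starD by auto
  have len: "length xs = Suc n" using assms by (rule tuples_length)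
  show "length (inhomog G xs) = Suc n" using len by simp
  show "inhomog G xs ! i \<in> arrs G" if "i \<le> n" for i
    using that x[of i] x[of "i - 1"] by (cases i) (simp_all add: nth_inhomog len)
  show "src G (inhomog G xs ! i) = tgt G (inhomog G xs ! Suc i)" if "i < n" for i
    using that x[of i] x[of "i - 1"] x[of "Suc i"] by (cases i) (simp_all add: nth_inhomog len)
  show "tgt G (inhomog G xs ! 0) = e" using x[of 0] by (simp add: nth_inhomog len)
qed

lemma inhomog_homog:
  assumes "gs \<in> simplices G n e"
  shows "inhomog G (homog G gs) = gs"
proof (rule nth_equalityI)
  fix i assume "i < length (inhomog G (homog G gs))"
  then show "inhomog G (homog G gs) ! i = gs ! i"
    using partial_cmp[OF assms, of "i - 1"] simplicesD[OF assms]
    by (cases i) (auto simp: nth_inhomog nth_homog)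
qed simp

text \<open>The partial products of successive quotients telescope.\<close>

lemma homog_inhomog:
  assumes "xs \<in> tuples (star G e) (Suc n)"
  shows "homog G (inhomog G xs) = xs"
proof (rule nth_equalityI)
  have x: "xs ! i \<in> arrs G" "tgt G (xs ! i) = e" if "i \<le> n" for i
    using tuples_nth[OF assms, of i] that starD by auto
  have len: "length xs = Suc n" using assms by (rule tuples_length)
  have "i \<le> n \<Longrightarrow> partial_cmp G (inhomog G xs) i = xs ! i" for i
  proof (induction i)
    case (Suc i)
    then show ?case using x[of i] x[of "Suc i"] by (simp add: nth_inhomog len)
  qed (simp add: nth_inhomog len)
  then show "homog G (inhomog G xs) ! i = xs ! i" if "i < length (homog G (inhomog G xs))" for i
    using that len by (simp add: nth_homog)
qed simp

text \<open>A common left factor \<open>g\<close> cancels in every quotient of consecutive vertices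
  and survives only in the first entry. In homogeneous coordinates the action is therefore diagonal
  left multiplication.\<close>

lemma inhomog_translate:
  assumes "g \<in> arrs G" "xs \<in> tuples (star G (src G g)) (Suc n)"
  shows "inhomog G (map (cmp G g) xs) = translate G g (inhomog G xs)"
proof (rule nth_equalityI)
  have x: "xs ! i \<in> arrs G" "tgt G (xs ! i) = src G g" if "i \<le> n" for i
    using tuples_nth[OF assms(2), of i] that starD by auto
  have len: "length xs = Suc n" using assms(2) by (rule tuples_length)
  then have ne: "inhomog G xs \<noteq> []" using length_inhomog[of G xs] by (metis list.size(3) nat.distinct(1))
  show "length (inhomog G (map (cmp G g) xs)) = length (translate G g (inhomog G xs))"
    using len by (simp add: translate_def)
  fix i assume i: "i < length (inhomog G (map (cmp G g) xs))"
  show "inhomog G (map (cmp G g) xs) ! i = translate G g (inhomog G xs) ! i"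
  proof (cases i)
    case 0
    with ne len show ?thesis by (simp add: translate_def nth_inhomog hd_conv_nth)
  next
    case (Suc j)
    then show ?thesis
      using i len x[of j] x[of "Suc j"] assms(1)
      by (simp add: translate_def nth_inhomog nth_tl ginv_cmp cmp_assoc)
  qed
qed

lemma star_cmp: "g \<in> arrs G \<Longrightarrow> x \<in> star G (src G g) \<Longrightarrow> cmp G g x \<in> star G (tgt G g)"
  by (simp add: star_def)

lemma tuples_star_cmp:
  "g \<in> arrs G \<Longrightarrow> xs \<in> tuples (star G (src G g)) k \<Longrightarrow> map (cmp G g) xs \<in> tuples (star G (tgt G g)) k"
  by (erule tuples_map) (rule star_cmp)

lemma translate_simplices:
  assumes "g \<in> arrs G" "gs \<in> simplices G n (src G g)"
  shows "translate G g gs \<in> simplices G n (tgt G g)" "homog G (translate G g gs) = map (cmp G g) (homog G gs)"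
proof -
  have eq: "translate G g gs = inhomog G (map (cmp G g) (homog G gs))"
    using inhomog_translate[OF assms(1) homog_tuples[OF assms(2)]] inhomog_homog[OF assms(2)] by simp
  note t = tuples_star_cmp[OF assms(1) homog_tuples[OF assms(2)]]
  show "translate G g gs \<in> simplices G n (tgt G g)" unfolding eq by (rule inhomog_simplices[OF t])
  show "homog G (translate G g gs) = map (cmp G g) (homog G gs)" unfolding eq by (rule homog_inhomog[OF t])
qed

text \<open>Composing two adjacent quotients cancels the vertex x_i between them; for
  \<open>i = 0\<close> the product of x_0 with the first quotient is x_1. With
  \<open>inhomog_del_last\<close> for the remaining face, the boundary becomes the simplicial
  one.\<close>

lemma inhomog_del:
  assumes "xs \<in> tuples (star G e) (Suc (Suc n))" "i \<le> n"
  shows "inhomog G (del i xs) = inner_face G i (inhomog G xs)"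
proof (rule nth_equalityI)
  have x: "xs ! i \<in> arrs G" "tgt G (xs ! i) = e" if "i \<le> Suc n" for i
    using tuples_nth[OF assms(1), of i] that starD by auto
  have len: "length xs = Suc (Suc n)" using assms(1) by (rule tuples_length)
  show "length (inhomog G (del i xs)) = length (inner_face G i (inhomog G xs))"
    using assms(2) len by (simp add: inner_face_def)
  fix j assume "j < length (inhomog G (del i xs))"
  then have j: "j \<le> n" using assms(2) len by simp
  have face: "inner_face G i (inhomog G xs) ! j = (if j < i then inhomog G xs ! j
      else if j = i then cmp G (inhomog G xs ! i) (inhomog G xs ! Suc i) else inhomog G xs ! Suc j)"
    using assms(2) j len by (auto simp: inner_face_def nth_append nth_Cons' min_def)
  consider "j < i" | "j = i" "i = 0" | "j = i" "i > 0" | "j > i" by linarith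
  then show "inhomog G (del i xs) ! j = inner_face G i (inhomog G xs) ! j"
  proof cases
    case 3
    then obtain k where "i = Suc k" by (cases i) auto
    with 3 show ?thesis
      unfolding face using assms(2) j len x[of k] x[of i] x[of "Suc i"]
      by (simp add: nth_inhomog nth_del cmp_assoc)
  qed (unfold face, use assms(2) j len x[of j] x[of "Suc j"] x[of 0] x[of 1] in \<open>auto simp: nth_inhomog nth_del\<close>)
qed

lemma inhomog_del_last:
  assumes "xs \<in> tuples (star G e) (Suc n)"
  shows "inhomog G (del n xs) = butlast (inhomog G xs)"
  using tuples_length[OF assms] by (intro nth_equalityI) (auto simp: nth_inhomog nth_del nth_butlast)

lemma normed_gmodule_chains: "normed_gmodule G (chains G n)"
proof (rule normed_gmoduleI)
  show "normed_space (fib (chains G n) e)" for e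
  proof (rule normed_spaceI, rule real_moduleI, goal_cases)
    case (1 c d)
    then show ?case using keys_add[of c d] by auto
  next
    case (3 r c)
    then show ?case by (auto simp: in_keys_iff)
  qed (simp_all add: algebra_simps norm_triangle_ineq)
  fix g assume g: "g \<in> arrs G"
  show "linear_map (fib (chains G n) (src G g)) (fib (chains G n) (tgt G g)) (act (chains G n) g)"
    unfolding linear_map_def
  proof (intro conjI funcsetI)
    fix c assume "c \<in> carrier (fib (chains G n) (src G g))"
    then show "act (chains G n) g c \<in> carrier (fib (chains G n) (tgt G g))"
      using keys_lin_sum[of "\<lambda>gs. Poly_Mapping.single (translate G g gs) 1" c] translate_simplices(1)[OF g]
      by fastforce
  qed (simp_all add: lin_sum_add lin_sum_scaleR)
  show "vnorm (fib (chains G n) (tgt G g)) (act (chains G n) g c) \<le> vnorm (fib (chains G n) (src G g)) c" for c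
  proof -
    \<comment> \<open>Basis elements go to basis elements, hence the constant 1;
      \<open>normed_gmoduleI\<close> upgrades this to an isometry.\<close>
    have "norm (lin_sum (\<lambda>gs. Poly_Mapping.single (translate G g gs) (1::real)) c) \<le> 1 * norm c"
      by (rule norm_lin_sum) simp
    then show ?thesis by simp
  qed
next
  fix g h c assume gh: "g \<in> arrs G" "h \<in> arrs G" "src G g = tgt G h"
    and c: "c \<in> carrier (fib (chains G n) (src G h))"
  have "translate G g (translate G h gs) = translate G (cmp G g h) gs" if "gs \<in> simplices G n (src G h)" for gs
    using gh simplicesD(1,4)[OF that] simplicesD(2)[OF that, of 0]
    by (cases gs) (auto simp: translate_def cmp_assoc)
  then show "act (chains G n) g (act (chains G n) h c) = act (chains G n) (cmp G g h) c"
    using c by (auto simp: lin_sum_lin_sum intro!: lin_sum_cong)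
next
  fix e c assume e: "e \<in> objs G" and c: "c \<in> carrier (fib (chains G n) e)"
  have "translate G (idn G e) gs = gs" if "gs \<in> simplices G n e" for gs
    using e simplicesD(1,4)[OF that] simplicesD(2)[OF that, of 0]
    by (cases gs) (auto simp: translate_def)
  then have "act (chains G n) (idn G e) c = lin_sum (\<lambda>gs. Poly_Mapping.single gs 1) c"
    using c by (auto intro!: lin_sum_cong)
  then show "act (chains G n) (idn G e) c = c" by (simp add: lin_sum_unit)
qed

end

text \<open>A cochain with values in the dual of \<open>V\<close> is given by its values \<open>ker f e xs v\<close> on homogeneous
  simplices and vectors.\<close>

definition ker :: "('o, 'm) gpd \<Rightarrow> ('o \<Rightarrow> 'm list fin_comb \<Rightarrow> 'v \<Rightarrow> real) \<Rightarrow> 'o \<Rightarrow> 'm list \<Rightarrow> 'v \<Rightarrow> real" where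
  "ker G f e xs v = f e (Poly_Mapping.single (inhomog G xs) 1) v"

definition of_ker :: "('o, 'm) gpd \<Rightarrow> ('o, 'm, 'v) gmod \<Rightarrow> nat \<Rightarrow> ('o \<Rightarrow> 'm list \<Rightarrow> 'v \<Rightarrow> real)
    \<Rightarrow> 'o \<Rightarrow> 'm list fin_comb \<Rightarrow> 'v \<Rightarrow> real" where
  "of_ker G V n \<phi> = (\<lambda>e\<in>objs G. \<lambda>c\<in>carrier (fib (chains G n) e). \<lambda>v\<in>carrier (fib V e).
     lin_sum (\<lambda>gs. \<phi> e (homog G gs) v) c)"

text \<open>What makes a function of vertices and vectors the kernel of a bounded cochain: for each
  tuple a functional of norm at most \<open>K\<close>, and invariance under simultaneous left
  multiplication of the tuple and action on the vector.\<close>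

locale cochain_kernel = normed_gmodule G V for G :: "('o, 'm) gpd" and V :: "('o, 'm, 'v) gmod" +
  fixes n :: nat and K :: real and \<phi> :: "'o \<Rightarrow> 'm list \<Rightarrow> 'v \<Rightarrow> real"
  assumes K_nonneg: "0 \<le> K"
    and bound: "\<lbrakk>e \<in> objs G; xs \<in> tuples (star G e) (Suc n); v \<in> carrier (fib V e)\<rbrakk>
      \<Longrightarrow> \<bar>\<phi> e xs v\<bar> \<le> K * vnorm (fib V e) v"
    and add: "\<lbrakk>e \<in> objs G; xs \<in> tuples (star G e) (Suc n); v \<in> carrier (fib V e); w \<in> carrier (fib V e)\<rbrakk>
      \<Longrightarrow> \<phi> e xs (v \<oplus>\<^bsub>fib V e\<^esub> w) = \<phi> e xs v + \<phi> e xs w"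
    and smult: "\<lbrakk>e \<in> objs G; xs \<in> tuples (star G e) (Suc n); v \<in> carrier (fib V e)\<rbrakk>
      \<Longrightarrow> \<phi> e xs (r \<odot>\<^bsub>fib V e\<^esub> v) = r * \<phi> e xs v"
    and equivariant: "\<lbrakk>g \<in> arrs G; xs \<in> tuples (star G (src G g)) (Suc n); v \<in> carrier (fib V (src G g))\<rbrakk>
      \<Longrightarrow> \<phi> (tgt G g) (map (cmp G g) xs) (act V g v) = \<phi> (src G g) xs v"

text \<open>Operations on real functions of vertices that can be applied to a cochain with the
  vector \<open>v\<close> held fixed. Linearity of the operation keeps the result linear in
  \<open>v\<close>, \<open>op_natural\<close> makes it equivariant, and \<open>L\<close> bounds its
  effect on norms. \<open>op_cong\<close> is needed because identities between kernels hold only on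
  tuples in a star. The coboundary, the average and the homotopy are all of this kind.\<close>

locale natural_operation = groupoid G for G :: "('o, 'm) gpd" +
  fixes k l :: nat and L :: real and \<Phi> :: "('m list \<Rightarrow> real) \<Rightarrow> 'm list \<Rightarrow> real"
  assumes L_nonneg: "0 \<le> L"
    and op_bound: "e \<in> objs G \<Longrightarrow> bounded_by (star G e) k K f \<Longrightarrow> bounded_by (star G e) l (L * K) (\<Phi> f)"
    and op_add: "\<lbrakk>e \<in> objs G; bounded_by (star G e) k K f; bounded_by (star G e) k K' f'; xs \<in> tuples (star G e) l\<rbrakk>
      \<Longrightarrow> \<Phi> (\<lambda>ys. f ys + f' ys) xs = \<Phi> f xs + \<Phi> f' xs"
    and op_mult: "\<lbrakk>e \<in> objs G; bounded_by (star G e) k K f; xs \<in> tuples (star G e) l\<rbrakk>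
      \<Longrightarrow> \<Phi> (\<lambda>ys. r * f ys) xs = r * \<Phi> f xs"
    and op_cong: "\<lbrakk>e \<in> objs G; xs \<in> tuples (star G e) l; \<And>ys. ys \<in> tuples (star G e) k \<Longrightarrow> f ys = f' ys\<rbrakk>
      \<Longrightarrow> \<Phi> f xs = \<Phi> f' xs"
    and op_natural: "\<lbrakk>g \<in> arrs G; xs \<in> tuples (star G (src G g)) l\<rbrakk>
      \<Longrightarrow> \<Phi> f (map (cmp G g) xs) = \<Phi> (\<lambda>ys. f (map (cmp G g) ys)) xs"

lemma (in groupoid) natural_operation_cob: "natural_operation G (Suc k) (Suc (Suc k)) (Suc (Suc k)) cob"
  by unfold_locales
    (auto intro: cob_bounded_by cob_cong simp: cob_add cob_mult cob_map simp del: of_nat_Suc)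

definition lift :: "('o, 'm) gpd \<Rightarrow> ('o, 'm, 'v) gmod \<Rightarrow> nat \<Rightarrow> (('m list \<Rightarrow> real) \<Rightarrow> 'm list \<Rightarrow> real)
    \<Rightarrow> ('o \<Rightarrow> 'm list fin_comb \<Rightarrow> 'v \<Rightarrow> real) \<Rightarrow> 'o \<Rightarrow> 'm list fin_comb \<Rightarrow> 'v \<Rightarrow> real" where
  "lift G V n \<Phi> f = of_ker G V n (\<lambda>e xs v. \<Phi> (\<lambda>ys. ker G f e ys v) xs)"

section \<open>The complex of bounded cochains with dual coefficients\<close>

context normed_gmodule begin

abbreviation cochains where "cochains n \<equiv> cspace (bounded_cochains G (dual_gmod G V)) n"

lemma cochains_eq: "cochains n = invariants G (hom_gmod G (chains G n) (dual_gmod G V))"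
  by (simp add: bounded_cochains_def bounded_gmaps_def)

lemma normed_gmodule_dual: "normed_gmodule G (dual_gmod G V)"
  by (rule normed_gmodule_dual_gmod) (rule normed_gmodule_axioms)

lemma normed_gmodule_cochains: "normed_gmodule G (hom_gmod G (chains G n) (dual_gmod G V))"
  by (rule normed_gmodule_hom_gmod[OF normed_gmodule_chains normed_gmodule_dual])

lemma real_module_cochains: "real_module (cochains n)"
  unfolding cochains_eq by (rule normed_gmodule.real_module_invariants[OF normed_gmodule_cochains])

lemma dual_simps [simp]:
  "fib (dual_gmod G V) e = bounded_maps (fib V e) real_space"
  "act (dual_gmod G V) g f = (\<lambda>v\<in>carrier (fib V (tgt G g)). f (act V (ginv G g) v))"
  by (simp_all add: dual_gmod_def)

lemma dual_pair: "e \<in> objs G \<Longrightarrow> normed_space_pair (fib V e) real_space"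
  by (simp add: normed_space_pair_def fib_normed normed_space_real_space)

lemma cochain_pair: "e \<in> objs G \<Longrightarrow> normed_space_pair (fib (chains G n) e) (fib (dual_gmod G V) e)"
  using normed_gmodule.fib_normed[OF normed_gmodule_chains] normed_gmodule.fib_normed[OF normed_gmodule_dual]
  by (simp add: normed_space_pair_def)

lemma cochain_fib: "f \<in> carrier (cochains n) \<Longrightarrow> e \<in> objs G
    \<Longrightarrow> f e \<in> carrier (bounded_maps (fib (chains G n) e) (fib (dual_gmod G V) e))"
  unfolding cochains_eq
  using normed_gmodule.invariants_closed[OF normed_gmodule_cochains[of n], of f e] by simp

lemma cochain_value: "f \<in> carrier (cochains n) \<Longrightarrow> e \<in> objs G \<Longrightarrow> c \<in> carrier (fib (chains G n) e)
    \<Longrightarrow> f e c \<in> carrier (bounded_maps (fib V e) real_space)"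
  using normed_space_pair.bounded_maps_closed[OF cochain_pair[of e n] cochain_fib[of f n e]] by simp

lemma cochain_norm_nonneg: "f \<in> carrier (cochains n) \<Longrightarrow> 0 \<le> vnorm (cochains n) f"
  unfolding cochains_eq by (rule normed_gmodule.invariants_norm_nonneg[OF normed_gmodule_cochains])

text \<open>Three nested norms are unfolded: the supremum over objects, the operator norm on chains,
  and the norm of the resulting functional.\<close>

lemma cochain_bound:
  assumes f: "f \<in> carrier (cochains n)" and e: "e \<in> objs G"
    and c: "c \<in> carrier (fib (chains G n) e)" and v: "v \<in> carrier (fib V e)"
  shows "\<bar>f e c v\<bar> \<le> vnorm (cochains n) f * norm c * vnorm (fib V e) v"
proof -
  interpret p: normed_space_pair "fib V e" real_space by (rule dual_pair[OF e])
  interpret q: normed_space_pair "fib (chains G n) e" "fib (dual_gmod G V) e" by (rule cochain_pair[OF e])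
  have "op_norm (fib (chains G n) e) (fib (dual_gmod G V) e) (f e) \<le> vnorm (cochains n) f"
    using normed_gmodule.invariants_norm_upper[OF normed_gmodule_cochains[of n], of f e] f e
    unfolding cochains_eq by (simp del: dual_simps q.bounded_maps_simps(1-3))
  moreover have "vnorm (fib (dual_gmod G V) e) (f e c)
      \<le> op_norm (fib (chains G n) e) (fib (dual_gmod G V) e) (f e) * norm c"
    using q.bounded_maps_bound[OF cochain_fib[OF f e] c] by simp
  moreover have "vnorm (fib (dual_gmod G V) e) (f e c) = op_norm (fib V e) real_space (f e c)" by simp
  ultimately have "op_norm (fib V e) real_space (f e c) \<le> vnorm (cochains n) f * norm c"
    using mult_right_mono[OF _ norm_ge_zero[of c]] order_trans by fastforce
  then have "op_norm (fib V e) real_space (f e c) * vnorm (fib V e) v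
      \<le> vnorm (cochains n) f * norm c * vnorm (fib V e) v"
    using v by (intro mult_right_mono) auto
  moreover have "\<bar>f e c v\<bar> \<le> op_norm (fib V e) real_space (f e c) * vnorm (fib V e) v"
    using p.bounded_maps_bound[OF cochain_value[OF f e c] v] by simp
  ultimately show ?thesis by linarith
qed

lemma cochain_linear:
  assumes f: "f \<in> carrier (cochains n)" and e: "e \<in> objs G"
  shows "linear_map (fib (chains G n) e) (bounded_maps (fib V e) real_space) (f e)"
  using normed_space_pair.bounded_maps_mem[OF cochain_pair[OF e]] cochain_fib[OF f e]
  by (simp add: bounded_map_def)

lemma cochain_add:
  assumes f: "f \<in> carrier (cochains n)" and e: "e \<in> objs G" and v: "v \<in> carrier (fib V e)"
    and c: "c \<in> carrier (fib (chains G n) e)" "d \<in> carrier (fib (chains G n) e)"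
  shows "f e (c + d) v = f e c v + f e d v"
proof -
  interpret p: normed_space_pair "fib V e" real_space by (rule dual_pair[OF e])
  show ?thesis using linear_map_add[OF cochain_linear[OF f e] c] v by simp
qed

lemma cochain_scaleR:
  assumes f: "f \<in> carrier (cochains n)" and e: "e \<in> objs G" and v: "v \<in> carrier (fib V e)"
    and c: "c \<in> carrier (fib (chains G n) e)"
  shows "f e (r *\<^sub>R c) v = r * f e c v"
proof -
  interpret p: normed_space_pair "fib V e" real_space by (rule dual_pair[OF e])
  show ?thesis using linear_map_smult[OF cochain_linear[OF f e] c, of r] v by simp
qed

lemma cochain_lin_sum:
  assumes f: "f \<in> carrier (cochains n)" and e: "e \<in> objs G" and v: "v \<in> carrier (fib V e)"
    and c: "c \<in> carrier (fib (chains G n) e)"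
  shows "f e c v = lin_sum (\<lambda>gs. f e (Poly_Mapping.single gs 1) v) c"
proof -
  \<comment> \<open>The partial sums have to be known to lie in the carrier, since
    \<open>f e\<close> is linear only there; membership is carried through the induction.\<close>
  have "finite I \<Longrightarrow> I \<subseteq> simplices G n e \<Longrightarrow>
      (\<Sum>gs\<in>I. Poly_Mapping.lookup c gs *\<^sub>R Poly_Mapping.single gs (1::real)) \<in> carrier (fib (chains G n) e) \<and>
      f e (\<Sum>gs\<in>I. Poly_Mapping.lookup c gs *\<^sub>R Poly_Mapping.single gs 1) v
        = (\<Sum>gs\<in>I. Poly_Mapping.lookup c gs * f e (Poly_Mapping.single gs 1) v)" for I
  proof (induction I rule: finite_induct)
    case empty
    have "f e 0 v = 0" using cochain_scaleR[OF f e v, of 0 0] by simp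
    then show ?case by simp
  next
    case (insert gs I)
    have 1: "Poly_Mapping.single gs 1 \<in> carrier (fib (chains G n) e)" using insert by simp
    have 2: "Poly_Mapping.lookup c gs *\<^sub>R Poly_Mapping.single gs 1 \<in> carrier (fib (chains G n) e)"
      using insert by (auto simp: in_keys_iff lookup_single when_def split: if_splits)
    have 3: "(\<Sum>gs\<in>I. Poly_Mapping.lookup c gs *\<^sub>R Poly_Mapping.single gs (1::real)) \<in> carrier (fib (chains G n) e)"
      using insert by blast
    have "Poly_Mapping.lookup c gs *\<^sub>R Poly_Mapping.single gs 1
        + (\<Sum>gs\<in>I. Poly_Mapping.lookup c gs *\<^sub>R Poly_Mapping.single gs (1::real)) \<in> carrier (fib (chains G n) e)"
      using 2 3 keys_add by fastforce
    then show ?case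
      using insert cochain_add[OF f e v 2 3] cochain_scaleR[OF f e v 1, of "Poly_Mapping.lookup c gs"]
      by (simp del: chains_simps)
  qed
  from this[OF finite_keys, of c] c show ?thesis
    using lin_sum_unit[of c] by (simp add: lin_sum_def)
qed

lemma cochain_equivariant:
  assumes f: "f \<in> carrier (cochains n)" and g: "g \<in> arrs G"
    and c: "c \<in> carrier (fib (chains G n) (tgt G g))" and v: "v \<in> carrier (fib V (tgt G g))"
  shows "f (tgt G g) c v = f (src G g) (act (chains G n) (ginv G g) c) (act V (ginv G g) v)"
proof -
  have "f (tgt G g) c v = act (hom_gmod G (chains G n) (dual_gmod G V)) g (f (src G g)) c v"
    using normed_gmodule.invariants_act[OF normed_gmodule_cochains[of n], of f g] f g
    unfolding cochains_eq by simp
  also have "\<dots> = f (src G g) (act (chains G n) (ginv G g) c) (act V (ginv G g) v)"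
    using c v by simp
  finally show ?thesis .
qed

lemma single_chain: "xs \<in> tuples (star G e) (Suc n)
    \<Longrightarrow> Poly_Mapping.single (inhomog G xs) 1 \<in> carrier (fib (chains G n) e)"
  by (simp add: inhomog_simplices)

lemma cochain_kernel_ker:
  assumes f: "f \<in> carrier (cochains n)"
  shows "cochain_kernel G V n (vnorm (cochains n) f) (ker G f)"
proof unfold_locales
  show "0 \<le> vnorm (cochains n) f" by (rule cochain_norm_nonneg[OF f])
next
  fix e xs v assume e: "e \<in> objs G" and xs: "xs \<in> tuples (star G e) (Suc n)" and v: "v \<in> carrier (fib V e)"
  interpret p: normed_space_pair "fib V e" real_space by (rule dual_pair[OF e])
  show "\<bar>ker G f e xs v\<bar> \<le> vnorm (cochains n) f * vnorm (fib V e) v"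
    using cochain_bound[OF f e single_chain[OF xs] v] by (simp add: ker_def)
  have lin: "linear_map (fib V e) real_space (f e (Poly_Mapping.single (inhomog G xs) 1))"
    using cochain_value[OF f e single_chain[OF xs]] by (simp add: p.bounded_maps_mem bounded_map_def)
  show "ker G f e xs (r \<odot>\<^bsub>fib V e\<^esub> v) = r * ker G f e xs v" for r
    using linear_map_smult[OF lin v] by (simp add: ker_def)
  show "ker G f e xs (v \<oplus>\<^bsub>fib V e\<^esub> w) = ker G f e xs v + ker G f e xs w" if "w \<in> carrier (fib V e)" for w
    using linear_map_add[OF lin v that] by (simp add: ker_def)
next
  fix g xs v assume g: "g \<in> arrs G" and xs: "xs \<in> tuples (star G (src G g)) (Suc n)"
    and v: "v \<in> carrier (fib V (src G g))"
  have xs': "map (cmp G g) xs \<in> tuples (star G (tgt G g)) (Suc n)" using g xs by (rule tuples_star_cmp)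
  have "map (cmp G (ginv G g)) (map (cmp G g) xs) = xs"
    using xs g by (intro map_idI[of _ "\<lambda>x. cmp G (ginv G g) (cmp G g x)", unfolded map_map[symmetric, unfolded comp_def]])
      (auto simp: tuples_def star_def)
  then have tr: "translate G (ginv G g) (inhomog G (map (cmp G g) xs)) = inhomog G xs"
    using inhomog_translate[of "ginv G g" "map (cmp G g) xs" n] g xs' by simp
  show "ker G f (tgt G g) (map (cmp G g) xs) (act V g v) = ker G f (src G g) xs v"
    unfolding ker_def
    using cochain_equivariant[OF f g single_chain[OF xs'] act_closed[OF g refl v]]
    by (simp add: tr act_ginv_act[OF g v])
qed

text \<open>The estimate on simplices extends to all chains through \<open>norm_lin_sum\<close>
  without changing \<open>K\<close>. Norm estimates for cochains thereby reduce to estimates of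
  kernels.\<close>

lemma of_ker_closed:
  assumes "cochain_kernel G V n K \<phi>"
  shows "of_ker G V n \<phi> \<in> carrier (cochains n)" "vnorm (cochains n) (of_ker G V n \<phi>) \<le> K"
proof -
  interpret \<phi>: cochain_kernel G V n K \<phi> by fact
  let ?F = "of_ker G V n \<phi>"
  have F: "?F e c v = lin_sum (\<lambda>gs. \<phi> e (homog G gs) v) c"
    if "e \<in> objs G" "c \<in> carrier (fib (chains G n) e)" "v \<in> carrier (fib V e)" for e c v
    using that by (simp add: of_ker_def)
  have keys: "Poly_Mapping.keys c \<subseteq> simplices G n e" if "c \<in> carrier (fib (chains G n) e)" for c e
    using that by simp
  have value_bound: "\<bar>?F e c v\<bar> \<le> (K * norm c) * vnorm (fib V e) v"
    if "e \<in> objs G" "c \<in> carrier (fib (chains G n) e)" "v \<in> carrier (fib V e)" for e c v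
  proof -
    have "norm (lin_sum (\<lambda>gs. \<phi> e (homog G gs) v) c) \<le> (K * vnorm (fib V e) v) * norm c"
      using \<phi>.bound[OF that(1) homog_tuples that(3)] keys[OF that(2)] by (intro norm_lin_sum) auto
    then show ?thesis using F[OF that] by (simp add: mult_ac)
  qed
  have value_mem: "?F e c \<in> carrier (bounded_maps (fib V e) real_space)"
    if e: "e \<in> objs G" and c: "c \<in> carrier (fib (chains G n) e)" for e c
  proof -
    interpret p: normed_space_pair "fib V e" real_space by (rule dual_pair[OF e])
    have h: "homog G gs \<in> tuples (star G e) (Suc n)" if "gs \<in> Poly_Mapping.keys c" for gs
      using homog_tuples keys[OF c] that by blast
    have sm: "r \<odot>\<^bsub>fib V e\<^esub> v \<in> carrier (fib V e)" if "v \<in> carrier (fib V e)" for r v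
      using that by (intro p.V.smult_closed) auto
    show ?thesis
    proof (rule p.bounded_maps_memI[where K = "K * norm c"])
      show "?F e c \<in> extensional (carrier (fib V e))" using e c by (simp add: of_ker_def)
      show "?F e c (v \<oplus>\<^bsub>fib V e\<^esub> w) = ?F e c v \<oplus>\<^bsub>real_space\<^esub> ?F e c w"
        if vw: "v \<in> carrier (fib V e)" "w \<in> carrier (fib V e)" for v w
      proof -
        have "lin_sum (\<lambda>gs. \<phi> e (homog G gs) (v \<oplus>\<^bsub>fib V e\<^esub> w)) c
            = lin_sum (\<lambda>gs. \<phi> e (homog G gs) v + \<phi> e (homog G gs) w) c"
          by (rule lin_sum_cong) (rule \<phi>.add[OF e h vw])
        then show ?thesis using vw by (simp add: F[OF e c] lin_sum_fun_add)
      qed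
      show "?F e c (r \<odot>\<^bsub>fib V e\<^esub> v) = r \<odot>\<^bsub>real_space\<^esub> ?F e c v" if v: "v \<in> carrier (fib V e)" for v r
      proof -
        have "lin_sum (\<lambda>gs. \<phi> e (homog G gs) (r \<odot>\<^bsub>fib V e\<^esub> v)) c = lin_sum (\<lambda>gs. r * \<phi> e (homog G gs) v) c"
          by (rule lin_sum_cong) (rule \<phi>.smult[OF e h v])
        then show ?thesis using v by (simp add: F[OF e c] sm lin_sum_fun_mult)
      qed
    qed (use value_bound[OF e c] in auto)
  qed
  have norm_value: "vnorm (fib (dual_gmod G V) e) (?F e c) \<le> K * norm c"
    if e: "e \<in> objs G" and c: "c \<in> carrier (fib (chains G n) e)" for e c
  proof -
    interpret p: normed_space_pair "fib V e" real_space by (rule dual_pair[OF e])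
    have "op_norm (fib V e) real_space (?F e c) \<le> K * norm c"
      by (rule p.op_norm_least) (use value_bound[OF e c] \<phi>.K_nonneg in auto)
    then show ?thesis by simp
  qed
  have fib_mem: "?F e \<in> carrier (bounded_maps (fib (chains G n) e) (fib (dual_gmod G V) e))"
    if e: "e \<in> objs G" for e
  proof -
    interpret p: normed_space_pair "fib V e" real_space by (rule dual_pair[OF e])
    interpret q: normed_space_pair "fib (chains G n) e" "fib (dual_gmod G V) e" by (rule cochain_pair[OF e])
    have sm: "r *\<^sub>R c \<in> carrier (fib (chains G n) e)" if "c \<in> carrier (fib (chains G n) e)" for r c
      using that by (auto simp: in_keys_iff)
    have ad: "c + d \<in> carrier (fib (chains G n) e)"
      if "c \<in> carrier (fib (chains G n) e)" "d \<in> carrier (fib (chains G n) e)" for c d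
      using that keys_add[of c d] by auto
    show ?thesis
    proof (rule q.bounded_maps_memI[where K = K])
      show "?F e \<in> extensional (carrier (fib (chains G n) e))" using e by (simp add: of_ker_def)
      show "?F e c \<in> carrier (fib (dual_gmod G V) e)" if "c \<in> carrier (fib (chains G n) e)" for c
        using value_mem[OF e that] by simp
      show "?F e (c \<oplus>\<^bsub>fib (chains G n) e\<^esub> d) = ?F e c \<oplus>\<^bsub>fib (dual_gmod G V) e\<^esub> ?F e d"
        if cd: "c \<in> carrier (fib (chains G n) e)" "d \<in> carrier (fib (chains G n) e)" for c d
      proof -
        have "?F e (c + d) v = ?F e c v + ?F e d v" if v: "v \<in> carrier (fib V e)" for v
          unfolding F[OF e ad[OF cd] v] F[OF e cd(1) v] F[OF e cd(2) v] by (rule lin_sum_add)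
        moreover have "?F e (c + d) \<in> extensional (carrier (fib V e))"
          using value_mem[OF e ad[OF cd]] by (simp add: p.bounded_maps_mem)
        ultimately show ?thesis
          unfolding chains_simps dual_simps p.bounded_maps_simps
          by (intro extensionalityI[of _ "carrier (fib V e)"]) auto
      qed
      show "?F e (r \<odot>\<^bsub>fib (chains G n) e\<^esub> c) = r \<odot>\<^bsub>fib (dual_gmod G V) e\<^esub> ?F e c"
        if c: "c \<in> carrier (fib (chains G n) e)" for r c
      proof -
        have "?F e (r *\<^sub>R c) v = r * ?F e c v" if v: "v \<in> carrier (fib V e)" for v
          unfolding F[OF e sm[OF c] v] F[OF e c v] by (simp add: lin_sum_scaleR)
        moreover have "?F e (r *\<^sub>R c) \<in> extensional (carrier (fib V e))"
          using value_mem[OF e sm[OF c]] by (simp add: p.bounded_maps_mem)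
        ultimately show ?thesis
          unfolding chains_simps dual_simps p.bounded_maps_simps
          by (intro extensionalityI[of _ "carrier (fib V e)"]) auto
      qed
      show "vnorm (fib (dual_gmod G V) e) (?F e c) \<le> K * vnorm (fib (chains G n) e) c"
        if "c \<in> carrier (fib (chains G n) e)" for c
        using norm_value[OF e that] by simp
    qed
  qed
  have fib_norm: "op_norm (fib (chains G n) e) (fib (dual_gmod G V) e) (?F e) \<le> K" if e: "e \<in> objs G" for e
    by (rule normed_space_pair.op_norm_least[OF cochain_pair[OF e] \<phi>.K_nonneg])
      (use norm_value[OF e] in simp)
  have vnorm_fib: "vnorm (fib (hom_gmod G (chains G n) (dual_gmod G V)) e) (?F e) \<le> K" if e: "e \<in> objs G" for e
    using fib_norm[OF e] normed_space_pair.bounded_maps_simps(4)[OF cochain_pair[OF e]] by simp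
  show "?F \<in> carrier (cochains n)"
    unfolding cochains_eq
  proof (rule normed_gmodule.invariants_memI[OF normed_gmodule_cochains _ _ _ vnorm_fib])
    show "?F \<in> extensional (objs G)" by (simp add: of_ker_def)
    show "?F e \<in> carrier (fib (hom_gmod G (chains G n) (dual_gmod G V)) e)" if "e \<in> objs G" for e
      using fib_mem[OF that] by simp
    fix g assume g: "g \<in> arrs G"
    interpret C: normed_gmodule G "chains G n" by (rule normed_gmodule_chains)
    have "?F (src G g) (act (chains G n) (ginv G g) c) (act V (ginv G g) v) = ?F (tgt G g) c v"
      if c: "c \<in> carrier (fib (chains G n) (tgt G g))" and v: "v \<in> carrier (fib V (tgt G g))" for c v
    proof -
      have "?F (src G g) (act (chains G n) (ginv G g) c) (act V (ginv G g) v)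
          = lin_sum (\<lambda>gs. \<phi> (src G g) (homog G gs) (act V (ginv G g) v)) (act (chains G n) (ginv G g) c)"
        using g by (intro F C.act_ginv_closed[OF g c] act_ginv_closed[OF g v]) simp
      also have "\<dots> = lin_sum (\<lambda>gs. \<phi> (src G g) (homog G (translate G (ginv G g) gs)) (act V (ginv G g) v)) c"
        by (simp add: lin_sum_lin_sum)
      also have "\<dots> = lin_sum (\<lambda>gs. \<phi> (tgt G g) (homog G gs) v) c"
      proof (rule lin_sum_cong)
        fix gs assume "gs \<in> Poly_Mapping.keys c"
        then have gs: "gs \<in> simplices G n (src G (ginv G g))" using keys[OF c] g by auto
        \<comment> \<open>Translation multiplies every vertex by \<open>ginv G g\<close>, so the
          equivariance of the kernel at that arrow applies.\<close>
        show "\<phi> (src G g) (homog G (translate G (ginv G g) gs)) (act V (ginv G g) v) = \<phi> (tgt G g) (homog G gs) v"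
          using translate_simplices(2)[OF _ gs] \<phi>.equivariant[OF _ homog_tuples[OF gs], of v] g v by simp
      qed
      also have "\<dots> = ?F (tgt G g) c v" using g by (intro F[OF _ c v, symmetric]) simp
      finally show ?thesis .
    qed
    then show "act (hom_gmod G (chains G n) (dual_gmod G V)) g (?F (src G g)) = ?F (tgt G g)"
      using g unfolding hom_gmod_simps dual_simps
      by (intro ext) (simp add: of_ker_def restrict_def)
  qed
  show "vnorm (cochains n) ?F \<le> K"
    unfolding cochains_eq
    by (rule normed_gmodule.invariants_norm_least[OF normed_gmodule_cochains \<phi>.K_nonneg vnorm_fib])
qed

lemma ker_of_ker:
  "e \<in> objs G \<Longrightarrow> xs \<in> tuples (star G e) (Suc n) \<Longrightarrow> v \<in> carrier (fib V e)
    \<Longrightarrow> ker G (of_ker G V n \<phi>) e xs v = \<phi> e xs v"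
  using single_chain[of xs e n] by (simp add: ker_def of_ker_def homog_inhomog)

lemma cochain_eqI:
  assumes f: "f \<in> carrier (cochains n)" and f': "f' \<in> carrier (cochains n)"
    and eq: "\<And>e c v. e \<in> objs G \<Longrightarrow> c \<in> carrier (fib (chains G n) e) \<Longrightarrow> v \<in> carrier (fib V e) \<Longrightarrow> f e c v = f' e c v"
  shows "f = f'"
proof (rule normed_gmodule.invariants_eqI[OF normed_gmodule_cochains])
  show "f \<in> carrier (invariants G (hom_gmod G (chains G n) (dual_gmod G V)))"
    and "f' \<in> carrier (invariants G (hom_gmod G (chains G n) (dual_gmod G V)))"
    using f f' by (simp_all only: cochains_eq)
  fix e assume e: "e \<in> objs G"
  show "f e = f' e"
  proof (rule normed_space_pair.bounded_maps_eqI[OF cochain_pair[OF e] cochain_fib[OF f e] cochain_fib[OF f' e]])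
    fix c assume c: "c \<in> carrier (fib (chains G n) e)"
    show "f e c = f' e c"
      by (rule normed_space_pair.bounded_maps_eqI[OF dual_pair[OF e] cochain_value[OF f e c] cochain_value[OF f' e c]])
        (rule eq[OF e c])
  qed
qed

text \<open>Every simplex has homogeneous coordinates, and simplices span the chains. Identities
  between cochains thus become identities between real functions of vertices.\<close>

lemma cochain_eq_kerI:
  assumes f: "f \<in> carrier (cochains n)" and f': "f' \<in> carrier (cochains n)"
    and eq: "\<And>e xs v. e \<in> objs G \<Longrightarrow> xs \<in> tuples (star G e) (Suc n) \<Longrightarrow> v \<in> carrier (fib V e)
      \<Longrightarrow> ker G f e xs v = ker G f' e xs v"
  shows "f = f'"
proof (rule cochain_eqI[OF f f'])
  fix e c v assume e: "e \<in> objs G" and c: "c \<in> carrier (fib (chains G n) e)" and v: "v \<in> carrier (fib V e)"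
  show "f e c v = f' e c v"
    unfolding cochain_lin_sum[OF f e v c] cochain_lin_sum[OF f' e v c]
  proof (rule lin_sum_cong)
    fix gs assume "gs \<in> Poly_Mapping.keys c"
    then have gs: "gs \<in> simplices G n e" using c by auto
    show "f e (Poly_Mapping.single gs 1) v = f' e (Poly_Mapping.single gs 1) v"
      using eq[OF e homog_tuples[OF gs] v] by (simp add: ker_def inhomog_homog[OF gs])
  qed
qed

lemma ker_bounded_by:
  assumes "f \<in> carrier (cochains n)" "e \<in> objs G" "v \<in> carrier (fib V e)"
  shows "bounded_by (star G e) (Suc n) (vnorm (cochains n) f * vnorm (fib V e) v) (\<lambda>ys. ker G f e ys v)"
  using cochain_kernel.bound[OF cochain_kernel_ker[OF assms(1)] assms(2) _ assms(3)]
  by (simp add: bounded_by_def)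

lemma lift:
  assumes f: "f \<in> carrier (cochains n)" and \<Phi>: "natural_operation G (Suc n) (Suc l) L \<Phi>"
  shows lift_closed: "lift G V l \<Phi> f \<in> carrier (cochains l)"
    and lift_norm: "vnorm (cochains l) (lift G V l \<Phi> f) \<le> L * vnorm (cochains n) f"
proof -
  interpret \<Phi>: natural_operation G "Suc n" "Suc l" L \<Phi> by fact
  interpret k: cochain_kernel G V n "vnorm (cochains n) f" "ker G f" by (rule cochain_kernel_ker[OF f])
  note B = ker_bounded_by[OF f]
  have "cochain_kernel G V l (L * vnorm (cochains n) f) (\<lambda>e xs v. \<Phi> (\<lambda>ys. ker G f e ys v) xs)"
  proof unfold_locales
    show "0 \<le> L * vnorm (cochains n) f" using \<Phi>.L_nonneg k.K_nonneg by simp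
  next
    fix e xs v assume e: "e \<in> objs G" and xs: "xs \<in> tuples (star G e) (Suc l)" and v: "v \<in> carrier (fib V e)"
    show "\<bar>\<Phi> (\<lambda>ys. ker G f e ys v) xs\<bar> \<le> L * vnorm (cochains n) f * vnorm (fib V e) v"
      using \<Phi>.op_bound[OF e B[OF e v]] xs by (simp add: bounded_by_def mult.assoc)
    show "\<Phi> (\<lambda>ys. ker G f e ys (r \<odot>\<^bsub>fib V e\<^esub> v)) xs = r * \<Phi> (\<lambda>ys. ker G f e ys v) xs" for r
      unfolding \<Phi>.op_mult[OF e B[OF e v] xs, symmetric]
      by (rule \<Phi>.op_cong[OF e xs]) (rule k.smult[OF e _ v])
    fix w assume w: "w \<in> carrier (fib V e)"
    show "\<Phi> (\<lambda>ys. ker G f e ys (v \<oplus>\<^bsub>fib V e\<^esub> w)) xs = \<Phi> (\<lambda>ys. ker G f e ys v) xs + \<Phi> (\<lambda>ys. ker G f e ys w) xs"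
      unfolding \<Phi>.op_add[OF e B[OF e v] B[OF e w] xs, symmetric]
      by (rule \<Phi>.op_cong[OF e xs]) (rule k.add[OF e _ v w])
  next
    fix g xs v assume g: "g \<in> arrs G" and xs: "xs \<in> tuples (star G (src G g)) (Suc l)"
      and v: "v \<in> carrier (fib V (src G g))"
    show "\<Phi> (\<lambda>ys. ker G f (tgt G g) ys (act V g v)) (map (cmp G g) xs) = \<Phi> (\<lambda>ys. ker G f (src G g) ys v) xs"
      unfolding \<Phi>.op_natural[OF g xs]
      by (rule \<Phi>.op_cong[OF src_closed[OF g] xs]) (rule k.equivariant[OF g _ v])
  qed
  from of_ker_closed[OF this]
  show "lift G V l \<Phi> f \<in> carrier (cochains l)" "vnorm (cochains l) (lift G V l \<Phi> f) \<le> L * vnorm (cochains n) f"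
    by (simp_all add: lift_def)
qed

lemma ker_lift:
  "e \<in> objs G \<Longrightarrow> xs \<in> tuples (star G e) (Suc l) \<Longrightarrow> v \<in> carrier (fib V e)
    \<Longrightarrow> ker G (lift G V l \<Phi> f) e xs v = \<Phi> (\<lambda>ys. ker G f e ys v) xs"
  unfolding lift_def by (rule ker_of_ker)

text \<open>By \<open>inhomog_del\<close> and \<open>inhomog_del_last\<close> the signed faces match
  the terms of \<open>cob\<close> one by one.\<close>

lemma lin_sum_boundary:
  fixes u :: "'m list fin_comb \<Rightarrow> real"
  assumes gs: "gs \<in> simplices G (Suc n) e"
  shows "lin_sum (\<lambda>gs. u (Poly_Mapping.single gs 1)) (boundary G (Suc n) (Poly_Mapping.single gs 1))
      = cob (\<lambda>ys. u (Poly_Mapping.single (inhomog G ys) 1)) (homog G gs)"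
proof -
  note xs = homog_tuples[OF gs]
  have "inner_face G i gs = inhomog G (del i (homog G gs))" if "i \<le> n" for i
    using inhomog_del[OF xs that] inhomog_homog[OF gs] by simp
  moreover have "butlast gs = inhomog G (del (Suc n) (homog G gs))"
    using inhomog_del_last[OF xs] inhomog_homog[OF gs] by simp
  ultimately show ?thesis
    using simplicesD(1)[OF gs]
    by (simp add: boundary_def lin_ext_eq_lin_sum lin_sum_add lin_sum_sum cob_def)
qed

lemma boundary_closed:
  assumes c: "c \<in> carrier (fib (chains G (Suc n)) e)"
  shows "boundary G (Suc n) c \<in> carrier (fib (chains G n) e)"
proof -
  have "Poly_Mapping.keys ((\<Sum>i<Suc n. Poly_Mapping.single (inner_face G i gs) ((-1) ^ i))
      + Poly_Mapping.single (butlast gs) ((-1) ^ Suc n :: real)) \<subseteq> simplices G n e"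
    if "gs \<in> Poly_Mapping.keys c" for gs
  proof -
    have gs: "gs \<in> simplices G (Suc n) e" using that c by auto
    note xs = homog_tuples[OF gs]
    have "inner_face G i gs \<in> simplices G n e" if "i \<le> n" for i
      using inhomog_del[OF xs that] inhomog_homog[OF gs] inhomog_simplices[OF del_tuples[OF xs, of i]] that by simp
    moreover have "butlast gs \<in> simplices G n e"
      using inhomog_del_last[OF xs] inhomog_homog[OF gs] inhomog_simplices[OF del_tuples[OF xs, of "Suc n"]] by simp
    ultimately have "(\<Union>i\<in>{..<Suc n}. Poly_Mapping.keys (Poly_Mapping.single (inner_face G i gs) ((-1) ^ i :: real)))
        \<union> Poly_Mapping.keys (Poly_Mapping.single (butlast gs) ((-1) ^ Suc n :: real)) \<subseteq> simplices G n e"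
      by auto
    moreover note keys_sum_subset[of "\<lambda>i. Poly_Mapping.single (inner_face G i gs) ((-1) ^ i)" "{..<Suc n}"]
      keys_add[of "\<Sum>i<Suc n. Poly_Mapping.single (inner_face G i gs) ((-1) ^ i :: real)"
        "Poly_Mapping.single (butlast gs) ((-1) ^ Suc n)"]
    ultimately show ?thesis by (meson Un_mono order_refl order_trans)
  qed
  then show ?thesis
    using keys_lin_sum[of "\<lambda>gs. (\<Sum>i<Suc n. Poly_Mapping.single (inner_face G i gs) ((-1) ^ i))
      + Poly_Mapping.single (butlast gs) ((-1) ^ Suc n)" c]
    unfolding boundary_def lin_ext_eq_lin_sum by fastforce
qed

lemma cdiff_eq: "cdiff (bounded_cochains G (dual_gmod G V)) n f
    = (\<lambda>e\<in>objs G. \<lambda>c\<in>carrier (fib (chains G (Suc n)) e). f e (boundary G (Suc n) c))"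
  by (simp add: bounded_cochains_def)

text \<open>Once the coboundary is a lifted natural operation, its boundedness and equivariance
  follow from \<open>lift\<close>, and its algebra from that of \<open>cob\<close>.\<close>

lemma cdiff_eq_lift:
  assumes f: "f \<in> carrier (cochains n)"
  shows "cdiff (bounded_cochains G (dual_gmod G V)) n f = lift G V (Suc n) cob f"
proof -
  have "f e (boundary G (Suc n) c) = (\<lambda>v\<in>carrier (fib V e).
      lin_sum (\<lambda>gs. cob (\<lambda>ys. ker G f e ys v) (homog G gs)) c)"
    if e: "e \<in> objs G" and c: "c \<in> carrier (fib (chains G (Suc n)) e)" for e c
  proof (rule extensionalityI[of _ "carrier (fib V e)"])
    note bc = boundary_closed[OF c]
    show "f e (boundary G (Suc n) c) \<in> extensional (carrier (fib V e))"
      using cochain_value[OF f e bc] normed_space_pair.bounded_maps_mem[OF dual_pair[OF e]] by simp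
    fix v assume v: "v \<in> carrier (fib V e)"
    let ?u = "\<lambda>gs. f e (Poly_Mapping.single gs 1) v"
    have "f e (boundary G (Suc n) c) v = lin_sum ?u (boundary G (Suc n) c)"
      by (rule cochain_lin_sum[OF f e v bc])
    also have "\<dots> = lin_sum (\<lambda>gs. lin_sum ?u (boundary G (Suc n) (Poly_Mapping.single gs 1))) c"
      by (simp add: boundary_def lin_ext_eq_lin_sum lin_sum_lin_sum)
    also have "\<dots> = lin_sum (\<lambda>gs. cob (\<lambda>ys. ker G f e ys v) (homog G gs)) c"
      unfolding ker_def using c by (intro lin_sum_cong lin_sum_boundary[of _ n e "\<lambda>c. f e c v"]) auto
    finally show "f e (boundary G (Suc n) c) v
        = (\<lambda>v\<in>carrier (fib V e). lin_sum (\<lambda>gs. cob (\<lambda>ys. ker G f e ys v) (homog G gs)) c) v"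
      using v by simp
  qed simp
  then show ?thesis unfolding cdiff_eq lift_def of_ker_def by (intro restrict_ext) simp
qed

lemma cdiff_closed: "f \<in> carrier (cochains n) \<Longrightarrow> cdiff (bounded_cochains G (dual_gmod G V)) n f \<in> carrier (cochains (Suc n))"
  unfolding cdiff_eq_lift by (rule lift_closed[OF _ natural_operation_cob])

lemma ker_cdiff:
  "f \<in> carrier (cochains n) \<Longrightarrow> e \<in> objs G \<Longrightarrow> xs \<in> tuples (star G e) (Suc (Suc n)) \<Longrightarrow> v \<in> carrier (fib V e)
    \<Longrightarrow> ker G (cdiff (bounded_cochains G (dual_gmod G V)) n f) e xs v = cob (\<lambda>ys. ker G f e ys v) xs"
  unfolding cdiff_eq_lift by (rule ker_lift)

lemma ker_add:
  assumes "f \<in> carrier (cochains n)" "f' \<in> carrier (cochains n)" "e \<in> objs G"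
    "xs \<in> tuples (star G e) (Suc n)" "v \<in> carrier (fib V e)"
  shows "ker G (f \<oplus>\<^bsub>cochains n\<^esub> f') e xs v = ker G f e xs v + ker G f' e xs v"
proof -
  interpret C: normed_gmodule G "hom_gmod G (chains G n) (dual_gmod G V)" by (rule normed_gmodule_cochains)
  interpret p: normed_space_pair "fib V e" real_space by (rule dual_pair[OF assms(3)])
  interpret q: normed_space_pair "fib (chains G n) e" "fib (dual_gmod G V) e" by (rule cochain_pair[OF assms(3)])
  have "(f \<oplus>\<^bsub>cochains n\<^esub> f') e = f e \<oplus>\<^bsub>bounded_maps (fib (chains G n) e) (fib (dual_gmod G V) e)\<^esub> f' e"
    using assms(3) by (simp only: cochains_eq C.invariants_simps restrict_apply if_True hom_gmod_simps)
  then show ?thesis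
    using single_chain[OF assms(4)] assms(5) unfolding ker_def q.bounded_maps_simps by simp
qed

lemma ker_smult:
  assumes "f \<in> carrier (cochains n)" "e \<in> objs G"
    "xs \<in> tuples (star G e) (Suc n)" "v \<in> carrier (fib V e)"
  shows "ker G (r \<odot>\<^bsub>cochains n\<^esub> f) e xs v = r * ker G f e xs v"
proof -
  interpret C: normed_gmodule G "hom_gmod G (chains G n) (dual_gmod G V)" by (rule normed_gmodule_cochains)
  interpret p: normed_space_pair "fib V e" real_space by (rule dual_pair[OF assms(2)])
  interpret q: normed_space_pair "fib (chains G n) e" "fib (dual_gmod G V) e" by (rule cochain_pair[OF assms(2)])
  have "(r \<odot>\<^bsub>cochains n\<^esub> f) e = r \<odot>\<^bsub>bounded_maps (fib (chains G n) e) (fib (dual_gmod G V) e)\<^esub> f e"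
    using assms(2) by (simp only: cochains_eq C.invariants_simps restrict_apply if_True hom_gmod_simps)
  then show ?thesis
    using single_chain[OF assms(3)] assms(4) unfolding ker_def q.bounded_maps_simps by simp
qed

lemma ker_zero:
  assumes "e \<in> objs G" "xs \<in> tuples (star G e) (Suc n)" "v \<in> carrier (fib V e)"
  shows "ker G \<zero>\<^bsub>cochains n\<^esub> e xs v = 0"
proof -
  interpret C: Module.module real_ring "cochains n" by (rule real_module_cochains)
  have "\<zero>\<^bsub>cochains n\<^esub> = 0 \<odot>\<^bsub>cochains n\<^esub> \<zero>\<^bsub>cochains n\<^esub>" using C.smult_l_null by simp
  then show ?thesis using ker_smult[OF C.zero_closed assms, of 0] by simp
qed

lemma cdiff_linear_map:
  "linear_map (cochains n) (cochains (Suc n)) (cdiff (bounded_cochains G (dual_gmod G V)) n)"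
proof -
  interpret C: Module.module real_ring "cochains n" by (rule real_module_cochains)
  interpret D: Module.module real_ring "cochains (Suc n)" by (rule real_module_cochains)
  have sc: "r \<odot>\<^bsub>cochains n\<^esub> f \<in> carrier (cochains n)" if "f \<in> carrier (cochains n)" for r f
    using that by (intro C.smult_closed) auto
  have sd: "r \<odot>\<^bsub>cochains (Suc n)\<^esub> f \<in> carrier (cochains (Suc n))" if "f \<in> carrier (cochains (Suc n))" for r f
    using that by (intro D.smult_closed) auto
  show ?thesis
    unfolding linear_map_def
  proof (intro conjI funcsetI ballI allI)
    fix f assume f: "f \<in> carrier (cochains n)"
    show "cdiff (bounded_cochains G (dual_gmod G V)) n f \<in> carrier (cochains (Suc n))" by (rule cdiff_closed[OF f])
    show "cdiff (bounded_cochains G (dual_gmod G V)) n (r \<odot>\<^bsub>cochains n\<^esub> f)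
        = r \<odot>\<^bsub>cochains (Suc n)\<^esub> cdiff (bounded_cochains G (dual_gmod G V)) n f" for r
    proof (rule cochain_eq_kerI[OF cdiff_closed[OF sc[OF f]] sd[OF cdiff_closed[OF f]]])
      fix e xs v assume e: "e \<in> objs G" and xs: "xs \<in> tuples (star G e) (Suc (Suc n))" and v: "v \<in> carrier (fib V e)"
      show "ker G (cdiff (bounded_cochains G (dual_gmod G V)) n (r \<odot>\<^bsub>cochains n\<^esub> f)) e xs v
          = ker G (r \<odot>\<^bsub>cochains (Suc n)\<^esub> cdiff (bounded_cochains G (dual_gmod G V)) n f) e xs v"
        unfolding ker_cdiff[OF sc[OF f] e xs v] ker_smult[OF cdiff_closed[OF f] e xs v] ker_cdiff[OF f e xs v]
          cob_mult[symmetric]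
        by (rule cob_cong[OF xs]) (rule ker_smult[OF f e _ v])
    qed
    fix f' assume f': "f' \<in> carrier (cochains n)"
    note ff' = C.a_closed[OF f f'] and dd' = D.a_closed[OF cdiff_closed[OF f] cdiff_closed[OF f']]
    show "cdiff (bounded_cochains G (dual_gmod G V)) n (f \<oplus>\<^bsub>cochains n\<^esub> f')
        = cdiff (bounded_cochains G (dual_gmod G V)) n f \<oplus>\<^bsub>cochains (Suc n)\<^esub> cdiff (bounded_cochains G (dual_gmod G V)) n f'"
    proof (rule cochain_eq_kerI[OF cdiff_closed[OF ff'] dd'])
      fix e xs v assume e: "e \<in> objs G" and xs: "xs \<in> tuples (star G e) (Suc (Suc n))" and v: "v \<in> carrier (fib V e)"
      show "ker G (cdiff (bounded_cochains G (dual_gmod G V)) n (f \<oplus>\<^bsub>cochains n\<^esub> f')) e xs v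
          = ker G (cdiff (bounded_cochains G (dual_gmod G V)) n f \<oplus>\<^bsub>cochains (Suc n)\<^esub> cdiff (bounded_cochains G (dual_gmod G V)) n f') e xs v"
        unfolding ker_cdiff[OF ff' e xs v] ker_add[OF cdiff_closed[OF f] cdiff_closed[OF f'] e xs v]
          ker_cdiff[OF f e xs v] ker_cdiff[OF f' e xs v] cob_add[symmetric]
        by (rule cob_cong[OF xs]) (rule ker_add[OF f f' e _ v])
    qed
  qed
qed

lemma cdiff_cdiff:
  assumes f: "f \<in> carrier (cochains n)"
  shows "cdiff (bounded_cochains G (dual_gmod G V)) (Suc n) (cdiff (bounded_cochains G (dual_gmod G V)) n f)
    = \<zero>\<^bsub>cochains (Suc (Suc n))\<^esub>"
proof -
  interpret C: Module.module real_ring "cochains (Suc (Suc n))" by (rule real_module_cochains)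
  note df = cdiff_closed[OF f]
  show ?thesis
  proof (rule cochain_eq_kerI[OF cdiff_closed[OF df] C.zero_closed])
    fix e xs v assume e: "e \<in> objs G" and xs: "xs \<in> tuples (star G e) (Suc (Suc (Suc n)))" and v: "v \<in> carrier (fib V e)"
    have "cob (\<lambda>ys. ker G (cdiff (bounded_cochains G (dual_gmod G V)) n f) e ys v) xs
        = cob (cob (\<lambda>ys. ker G f e ys v)) xs"
      by (rule cob_cong[OF xs]) (rule ker_cdiff[OF f e _ v])
    then show "ker G (cdiff (bounded_cochains G (dual_gmod G V)) (Suc n)
        (cdiff (bounded_cochains G (dual_gmod G V)) n f)) e xs v = ker G \<zero>\<^bsub>cochains (Suc (Suc n))\<^esub> e xs v"
      by (simp add: ker_cdiff[OF df e xs v] cob_cob ker_zero[OF e xs v])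
  qed
qed

end

section \<open>Averaging over an amenable subgroupoid\<close>

lemma is_mean_dirac: "x \<in> X \<Longrightarrow> is_mean X (\<lambda>\<phi>. \<phi> x)"
  by unfold_locales auto

lemma is_mean_push_forward:
  assumes N: "is_mean Y N" and p: "\<And>y. y \<in> Y \<Longrightarrow> p y \<in> X"
  shows "is_mean X (\<lambda>\<phi>. N (\<lambda>y. \<phi> (p y)))"
proof unfold_locales
  interpret is_mean Y N by fact
  fix \<phi> \<psi> :: "'b \<Rightarrow> real" and K L r
  show "(\<And>x. x \<in> X \<Longrightarrow> \<bar>\<phi> x\<bar> \<le> K) \<Longrightarrow> (\<And>x. x \<in> X \<Longrightarrow> \<bar>\<psi> x\<bar> \<le> L)
      \<Longrightarrow> N (\<lambda>y. \<phi> (p y) + \<psi> (p y)) = N (\<lambda>y. \<phi> (p y)) + N (\<lambda>y. \<psi> (p y))"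
    by (rule add[of _ K _ L]) (simp_all add: p)
  show "(\<And>x. x \<in> X \<Longrightarrow> \<bar>\<phi> x\<bar> \<le> K) \<Longrightarrow> N (\<lambda>y. r * \<phi> (p y)) = r * N (\<lambda>y. \<phi> (p y))"
    by (rule mult[of _ K]) (simp add: p)
  show "(\<And>x. x \<in> X \<Longrightarrow> \<bar>\<phi> x\<bar> \<le> K) \<Longrightarrow> \<bar>N (\<lambda>y. \<phi> (p y))\<bar> \<le> K"
    by (rule bound) (simp add: p)
  show "(\<And>x. x \<in> X \<Longrightarrow> \<phi> x = \<psi> x) \<Longrightarrow> N (\<lambda>y. \<phi> (p y)) = N (\<lambda>y. \<psi> (p y))"
    by (rule cong) (simp add: p)
  show "N (\<lambda>y. r) = r" by (rule const)
qed

lemma linf_gmod_simps: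
  "carrier (fib (linf_gmod A) e) = {\<phi> \<in> extensional (star A e). bdd_above ((\<lambda>h. \<bar>\<phi> h\<bar>) ` star A e)}"
  "\<phi> \<oplus>\<^bsub>fib (linf_gmod A) e\<^esub> \<psi> = (\<lambda>h\<in>star A e. \<phi> h + \<psi> h)"
  "r \<odot>\<^bsub>fib (linf_gmod A) e\<^esub> \<phi> = (\<lambda>h\<in>star A e. r * \<phi> h)"
  "vnorm (fib (linf_gmod A) e) \<phi> = (SUP h\<in>star A e. \<bar>\<phi> h\<bar>)"
  "act (linf_gmod A) g \<phi> = (\<lambda>h\<in>star A (tgt A g). \<phi> (cmp A (ginv A g) h))"
  by (simp_all add: linf_gmod_def Let_def star_def)

locale amenable_pair = groupoid_pair A G io ia + V: normed_gmodule G V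
  for A :: "('p, 'q) gpd" and G :: "('o, 'm) gpd" and io :: "'p \<Rightarrow> 'o" and ia :: "'q \<Rightarrow> 'm"
    and V :: "('o, 'm, 'v) gmod" +
  fixes m :: "'p \<Rightarrow> ('q \<Rightarrow> real) \<Rightarrow> real"
  assumes m_gmap: "is_gmap A (linf_gmod A) trivial_gmod m"
    and m_norm: "gmap_norm A (linf_gmod A) trivial_gmod m = 1"
    and m_const: "p \<in> objs A \<Longrightarrow> m p (\<lambda>h\<in>star A p. r) = r"
begin

text \<open>The guard makes the values on unbounded functions, on which \<open>m\<close> is arbitrary, invariant
  as well.\<close>

definition M :: "'p \<Rightarrow> ('q \<Rightarrow> real) \<Rightarrow> real" where
  "M p \<psi> = (if bdd_above ((\<lambda>h. \<bar>\<psi> h\<bar>) ` star A p) then m p (restrict \<psi> (star A p)) else 0)"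

text \<open>Stars are nonempty, so the suprema that define the norm of bounded functions on them are
  taken over nonempty sets.\<close>

lemma idn_star: "p \<in> objs A \<Longrightarrow> idn A p \<in> star A p"
  by (simp add: star_def)

lemma m_linear: "p \<in> objs A \<Longrightarrow> linear_map (fib (linf_gmod A) p) real_space (m p)"
  using m_gmap by (simp add: is_gmap_def bounded_map_def)

lemma restrict_linf:
  "bdd_above ((\<lambda>h. \<bar>\<psi> h\<bar>) ` star A p) \<Longrightarrow> restrict \<psi> (star A p) \<in> carrier (fib (linf_gmod A) p)"
  by (simp add: linf_gmod_simps)

lemma M_eq:
  assumes "\<And>h. h \<in> star A p \<Longrightarrow> \<bar>\<psi> h\<bar> \<le> K"
  shows "M p \<psi> = m p (restrict \<psi> (star A p))" "restrict \<psi> (star A p) \<in> carrier (fib (linf_gmod A) p)"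
proof -
  have "bdd_above ((\<lambda>h. \<bar>\<psi> h\<bar>) ` star A p)" using assms by (intro bdd_aboveI2) auto
  then show "M p \<psi> = m p (restrict \<psi> (star A p))" "restrict \<psi> (star A p) \<in> carrier (fib (linf_gmod A) p)"
    by (simp_all add: M_def restrict_linf)
qed

lemma linf_norm_le:
  "p \<in> objs A \<Longrightarrow> (\<And>h. h \<in> star A p \<Longrightarrow> \<bar>\<psi> h\<bar> \<le> K) \<Longrightarrow> vnorm (fib (linf_gmod A) p) (restrict \<psi> (star A p)) \<le> K"
  unfolding linf_gmod_simps using idn_star by (intro cSUP_least) auto

lemma linf_norm_nonneg:
  assumes "p \<in> objs A" "\<psi> \<in> carrier (fib (linf_gmod A) p)"
  shows "0 \<le> vnorm (fib (linf_gmod A) p) \<psi>"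
  using assms idn_star[OF assms(1)] unfolding linf_gmod_simps
  by (intro cSUP_upper2[of _ _ "idn A p"]) auto

text \<open>On the unit ball \<open>m p\<close> is bounded by its operator norm, and
  \<open>gmap_norm\<close> bounds all these operator norms by 1. Both suprema are finite because
  \<open>m\<close> is a bounded family.\<close>

lemma m_contraction:
  assumes p: "p \<in> objs A" and \<psi>: "\<psi> \<in> carrier (fib (linf_gmod A) p)" "vnorm (fib (linf_gmod A) p) \<psi> \<le> 1"
  shows "\<bar>m p \<psi>\<bar> \<le> 1"
proof -
  have bm: "bounded_map (fib (linf_gmod A) p) real_space (m p)"
    using m_gmap p by (simp add: is_gmap_def)
  then obtain K where K: "\<And>x. x \<in> carrier (fib (linf_gmod A) p) \<Longrightarrow> \<bar>m p x\<bar> \<le> K * vnorm (fib (linf_gmod A) p) x"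
    by (auto simp: bounded_map_def)
  have "bdd_above ((\<lambda>x. vnorm real_space (m p x)) ` {x \<in> carrier (fib (linf_gmod A) p). vnorm (fib (linf_gmod A) p) x \<le> 1})"
  proof (rule bdd_aboveI2)
    fix x assume x: "x \<in> {x \<in> carrier (fib (linf_gmod A) p). vnorm (fib (linf_gmod A) p) x \<le> 1}"
    then have "\<bar>m p x\<bar> \<le> K * vnorm (fib (linf_gmod A) p) x" using K by blast
    also have "\<dots> \<le> \<bar>K\<bar> * 1" using x linf_norm_nonneg[OF p, of x] by (intro mult_mono) auto
    finally show "vnorm real_space (m p x) \<le> \<bar>K\<bar>" by simp
  qed
  then have "vnorm real_space (m p \<psi>) \<le> op_norm (fib (linf_gmod A) p) real_space (m p)"
    unfolding op_norm_def using \<psi> by (intro cSUP_upper) auto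
  also have "\<dots> \<le> gmap_norm A (linf_gmod A) trivial_gmod m"
    unfolding gmap_norm_def using m_gmap p by (intro le_sup0) (auto simp: is_gmap_def)
  finally show ?thesis using m_norm by simp
qed

lemma is_mean_M:
  assumes p: "p \<in> objs A"
  shows "is_mean (star A p) (M p)"
proof unfold_locales
  fix \<phi> \<psi> :: "'q \<Rightarrow> real" and K L r
  show "M p \<phi> = M p \<psi>" if eq: "\<And>x. x \<in> star A p \<Longrightarrow> \<phi> x = \<psi> x"
  proof -
    have "(\<lambda>h. \<bar>\<phi> h\<bar>) ` star A p = (\<lambda>h. \<bar>\<psi> h\<bar>) ` star A p" using eq by (intro image_cong) auto
    moreover have "restrict \<phi> (star A p) = restrict \<psi> (star A p)" using eq by (rule restrict_ext)
    ultimately show ?thesis by (simp add: M_def)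
  qed
  show "M p (\<lambda>x. r) = r"
    using M_eq(1)[of p "\<lambda>x. r" "\<bar>r\<bar>"] m_const[OF p] by simp
  assume \<phi>: "\<And>x. x \<in> star A p \<Longrightarrow> \<bar>\<phi> x\<bar> \<le> K"
  show scale: "M p (\<lambda>x. r * \<phi> x) = r * M p \<phi>"
  proof -
    have "M p (\<lambda>x. r * \<phi> x) = m p (\<lambda>h\<in>star A p. r * \<phi> h)"
      using \<phi> by (intro M_eq(1)[of _ _ "\<bar>r\<bar> * K"]) (simp add: abs_mult mult_left_mono)
    also have "(\<lambda>h\<in>star A p. r * \<phi> h) = r \<odot>\<^bsub>fib (linf_gmod A) p\<^esub> restrict \<phi> (star A p)"
      by (auto simp: linf_gmod_simps)
    also have "m p \<dots> = r * M p \<phi>"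
      using linear_map_smult[OF m_linear[OF p] M_eq(2)[OF \<phi>]] M_eq(1)[OF \<phi>] by simp
    finally show ?thesis .
  qed
  show "\<bar>M p \<phi>\<bar> \<le> K"
  \<comment> \<open>For positive \<open>K\<close> the function is rescaled into the unit ball, where
    \<open>m_contraction\<close> applies. For \<open>K = 0\<close> there is nothing to divide by,
    but the function vanishes on the star.\<close>
  proof (cases "K = 0")
    case True
    have "restrict \<phi> (star A p) = 0 \<odot>\<^bsub>fib (linf_gmod A) p\<^esub> restrict \<phi> (star A p)"
      unfolding linf_gmod_simps using \<phi> True by (intro restrict_ext) auto
    then have "m p (restrict \<phi> (star A p)) = m p (0 \<odot>\<^bsub>fib (linf_gmod A) p\<^esub> restrict \<phi> (star A p))"
      by (rule arg_cong)
    then show ?thesis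
      using linear_map_smult[OF m_linear[OF p] M_eq(2)[OF \<phi>], where r = 0] True M_eq(1)[OF \<phi>] by simp
  next
    case False
    have "0 \<le> K" using \<phi>[OF idn_star[OF p]] by (rule order_trans[OF abs_ge_zero])
    with False have K: "K > 0" by simp
    let ?\<psi> = "\<lambda>h\<in>star A p. inverse K * \<phi> h"
    have b: "\<bar>inverse K * \<phi> h\<bar> \<le> 1" if "h \<in> star A p" for h
      using \<phi>[OF that] K by (simp add: abs_mult field_simps)
    have "?\<psi> = inverse K \<odot>\<^bsub>fib (linf_gmod A) p\<^esub> restrict \<phi> (star A p)"
      by (auto simp: linf_gmod_simps)
    then have "m p ?\<psi> = inverse K * M p \<phi>"
      using linear_map_smult[OF m_linear[OF p] M_eq(2)[OF \<phi>], where r = "inverse K"] M_eq(1)[OF \<phi>] by simp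
    moreover have "\<bar>m p ?\<psi>\<bar> \<le> 1"
      by (rule m_contraction[OF p M_eq(2)[OF b] linf_norm_le[OF p b]])
    ultimately have "\<bar>M p \<phi>\<bar> / K \<le> 1" using K by (simp add: abs_mult divide_inverse mult.commute)
    then show ?thesis using K by simp
  qed
  assume \<psi>: "\<And>x. x \<in> star A p \<Longrightarrow> \<bar>\<psi> x\<bar> \<le> L"
  show "M p (\<lambda>x. \<phi> x + \<psi> x) = M p \<phi> + M p \<psi>"
  proof -
    have "\<bar>\<phi> h + \<psi> h\<bar> \<le> K + L" if "h \<in> star A p" for h
      using \<phi>[OF that] \<psi>[OF that] by linarith
    then have "M p (\<lambda>x. \<phi> x + \<psi> x) = m p (\<lambda>h\<in>star A p. \<phi> h + \<psi> h)" by (rule M_eq(1))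
    also have "(\<lambda>h\<in>star A p. \<phi> h + \<psi> h)
        = restrict \<phi> (star A p) \<oplus>\<^bsub>fib (linf_gmod A) p\<^esub> restrict \<psi> (star A p)"
      by (auto simp: linf_gmod_simps)
    also have "m p \<dots> = M p \<phi> + M p \<psi>"
      using linear_map_add[OF m_linear[OF p] M_eq(2)[OF \<phi>] M_eq(2)[OF \<psi>]] M_eq(1)[OF \<phi>] M_eq(1)[OF \<psi>] by simp
    finally show ?thesis .
  qed
qed

lemma star_cmp_image: "b \<in> arrs A \<Longrightarrow> cmp A b ` star A (src A b) = star A (tgt A b)"
proof (intro equalityI subsetI)
  fix h assume b: "b \<in> arrs A" and h: "h \<in> star A (tgt A b)"
  then have "cmp A (ginv A b) h \<in> star A (src A b)" "h = cmp A b (cmp A (ginv A b) h)"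
    by (simp_all add: star_def)
  then show "h \<in> cmp A b ` star A (src A b)" by blast
qed (auto simp: star_def)

text \<open>Left multiplication by \<open>b\<close> maps one star onto the other, so the boundedness
  guards agree. In the bounded case, translating the pulled-back function by \<open>b\<close> gives
  back the original one, and \<open>m\<close> is equivariant.\<close>

lemma M_invariant:
  assumes b: "b \<in> arrs A"
  shows "M (src A b) (\<lambda>a. \<psi> (cmp A b a)) = M (tgt A b) \<psi>"
proof -
  have img: "(\<lambda>a. \<bar>\<psi> (cmp A b a)\<bar>) ` star A (src A b) = (\<lambda>h. \<bar>\<psi> h\<bar>) ` star A (tgt A b)"
    unfolding star_cmp_image[OF b, symmetric] image_image by simp
  show ?thesis
  proof (cases "bdd_above ((\<lambda>h. \<bar>\<psi> h\<bar>) ` star A (tgt A b))")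
    case True
    let ?\<chi> = "\<lambda>a\<in>star A (src A b). \<psi> (cmp A b a)"
    have \<chi>: "?\<chi> \<in> carrier (fib (linf_gmod A) (src A b))" using True img by (intro restrict_linf) simp
    have "m (tgt A b) (act (linf_gmod A) b ?\<chi>) = m (src A b) ?\<chi>"
      using m_gmap b \<chi> unfolding is_gmap_def trivial_gmod_simps by blast
    moreover have "act (linf_gmod A) b ?\<chi> = restrict \<psi> (star A (tgt A b))"
      unfolding linf_gmod_simps using b by (intro restrict_ext) (auto simp: star_def)
    ultimately show ?thesis using True img by (simp add: M_def)
  qed (simp add: M_def img)
qed

text \<open>The law of the random arrow \<open>x\<close> composed with \<open>ia a\<close>, where
  \<open>a\<close> is distributed by the mean at the source of \<open>x\<close>. If that source is
  no object of the subgroupoid, the law is Dirac at \<open>x\<close>. The object of \<open>A\<close>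
  is recovered by \<open>inv_into\<close>, which is unambiguous by injectivity of
  \<open>io\<close>.\<close>

definition mean_at :: "'m \<Rightarrow> ('m \<Rightarrow> real) \<Rightarrow> real" where
  "mean_at x \<phi> = (if src G x \<in> io ` objs A
     then M (inv_into (objs A) io (src G x)) (\<lambda>a. \<phi> (cmp G x (ia a))) else \<phi> x)"

lemma mean_at_io: "p \<in> objs A \<Longrightarrow> src G x = io p \<Longrightarrow> mean_at x = (\<lambda>\<phi>. M p (\<lambda>a. \<phi> (cmp G x (ia a))))"
  by (rule ext) (simp add: mean_at_def inv_into_f_f[OF inj_io])

lemma is_mean_mean_at:
  assumes "x \<in> X" "\<And>p a. p \<in> objs A \<Longrightarrow> src G x = io p \<Longrightarrow> a \<in> star A p \<Longrightarrow> cmp G x (ia a) \<in> X"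
  shows "is_mean X (mean_at x)"
proof (cases "src G x \<in> io ` objs A")
  case True
  then obtain p where p: "p \<in> objs A" "src G x = io p" by blast
  show ?thesis
    unfolding mean_at_io[OF p] by (rule is_mean_push_forward[OF is_mean_M[OF p(1)]]) (rule assms(2)[OF p])
next
  case False
  then have "mean_at x = (\<lambda>\<phi>. \<phi> x)" by (intro ext) (simp add: mean_at_def)
  with is_mean_dirac[OF assms(1)] show ?thesis by simp
qed

lemma mean_system_star: "mean_system (star G e) mean_at"
  by (rule mean_system.intro, rule is_mean_mean_at) (auto simp: star_def ia_closed tgt_ia)

text \<open>For \<open>x = ia a\<close> the random arrow stays in the subgroupoid, and invariance of
  the mean removes the dependence on \<open>a\<close>. Hence all vertices of a simplex of the
  subgroupoid receive the same mean.\<close>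

lemma mean_at_ia:
  assumes "a \<in> star A p"
  shows "mean_at (ia a) = (\<lambda>\<phi>. M p (\<lambda>h. \<phi> (ia h)))"
proof
  fix \<phi> :: "'m \<Rightarrow> real"
  have a: "a \<in> arrs A" "tgt A a = p" using assms by (simp_all add: star_def)
  have "mean_at (ia a) \<phi> = M (src A a) (\<lambda>b. \<phi> (cmp G (ia a) (ia b)))"
    using mean_at_io[of "src A a" "ia a"] a by (simp add: src_ia)
  also have "\<dots> = M (src A a) (\<lambda>b. \<phi> (ia (cmp A a b)))"
    using a by (intro is_mean.cong[OF is_mean_M]) (auto simp: ia_cmp star_def)
  also have "\<dots> = M p (\<lambda>h. \<phi> (ia h))" using M_invariant[OF a(1), of "\<lambda>h. \<phi> (ia h)"] a(2) by simp
  finally show "mean_at (ia a) \<phi> = M p (\<lambda>h. \<phi> (ia h))" .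
qed

lemma mean_system_ia:
  assumes p: "p \<in> objs A"
  shows "mean_system (ia ` star A p) mean_at"
proof (rule mean_system.intro)
  fix x assume "x \<in> ia ` star A p"
  then obtain a where a: "a \<in> star A p" "x = ia a" by blast
  show "is_mean (ia ` star A p) (mean_at x)"
    unfolding a(2) mean_at_ia[OF a(1)] by (rule is_mean_push_forward[OF is_mean_M[OF p]]) simp
qed

text \<open>Left multiplication does not change the source, hence not the mean used, and it commutes
  with the random right factor by associativity.\<close>

lemma mean_at_cmp:
  assumes "g \<in> arrs G" "x \<in> star G (src G g)"
  shows "mean_at (cmp G g x) = (\<lambda>\<phi>. mean_at x (\<lambda>y. \<phi> (cmp G g y)))"
proof
  fix \<phi> :: "'m \<Rightarrow> real"
  have x: "x \<in> arrs G" "tgt G x = src G g" using assms(2) by (simp_all add: star_def)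
  show "mean_at (cmp G g x) \<phi> = mean_at x (\<lambda>y. \<phi> (cmp G g y))"
  proof (cases "src G x \<in> io ` objs A")
    case True
    then obtain p where p: "p \<in> objs A" "src G x = io p" by blast
    then have gx: "src G (cmp G g x) = io p" using assms(1) x by simp
    show ?thesis
      unfolding mean_at_io[OF p] mean_at_io[OF p(1) gx]
      by (intro is_mean.cong[OF is_mean_M[OF p(1)]])
        (use assms(1) x p in \<open>simp add: star_def G.cmp_assoc ia_closed tgt_ia\<close>)
  qed (use assms(1) x in \<open>simp add: mean_at_def\<close>)
qed

section \<open>Average and homotopy as natural operations\<close>

lemma natural_operation_avg: "natural_operation G k k 1 (\<lambda>f xs. avg k (map mean_at xs) f)"
proof unfold_locales
  fix e K K' r f f' xs
  interpret mean_system "star G e" mean_at by (rule mean_system_star)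
  show "bounded_by (star G e) k K f \<Longrightarrow> bounded_by (star G e) k (1 * K) (\<lambda>xs. avg k (map mean_at xs) f)"
    unfolding bounded_by_def[of _ _ "1 * K"] using avg_bound[OF map_means] by auto
  assume xs: "xs \<in> tuples (star G e) k"
  show "(\<And>ys. ys \<in> tuples (star G e) k \<Longrightarrow> f ys = f' ys) \<Longrightarrow> avg k (map mean_at xs) f = avg k (map mean_at xs) f'"
    by (rule avg_cong[OF map_means[OF xs]])
  assume f: "bounded_by (star G e) k K f"
  show "avg k (map mean_at xs) (\<lambda>ys. r * f ys) = r * avg k (map mean_at xs) f"
    by (rule avg_mult[OF map_means[OF xs] f])
  assume "bounded_by (star G e) k K' f'"
  then show "avg k (map mean_at xs) (\<lambda>ys. f ys + f' ys) = avg k (map mean_at xs) f + avg k (map mean_at xs) f'"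
    by (rule avg_add[OF map_means[OF xs] f])
next
  fix g xs f assume g: "g \<in> arrs G" and xs: "xs \<in> tuples (star G (src G g)) k"
  show "avg k (map mean_at (map (cmp G g) xs)) f = avg k (map mean_at xs) (\<lambda>ys. f (map (cmp G g) ys))"
    using xs by (intro avg_natural mean_at_cmp[OF g]) (auto simp: tuples_def)
qed simp

lemma natural_operation_hmt: "natural_operation G (Suc k) k (hmt_bound k) (hmt mean_at k)"
proof unfold_locales
  fix e K K' r f f' xs
  interpret mean_system "star G e" mean_at by (rule mean_system_star)
  show "bounded_by (star G e) (Suc k) K f \<Longrightarrow> bounded_by (star G e) k (hmt_bound k * K) (hmt mean_at k f)"
    by (rule hmt_bounded_by)
  assume xs: "xs \<in> tuples (star G e) k"
  show "(\<And>ys. ys \<in> tuples (star G e) (Suc k) \<Longrightarrow> f ys = f' ys) \<Longrightarrow> hmt mean_at k f xs = hmt mean_at k f' xs"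
    by (rule hmt_cong[OF xs])
  assume f: "bounded_by (star G e) (Suc k) K f"
  show "hmt mean_at k (\<lambda>ys. r * f ys) xs = r * hmt mean_at k f xs" by (rule hmt_mult[OF xs f])
  assume "bounded_by (star G e) (Suc k) K' f'"
  then show "hmt mean_at k (\<lambda>ys. f ys + f' ys) xs = hmt mean_at k f xs + hmt mean_at k f' xs"
    by (rule hmt_add[OF xs f])
next
  fix g xs f assume g: "g \<in> arrs G" and xs: "xs \<in> tuples (star G (src G g)) k"
  show "hmt mean_at k f (map (cmp G g) xs) = hmt mean_at k (\<lambda>ys. f (map (cmp G g) ys)) xs"
    using xs by (intro hmt_natural mean_at_cmp[OF g]) (auto simp: tuples_def)
qed (rule hmt_bound_nonneg)

section \<open>Relative cochains in homogeneous coordinates\<close>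

lemma ia_tuples: "p \<in> objs A \<Longrightarrow> xs \<in> tuples (star A p) k \<Longrightarrow> map ia xs \<in> tuples (star G (io p)) k"
  by (erule tuples_map) (simp add: star_def ia_closed tgt_ia)

lemma ia_ginv: "a \<in> arrs A \<Longrightarrow> ia (ginv A a) = ginv G (ia a)"
  by (rule G.ginv_eqI[symmetric])
    (simp_all add: is_inverse_def ia_closed src_ia tgt_ia A.cmp_ginv_left A.cmp_ginv_right flip: ia_cmp ia_idn)

lemma inhomog_ia:
  assumes "xs \<in> tuples (star A p) k"
  shows "inhomog G (map ia xs) = map ia (inhomog A xs)"
proof (rule nth_equalityI)
  fix i assume "i < length (inhomog G (map ia xs))"
  then have i: "i < length xs" by simp
  have x: "xs ! j \<in> arrs A" "tgt A (xs ! j) = p" if "j < length xs" for j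
    using tuples_nth[OF assms, of j] tuples_length[OF assms] that by (simp_all add: star_def)
  show "inhomog G (map ia xs) ! i = map ia (inhomog A xs) ! i"
    using i x[of i] x[of "i - 1"] by (cases i) (simp_all add: nth_inhomog ia_cmp ia_ginv)
qed simp

definition relative_cochains :: "nat \<Rightarrow> ('o \<Rightarrow> 'm list fin_comb \<Rightarrow> 'v \<Rightarrow> real) set" where
  "relative_cochains k = {f \<in> carrier (V.cochains k). \<forall>e\<in>objs A. \<forall>c\<in>carrier (fib (chains A k) e).
     f (io e) (lin_ext (\<lambda>as. Poly_Mapping.single (map ia as) 1) c) = \<zero>\<^bsub>fib (dual_gmod G V) (io e)\<^esub>}"

lemma relative_bounded_cochains_eq:
  "relative_bounded_cochains A G io ia (dual_gmod G V)
    = subcomplex (bounded_cochains G (dual_gmod G V)) relative_cochains"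
  by (simp add: relative_bounded_cochains_def subcomplex_def relative_cochains_def[abs_def])

text \<open>Vanishing on chains of \<open>A\<close> can be tested on simplices by linearity. The
  functor \<open>ia\<close> commutes with the change of coordinates, so these are the tuples of
  vertices coming from a single star of \<open>A\<close>.\<close>

lemma relative_cochains_iff:
  "f \<in> relative_cochains k \<longleftrightarrow> f \<in> carrier (V.cochains k) \<and>
    (\<forall>p\<in>objs A. \<forall>xs\<in>tuples (ia ` star A p) (Suc k). \<forall>v\<in>carrier (fib V (io p)). ker G f (io p) xs v = 0)"
proof (cases "f \<in> carrier (V.cochains k)")
  case f: True
  let ?i = "\<lambda>c. lin_ext (\<lambda>as. Poly_Mapping.single (map ia as) (1::real)) c"
  have "(\<forall>c\<in>carrier (fib (chains A k) p). f (io p) (?i c) = \<zero>\<^bsub>fib (dual_gmod G V) (io p)\<^esub>)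
      \<longleftrightarrow> (\<forall>xs\<in>tuples (ia ` star A p) (Suc k). \<forall>v\<in>carrier (fib V (io p)). ker G f (io p) xs v = 0)"
    if p: "p \<in> objs A" for p
  proof -
    interpret q: normed_space_pair "fib V (io p)" real_space using io_closed[OF p] by (rule V.dual_pair)
    show ?thesis
    proof (intro iffI ballI)
      fix xs v assume vanish: "\<forall>c\<in>carrier (fib (chains A k) p). f (io p) (?i c) = \<zero>\<^bsub>fib (dual_gmod G V) (io p)\<^esub>"
        and xs: "xs \<in> tuples (ia ` star A p) (Suc k)" and v: "v \<in> carrier (fib V (io p))"
      have "xs \<in> lists (ia ` star A p)" using xs by (auto simp: tuples_def)
      then obtain ys where ys: "xs = map ia ys" "ys \<in> lists (star A p)" unfolding lists_image by blast
      then have ys': "ys \<in> tuples (star A p) (Suc k)" using xs by (auto simp: tuples_def)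
      have "Poly_Mapping.single (inhomog G xs) (1::real) = ?i (Poly_Mapping.single (inhomog A ys) 1)"
        by (simp add: ys(1) inhomog_ia[OF ys'] lin_ext_eq_lin_sum)
      then show "ker G f (io p) xs v = 0"
        using vanish A.inhomog_simplices[OF ys'] v by (simp add: ker_def)
    next
      fix c assume vanish: "\<forall>xs\<in>tuples (ia ` star A p) (Suc k). \<forall>v\<in>carrier (fib V (io p)). ker G f (io p) xs v = 0"
        and c: "c \<in> carrier (fib (chains A k) p)"
      have ia_homog: "map ia as = inhomog G (map ia (homog A as))" "map ia (homog A as) \<in> tuples (ia ` star A p) (Suc k)"
        "map ia as \<in> simplices G k (io p)" if "as \<in> Poly_Mapping.keys c" for as
      proof -
        have as: "as \<in> simplices A k p" using c that by auto
        note t = A.homog_tuples[OF as]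
        show eq: "map ia as = inhomog G (map ia (homog A as))" using inhomog_ia[OF t] A.inhomog_homog[OF as] by simp
        show "map ia (homog A as) \<in> tuples (ia ` star A p) (Suc k)" by (rule tuples_map[OF t]) simp
        show "map ia as \<in> simplices G k (io p)"
          unfolding eq by (rule G.inhomog_simplices[OF ia_tuples[OF p t]])
      qed
      have ic: "?i c \<in> carrier (fib (chains G k) (io p))"
        using keys_lin_sum[of "\<lambda>as. Poly_Mapping.single (map ia as) 1" c] ia_homog(3)
        by (fastforce simp: lin_ext_eq_lin_sum)
      show "f (io p) (?i c) = \<zero>\<^bsub>fib (dual_gmod G V) (io p)\<^esub>"
        unfolding V.dual_simps
      proof (rule q.bounded_maps_eqI[OF V.cochain_value[OF f io_closed[OF p] ic] q.bounded_maps_zero_closed])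
        fix v assume v: "v \<in> carrier (fib V (io p))"
        have "f (io p) (?i c) v = lin_sum (\<lambda>as. f (io p) (Poly_Mapping.single (map ia as) 1) v) c"
          using V.cochain_lin_sum[OF f io_closed[OF p] v ic] by (simp add: lin_ext_eq_lin_sum lin_sum_lin_sum)
        also have "\<dots> = lin_sum (\<lambda>as. 0) c"
        proof (rule lin_sum_cong)
          fix as assume as: "as \<in> Poly_Mapping.keys c"
          show "f (io p) (Poly_Mapping.single (map ia as) 1) v = 0"
            using vanish ia_homog(2)[OF as] v unfolding ia_homog(1)[OF as] ker_def by blast
        qed
        finally show "f (io p) (?i c) v = \<zero>\<^bsub>bounded_maps (fib V (io p)) real_space\<^esub> v"
          using v by (simp add: lin_sum_def)
      qed
    qed
  qed
  with f show ?thesis by (auto simp: relative_cochains_def)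
qed (simp add: relative_cochains_def)

lemma tuples_ia_star:
  "p \<in> objs A \<Longrightarrow> xs \<in> tuples (ia ` star A p) k \<Longrightarrow> xs \<in> tuples (star G (io p)) k"
  by (force simp: tuples_def star_def ia_closed tgt_ia)

lemma real_subspace_relative_cochains: "real_subspace (V.cochains k) (relative_cochains k)"
proof -
  interpret C: Module.module real_ring "V.cochains k" by (rule V.real_module_cochains)
  show ?thesis
  proof unfold_locales
    show "relative_cochains k \<subseteq> carrier (V.cochains k)" by (auto simp: relative_cochains_def)
    show "\<zero>\<^bsub>V.cochains k\<^esub> \<in> relative_cochains k"
      unfolding relative_cochains_iff using V.ker_zero io_closed tuples_ia_star by auto
    show "f \<oplus>\<^bsub>V.cochains k\<^esub> f' \<in> relative_cochains k" if "f \<in> relative_cochains k" "f' \<in> relative_cochains k" for f f'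
      using that V.ker_add[of f k f'] io_closed tuples_ia_star unfolding relative_cochains_iff by auto
    show "r \<odot>\<^bsub>V.cochains k\<^esub> f \<in> relative_cochains k" if "f \<in> relative_cochains k" for f r
      using that V.ker_smult[of f k _ _ _ r] io_closed tuples_ia_star C.smult_closed[of r f]
      unfolding relative_cochains_iff by auto
  qed
qed

section \<open>The retraction onto relative cochains\<close>

definition averaging where "averaging k = lift G V k (\<lambda>f xs. avg (Suc k) (map mean_at xs) f)"

text \<open>Cochains of degree \<open>k\<close> depend on \<open>Suc k\<close> vertices, so
  \<open>hmt\<close> at \<open>Suc k\<close> lowers the degree from \<open>Suc k\<close> to
  \<open>k\<close>.\<close>

definition homotopy where "homotopy k = lift G V k (hmt mean_at (Suc k))"

lemma averaging_closed: "f \<in> carrier (V.cochains k) \<Longrightarrow> averaging k f \<in> carrier (V.cochains k)"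
  unfolding averaging_def by (rule V.lift_closed[OF _ natural_operation_avg])

lemma ker_averaging:
  "e \<in> objs G \<Longrightarrow> xs \<in> tuples (star G e) (Suc k) \<Longrightarrow> v \<in> carrier (fib V e)
    \<Longrightarrow> ker G (averaging k f) e xs v = avg (Suc k) (map mean_at xs) (\<lambda>ys. ker G f e ys v)"
  unfolding averaging_def by (rule V.ker_lift)

lemma homotopy_closed: "f \<in> carrier (V.cochains (Suc k)) \<Longrightarrow> homotopy k f \<in> carrier (V.cochains k)"
  unfolding homotopy_def by (rule V.lift_closed[OF _ natural_operation_hmt])

lemma ker_homotopy:
  "e \<in> objs G \<Longrightarrow> xs \<in> tuples (star G e) (Suc k) \<Longrightarrow> v \<in> carrier (fib V e)
    \<Longrightarrow> ker G (homotopy k f) e xs v = hmt mean_at (Suc k) (\<lambda>ys. ker G f e ys v) xs"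
  unfolding homotopy_def by (rule V.ker_lift)

text \<open>By \<open>mean_at_ia\<close> all means along a simplex of the subgroupoid coincide, and
  \<open>avg_replicate\<close> applies because degree \<open>k > 0\<close> means at least two
  vertices.\<close>

lemma averaging_relative:
  assumes f: "f \<in> carrier (V.cochains k)" and k: "k > 0"
  shows "averaging k f \<in> relative_cochains k"
  unfolding relative_cochains_iff
proof (intro conjI ballI averaging_closed[OF f])
  fix p xs v assume p: "p \<in> objs A" and xs: "xs \<in> tuples (ia ` star A p) (Suc k)" and v: "v \<in> carrier (fib V (io p))"
  let ?M = "\<lambda>\<phi>. M p (\<lambda>h. \<phi> (ia h))"
  have "mean_at x = ?M" if "x \<in> set xs" for x
    using that xs mean_at_ia by (auto simp: tuples_def)
  then have "map mean_at xs = replicate (Suc k) ?M"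
    using tuples_length[OF xs] by (intro replicate_eqI) auto
  moreover have "is_mean (ia ` star A p) ?M" by (rule is_mean_push_forward[OF is_mean_M[OF p]]) simp
  ultimately show "ker G (averaging k f) (io p) xs v = 0"
    using avg_replicate[of _ ?M "Suc k"] k
    by (simp add: ker_averaging[OF io_closed[OF p] tuples_ia_star[OF p xs] v] del: replicate_Suc)
qed

lemma homotopy_relative:
  assumes f: "f \<in> relative_cochains (Suc k)"
  shows "homotopy k f \<in> relative_cochains k"
  unfolding relative_cochains_iff
proof (intro conjI ballI)
  show "homotopy k f \<in> carrier (V.cochains k)" using f relative_cochains_iff homotopy_closed by blast
  fix p xs v assume p: "p \<in> objs A" and xs: "xs \<in> tuples (ia ` star A p) (Suc k)" and v: "v \<in> carrier (fib V (io p))"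
  interpret mean_system "ia ` star A p" mean_at by (rule mean_system_ia[OF p])
  have "bounded_by (ia ` star A p) (Suc (Suc k)) 0 (\<lambda>ys. ker G f (io p) ys v)"
    using f p v by (auto simp: relative_cochains_iff bounded_by_def)
  from hmt_bounded_by[OF this] xs show "ker G (homotopy k f) (io p) xs v = 0"
    by (simp add: ker_homotopy[OF io_closed[OF p] tuples_ia_star[OF p xs] v] bounded_by_def del: hmt.simps)
qed

abbreviation "d \<equiv> cdiff (bounded_cochains G (dual_gmod G V))"

lemma averaging_cdiff:
  assumes f: "f \<in> carrier (V.cochains k)"
  shows "averaging (Suc k) (d k f) = d k (averaging k f)"
proof (rule V.cochain_eq_kerI[OF averaging_closed[OF V.cdiff_closed[OF f]] V.cdiff_closed[OF averaging_closed[OF f]]])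
  fix e xs v assume e: "e \<in> objs G" and xs: "xs \<in> tuples (star G e) (Suc (Suc k))" and v: "v \<in> carrier (fib V e)"
  interpret mean_system "star G e" mean_at by (rule mean_system_star)
  have "ker G (averaging (Suc k) (d k f)) e xs v
      = avg (Suc (Suc k)) (map mean_at xs) (cob (\<lambda>ys. ker G f e ys v))"
    unfolding ker_averaging[OF e xs v]
    by (rule avg_cong[OF map_means[OF xs]]) (rule V.ker_cdiff[OF f e _ v])
  also have "\<dots> = cob (\<lambda>ys. avg (Suc k) (map mean_at ys) (\<lambda>ys. ker G f e ys v)) xs"
    by (rule avg_cob_map[OF xs V.ker_bounded_by[OF f e v]])
  also have "\<dots> = cob (\<lambda>ys. ker G (averaging k f) e ys v) xs"
    by (rule cob_cong[OF xs]) (rule ker_averaging[OF e _ v, symmetric])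
  also have "\<dots> = ker G (d k (averaging k f)) e xs v"
    by (rule V.ker_cdiff[OF averaging_closed[OF f] e xs v, symmetric])
  finally show "ker G (averaging (Suc k) (d k f)) e xs v = ker G (d k (averaging k f)) e xs v" .
qed

lemma averaging_homotopy:
  assumes f: "f \<in> carrier (V.cochains (Suc k))" and cocycle: "d (Suc k) f = \<zero>\<^bsub>V.cochains (Suc (Suc k))\<^esub>"
  shows "averaging (Suc k) f = f \<oplus>\<^bsub>V.cochains (Suc k)\<^esub> d k (homotopy k f)"
proof -
  interpret C: Module.module real_ring "V.cochains (Suc k)" by (rule V.real_module_cochains)
  note hf = homotopy_closed[OF f]
  note dhf = V.cdiff_closed[OF hf]
  show ?thesis
  proof (rule V.cochain_eq_kerI[OF averaging_closed[OF f] C.a_closed[OF f dhf]])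
    fix e xs v assume e: "e \<in> objs G" and xs: "xs \<in> tuples (star G e) (Suc (Suc k))" and v: "v \<in> carrier (fib V e)"
    interpret mean_system "star G e" mean_at by (rule mean_system_star)
    let ?F = "\<lambda>ys. ker G f e ys v"
    \<comment> \<open>For a cocycle the coboundary is bounded by 0, so \<open>hmt_bounded_by\<close>
      removes the term of the homotopy formula that contains it.\<close>
    have "bounded_by (star G e) (Suc (Suc (Suc k))) 0 (cob ?F)"
      using V.ker_cdiff[OF f e _ v] V.ker_zero[OF e _ v] by (simp add: bounded_by_def cocycle)
    from hmt_bounded_by[OF this] xs have z: "hmt mean_at (Suc (Suc k)) (cob ?F) xs = 0"
      by (simp add: bounded_by_def del: hmt.simps)
    have "ker G (d k (homotopy k f)) e xs v = cob (hmt mean_at (Suc k) ?F) xs"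
      unfolding V.ker_cdiff[OF hf e xs v] by (rule cob_cong[OF xs]) (rule ker_homotopy[OF e _ v])
    also have "\<dots> = avg (Suc (Suc k)) (map mean_at xs) ?F - ?F xs"
      using hmt_homotopy[OF xs V.ker_bounded_by[OF f e v]] unfolding z by simp
    finally show "ker G (averaging (Suc k) f) e xs v
        = ker G (f \<oplus>\<^bsub>V.cochains (Suc k)\<^esub> d k (homotopy k f)) e xs v"
      unfolding V.ker_add[OF f dhf e xs v] ker_averaging[OF e xs v] by simp
  qed
qed

text \<open>\<open>k > 0\<close> ensures that averages are relative in both degrees involved. The
  norm condition holds because averaging is a natural operation with constant 1.\<close>

lemma cochain_retraction_averaging:
  assumes "k > 0"
  shows "cochain_retraction (bounded_cochains G (dual_gmod G V)) relative_cochains k averaging (homotopy k)"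
proof (rule cochain_retraction.intro)
  fix f assume f: "f \<in> carrier (V.cochains (Suc k))"
  show "vnorm (V.cochains (Suc k)) (averaging (Suc k) f) \<le> vnorm (V.cochains (Suc k)) f"
    using V.lift_norm[OF f natural_operation_avg] by (simp add: averaging_def)
qed (use assms in \<open>auto intro: V.real_module_cochains V.cdiff_linear_map V.cdiff_cdiff V.cochain_norm_nonneg
    real_subspace_relative_cochains averaging_relative averaging_cdiff homotopy_closed homotopy_relative
    averaging_homotopy\<close>)

end

theorem theorem5:
  fixes A :: "('p, 'q) gpd" and G :: "('o, 'm) gpd"
    and io :: "'p \<Rightarrow> 'o" and ia :: "'q \<Rightarrow> 'm"
    and V :: "('o, 'm, 'v) gmod" and n :: nat
  assumes "groupoid_pair A G io ia"
    and "amenable A"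
    and "banach_gmodule G V"
    and "n \<ge> 2"
  shows "isometric_isomorphism
    (cohomology (relative_bounded_cochains A G io ia (dual_gmod G V)) n)
    (cohomology (bounded_cochains G (dual_gmod G V)) n)
    (induced_map (relative_bounded_cochains A G io ia (dual_gmod G V))
      (bounded_cochains G (dual_gmod G V)) (\<lambda>k f. f) n)"
proof -
  obtain m where m: "is_gmap A (linf_gmod A) trivial_gmod m"
      "gmap_norm A (linf_gmod A) trivial_gmod m = 1"
      "\<And>e r. e \<in> objs A \<Longrightarrow> m e (\<lambda>h\<in>star A e. r) = r"
    using assms(2) unfolding amenable_def star_def by blast
  interpret amenable_pair A G io ia V m
    by (intro amenable_pair.intro amenable_pair_axioms.intro assms(1) m banach_gmodule.axioms(1)[OF assms(3)])
  \<comment> \<open>This is where \<open>n >= 2\<close> enters: the primitives have degree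
    \<open>k\<close>, and averages are relative only in positive degrees.\<close>
  obtain k where k: "n = Suc k" "k > 0" using assms(4) by (cases n) auto
  interpret cochain_retraction "bounded_cochains G (dual_gmod G V)" relative_cochains k averaging "homotopy k"
    by (rule cochain_retraction_averaging[OF k(2)])
  show ?thesis
    unfolding relative_bounded_cochains_eq k(1) by (rule isometric_isomorphism_induced_map)
qed

end
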